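(* Let $\Omega\subset\mathbb{R}^n$ be a bounded Lipschitz domain, let $G$ be a Young function with $g=G'$ satisfying $p^--1\le \frac{t g'(t)}{g(t)}\le p^+-1$ for all $t>0$, for some constants $1<p^-<p^+<\infty$ (so that also $p^-\le \frac{t g(t)}{G(t)}\le p^+$ for all $t>0$), and let $s\in(0,1]$. Let $u\in W^{s,G}_0(\Omega)\setminus\{0\}$. Then $u$ is a critical point of the functional $\mathcal{J}_s=\mathcal{H}_s/\mathcal{I}$ on $W^{s,G}_0(\Omega)\setminus\{0\}$ if and only if $u$ is a weak solution of the eigenvalue problem $$\mathcal{L}_s u=\lambda^s\, g\left(\frac{|u|}{\|u\|_G}\right)\frac{u}{|u|}\ \text{ in }\Omega,\qquad u=0\ \text{ in }\mathbb{R}^n\setminus\Omega,$$ for some $\lambda^s\in\mathbb{R}$, that is, there is $\lambda^s\in\mathbb{R}$ such that $$\langle \mathcal{L}_s u,v\rangle=\lambda^s\int_\Omega g\left(\frac{|u|}{\|u\|_G}\right)\frac{u\,v}{|u|}\,dx\qquad\text{for all } v\in W^{s,G}_0(\Omega).$$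
   Context: A Young function is $G:[0,\infty)\to[0,\infty)$ with $G(t)=\int_0^t g(\tau)\,d\tau$, where $g$ is right-continuous, positive on $(0,\infty)$, $g(0)=0$, non-decreasing, and $g(t)\to\infty$ as $t\to\infty$; $g$ is moreover differentiable on $(0,\infty)$. For $s\in(0,1)$ put $D_su(x,y)=\frac{u(x)-u(y)}{|x-y|^s}$ and $d\mu=\frac{dx\,dy}{|x-y|^n}$ on $\mathbb{R}^n\times\mathbb{R}^n$. Luxemburg norms: $\|u\|_G=\inf\{\tau>0:\int_\Omega G(|u|/\tau)\,dx\le1\}$, $\|\nabla u\|_G=\inf\{\tau>0:\int_\Omega G(|\nabla u|/\tau)\,dx\le1\}$, and, for $s\in(0,1)$, $[u]_{s,G}=\inf\{\tau>0:(1-s)\iint_{\mathbb{R}^n\times\mathbb{R}^n}G(|D_su|/\tau)\,d\mu\le1\}$. $W^{s,G}_0(\Omega)$ is the closure of $C_c^\infty(\Omega)$ (functions extended by $0$ outside $\Omega$) in the norm $\|u\|_G+[u]_{s,G}$ if $s\in(0,1)$, and in the norm $\|u\|_G+\|\nabla u\|_G$ if $s=1$. $\mathcal{I}(u)=\|u\|_G$; $\mathcal{H}_s(u)=[u]_{s,G}$ for $s\in(0,1)$ and $\mathcal{H}_1(u)=\|\nabla u\|_G$. For $u\ne0$, $\mathcal{L}_su$ is the element of the dual of $W^{s,G}_0(\Omega)$ given by $$\langle\mathcal{L}_su,v\rangle=(1-s)\iint_{\mathbb{R}^n\times\mathbb{R}^n}g\left(\frac{|D_su|}{[u]_{s,G}}\right)\frac{D_su}{|D_su|}D_sv\,d\mu\quad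 (0<s<1),$$ $$\langle\mathcal{L}_1u,v\rangle=\int_\Omega g\left(\frac{|\nabla u|}{\|\nabla u\|_G}\right)\frac{\nabla u\cdot\nabla v}{|\nabla u|}\,dx .$$ Expressions $g(|a|)\frac{a}{|a|}$ are understood as $0$ where $a=0$. *)

theory Defs
  imports "HOL-Analysis.Analysis"
begin

text \<open>Only the values of \<open>G\<close> and \<open>g\<close> on the half line \<open>{0..}\<close> matter; they are total
  functions on the reals whose values at negative arguments are never used.\<close>

definition young_function :: "(real \<Rightarrow> real) \<Rightarrow> (real \<Rightarrow> real) \<Rightarrow> bool" where
  "young_function G g \<longleftrightarrow>
     (\<forall>t\<ge>0. (g has_integral G t) {0..t}) \<and>
     (\<forall>t\<ge>0. continuous (at_right t) g) \<and>
     (\<forall>t>0. g t > 0) \<and> g 0 = 0 \<and>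
     mono_on {0..} g \<and>
     filterlim g at_top at_top \<and>
     (\<forall>t>0. g differentiable (at t))"

text \<open>Near each boundary point the domain is the part of a ball lying above the graph of a
  Lipschitz function, in the Cartesian coordinates whose last axis points in the direction
  \<open>e\<close>; the graph function lives on the hyperplane orthogonal to \<open>e\<close>.\<close>

definition bounded_lipschitz_domain :: "'a::euclidean_space set \<Rightarrow> bool" where
  "bounded_lipschitz_domain \<Omega> \<longleftrightarrow>
     \<Omega> \<noteq> {} \<and> open \<Omega> \<and> connected \<Omega> \<and> bounded \<Omega> \<and>
     (\<forall>x\<^sub>0\<in>frontier \<Omega>. \<exists>e r L \<gamma>. norm e = 1 \<and> r > 0 \<and>
        L-lipschitz_on {z. z \<bullet> e = 0} \<gamma> \<and>
        \<Omega> \<inter> ball x\<^sub>0 r = {x \<in> ball x\<^sub>0 r. \<gamma> (x - (x \<bullet> e) *\<^sub>R e) < x \<bullet> e})"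

primrec C_k :: "nat \<Rightarrow> ('a::euclidean_space \<Rightarrow> real) \<Rightarrow> bool" where
  "C_k 0 f \<longleftrightarrow> continuous_on UNIV f"
| "C_k (Suc k) f \<longleftrightarrow> (\<forall>x. f differentiable (at x)) \<and>
     (\<forall>b\<in>Basis. C_k k (\<lambda>x. frechet_derivative f (at x) b))"

definition test_functions :: "'a::euclidean_space set \<Rightarrow> ('a \<Rightarrow> real) set" where
  "test_functions \<Omega> = {\<phi>. (\<forall>k. C_k k \<phi>) \<and>
     compact (closure {x. \<phi> x \<noteq> 0}) \<and> closure {x. \<phi> x \<noteq> 0} \<subseteq> \<Omega>}"

definition weak_gradient ::
    "'a::euclidean_space set \<Rightarrow> ('a \<Rightarrow> real) \<Rightarrow> ('a \<Rightarrow> 'a) \<Rightarrow> bool" where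
  "weak_gradient \<Omega> u V \<longleftrightarrow>
     V \<in> borel_measurable borel \<and>
     (\<forall>K. compact K \<and> K \<subseteq> \<Omega> \<longrightarrow> set_integrable lborel K u \<and> set_integrable lborel K V) \<and>
     (\<forall>\<phi>\<in>test_functions \<Omega>. \<forall>b\<in>Basis.
        (LINT x:\<Omega>|lborel. u x * frechet_derivative \<phi> (at x) b)
          = - (LINT x:\<Omega>|lborel. (V x \<bullet> b) * \<phi> x))"

text \<open>The weak gradient is unique almost everywhere on \<open>\<Omega>\<close>; \<open>grad\<close> picks a representative
  and is meaningful only when a weak gradient exists.\<close>

definition grad :: "'a::euclidean_space set \<Rightarrow> ('a \<Rightarrow> real) \<Rightarrow> 'a \<Rightarrow> 'a" where
  "grad \<Omega> u = (SOME V. weak_gradient \<Omega> u V)"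

text \<open>The quotient is \<open>0\<close> on the diagonal, which is a null set.\<close>

definition D_s :: "real \<Rightarrow> ('a::euclidean_space \<Rightarrow> real) \<Rightarrow> 'a \<times> 'a \<Rightarrow> real" where
  "D_s s u = (\<lambda>(x, y). (u x - u y) / norm (x - y) powr s)"

definition mu :: "('a::euclidean_space \<times> 'a) measure" where
  "mu = density (lborel \<Otimes>\<^sub>M lborel) (\<lambda>(x, y). ennreal (1 / norm (x - y) ^ DIM('a)))"

text \<open>The Luxemburg norm belonging to a family of modulars, \<open>\<rho> \<tau>\<close> being the modular of the
  function divided by \<open>\<tau>\<close>. It takes the value \<open>\<infinity>\<close> when no \<open>\<tau>\<close> is admissible.\<close>

definition luxemburg :: "(real \<Rightarrow> ennreal) \<Rightarrow> ennreal" where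
  "luxemburg \<rho> = Inf {ennreal \<tau> | \<tau>. \<tau> > 0 \<and> \<rho> \<tau> \<le> 1}"

definition norm_G ::
    "(real \<Rightarrow> real) \<Rightarrow> 'a::euclidean_space set \<Rightarrow> ('a \<Rightarrow> real) \<Rightarrow> ennreal" where
  "norm_G G \<Omega> u = luxemburg (\<lambda>\<tau>. \<integral>\<^sup>+x\<in>\<Omega>. ennreal (G (\<bar>u x\<bar> / \<tau>)) \<partial>lborel)"

definition norm_grad_G ::
    "(real \<Rightarrow> real) \<Rightarrow> 'a::euclidean_space set \<Rightarrow> ('a \<Rightarrow> real) \<Rightarrow> ennreal" where
  "norm_grad_G G \<Omega> u = luxemburg (\<lambda>\<tau>. \<integral>\<^sup>+x\<in>\<Omega>. ennreal (G (norm (grad \<Omega> u x) / \<tau>)) \<partial>lborel)"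

definition seminorm_sG ::
    "(real \<Rightarrow> real) \<Rightarrow> real \<Rightarrow> ('a::euclidean_space \<Rightarrow> real) \<Rightarrow> ennreal" where
  "seminorm_sG G s u =
     luxemburg (\<lambda>\<tau>. ennreal (1 - s) * (\<integral>\<^sup>+z. ennreal (G (\<bar>D_s s u z\<bar> / \<tau>)) \<partial>mu))"

definition energy_norm ::
    "(real \<Rightarrow> real) \<Rightarrow> real \<Rightarrow> 'a::euclidean_space set \<Rightarrow> ('a \<Rightarrow> real) \<Rightarrow> ennreal" where
  "energy_norm G s \<Omega> u = (if s = 1 then norm_grad_G G \<Omega> u else seminorm_sG G s u)"

definition W_norm ::
    "(real \<Rightarrow> real) \<Rightarrow> real \<Rightarrow> 'a::euclidean_space set \<Rightarrow> ('a \<Rightarrow> real) \<Rightarrow> ennreal" where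
  "W_norm G s \<Omega> u = norm_G G \<Omega> u + energy_norm G s \<Omega> u"

text \<open>Functions stand for their classes modulo equality almost everywhere; every class
  of Lebesgue measurable functions has a Borel representative.\<close>

definition W_sG ::
    "(real \<Rightarrow> real) \<Rightarrow> real \<Rightarrow> 'a::euclidean_space set \<Rightarrow> ('a \<Rightarrow> real) set" where
  "W_sG G s \<Omega> = {u \<in> borel_measurable borel.
     (AE x in lborel. x \<notin> \<Omega> \<longrightarrow> u x = 0) \<and>
     (s = 1 \<longrightarrow> (\<exists>V. weak_gradient \<Omega> u V)) \<and>
     W_norm G s \<Omega> u < \<infinity>}"

definition W0_sG ::
    "(real \<Rightarrow> real) \<Rightarrow> real \<Rightarrow> 'a::euclidean_space set \<Rightarrow> ('a \<Rightarrow> real) set" where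
  "W0_sG G s \<Omega> = {u \<in> W_sG G s \<Omega>.
     \<forall>\<epsilon>>0. \<exists>\<phi>\<in>test_functions \<Omega>. W_norm G s \<Omega> (\<lambda>x. u x - \<phi> x) < ennreal \<epsilon>}"

definition W0_sG_nonzero ::
    "(real \<Rightarrow> real) \<Rightarrow> real \<Rightarrow> 'a::euclidean_space set \<Rightarrow> ('a \<Rightarrow> real) set" where
  "W0_sG_nonzero G s \<Omega> = {u \<in> W0_sG G s \<Omega>. \<not> (AE x in lborel. u x = 0)}"

definition I_fun ::
    "(real \<Rightarrow> real) \<Rightarrow> 'a::euclidean_space set \<Rightarrow> ('a \<Rightarrow> real) \<Rightarrow> real" where
  "I_fun G \<Omega> u = enn2real (norm_G G \<Omega> u)"

definition H_fun ::
    "(real \<Rightarrow> real) \<Rightarrow> real \<Rightarrow> 'a::euclidean_space set \<Rightarrow> ('a \<Rightarrow> real) \<Rightarrow> real" where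
  "H_fun G s \<Omega> u = enn2real (energy_norm G s \<Omega> u)"

definition J_fun ::
    "(real \<Rightarrow> real) \<Rightarrow> real \<Rightarrow> 'a::euclidean_space set \<Rightarrow> ('a \<Rightarrow> real) \<Rightarrow> real" where
  "J_fun G s \<Omega> u = H_fun G s \<Omega> u / I_fun G \<Omega> u"

text \<open>Frechet differentiability at \<open>u\<close> of a functional \<open>J\<close> on the subset \<open>U\<close> of the space \<open>W\<close> of
  functions with norm \<open>N\<close>, the derivative \<open>L\<close> being a bounded linear functional on \<open>W\<close>. It is
  spelled out because a function space with a given norm is not a normed-space type.\<close>

definition has_frechet_derivative_in ::
    "('a \<Rightarrow> real) set \<Rightarrow> (('a \<Rightarrow> real) \<Rightarrow> real) \<Rightarrow> ('a \<Rightarrow> real) set \<Rightarrow>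
     (('a \<Rightarrow> real) \<Rightarrow> real) \<Rightarrow> (('a \<Rightarrow> real) \<Rightarrow> real) \<Rightarrow> ('a \<Rightarrow> real) \<Rightarrow> bool" where
  "has_frechet_derivative_in W N U J L u \<longleftrightarrow>
     (\<forall>v\<in>W. \<forall>w\<in>W. \<forall>a b. L (\<lambda>x. a * v x + b * w x) = a * L v + b * L w) \<and>
     (\<exists>C. \<forall>v\<in>W. \<bar>L v\<bar> \<le> C * N v) \<and>
     (\<forall>\<epsilon>>0. \<exists>\<delta>>0. \<forall>v\<in>W. (\<lambda>x. u x + v x) \<in> U \<and> N v < \<delta> \<longrightarrow>
        \<bar>J (\<lambda>x. u x + v x) - J u - L v\<bar> \<le> \<epsilon> * N v)"

definition critical_point ::
    "('a \<Rightarrow> real) set \<Rightarrow> (('a \<Rightarrow> real) \<Rightarrow> real) \<Rightarrow> ('a \<Rightarrow> real) set \<Rightarrow>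
     (('a \<Rightarrow> real) \<Rightarrow> real) \<Rightarrow> ('a \<Rightarrow> real) \<Rightarrow> bool" where
  "critical_point W N U J u \<longleftrightarrow> u \<in> U \<and> has_frechet_derivative_in W N U J (\<lambda>_. 0) u"

text \<open>In the integrands below, division by zero being zero gives the convention that
  \<open>g(|a|) a/|a|\<close> vanishes where \<open>a = 0\<close>.\<close>

definition L_op ::
    "(real \<Rightarrow> real) \<Rightarrow> (real \<Rightarrow> real) \<Rightarrow> real \<Rightarrow> 'a::euclidean_space set \<Rightarrow>
     ('a \<Rightarrow> real) \<Rightarrow> ('a \<Rightarrow> real) \<Rightarrow> real" where
  "L_op G g s \<Omega> u v =
     (if s = 1 then
        (LINT x:\<Omega>|lborel. g (norm (grad \<Omega> u x) / H_fun G s \<Omega> u) *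
           ((grad \<Omega> u x \<bullet> grad \<Omega> v x) / norm (grad \<Omega> u x)))
      else
        (1 - s) * (LINT z|mu. g (\<bar>D_s s u z\<bar> / H_fun G s \<Omega> u) *
           (D_s s u z / \<bar>D_s s u z\<bar>) * D_s s v z))"

text \<open>The condition \<open>u = 0\<close> outside \<open>\<Omega>\<close> is part of membership in the space.\<close>

definition weak_eigen_solution ::
    "(real \<Rightarrow> real) \<Rightarrow> (real \<Rightarrow> real) \<Rightarrow> real \<Rightarrow> 'a::euclidean_space set \<Rightarrow>
     real \<Rightarrow> ('a \<Rightarrow> real) \<Rightarrow> bool" where
  "weak_eigen_solution G g s \<Omega> lam u \<longleftrightarrow>
     u \<in> W0_sG G s \<Omega> \<and>
     (\<forall>v\<in>W0_sG G s \<Omega>. L_op G g s \<Omega> u v =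
        lam * (LINT x:\<Omega>|lborel. g (\<bar>u x\<bar> / I_fun G \<Omega> u) * (u x * v x / \<bar>u x\<bar>)))"

end

(* Both the norm and the energy are Luxemburg norms of a vector-valued function depending linearly on
   u: u itself, its gradient, or its difference quotient D_s u. Convexity of G bounds the modular below by
   its linearisation; splitting according to whether the increment is pointwise small compared
   with the function, the growth conditions on g bound the remainder above by o(1) times the norm of the increment. So the modular is
   Frechet differentiable, and since it is 1 at a normalised function, so is the Luxemburg norm N, with
   derivative N(F) A(V) / A(F) at F, where A is the dual form of F. The derivative of H/I at u
   therefore vanishes iff the dual forms of energy and norm are proportional. Nothing is divided by
   zero because a function in the closure of the test functions with vanishing energy is zero. *)

theory Submission
  imports Defs
begin

section \<open>Young functions with two-sided power growth\<close>

text \<open>A pointwise expansion of G(|a + h|) is not uniform where |h| is large against |a|, while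
  a Frechet derivative needs an error controlled by the norm of the increment alone. The increment
  is therefore written as its norm \<nu> times a function U of norm 1, whose modular is exactly 1.
  Where |\<nu> U| \<le> \<theta> |F| the flux varies by a small relative amount; elsewhere a factor
  \<nu>^(pm - 1) is gained, which is small because pm > 1. The order matters: \<theta> is fixed
  before \<nu>, since the constant of the second case blows up as \<theta> tends to 0. The upper
  exponent pp gives a doubling bound, which makes modulars finite at every scale and forces the
  modular to be 1 at norm 1. A separate obstacle is that \<open>grad\<close> selects a weak gradient
  by choice, so it is linear only up to null sets; hence the fundamental lemma with its explicit
  bumps. As for zero energy: if s = 1, a Poincare estimate for test functions survives the passage
  to the closure; if s < 1, the function is constant almost everywhere, and boundedness of the
  domain makes the constant 0.\<close>

locale orlicz =
  fixes G g :: "real \<Rightarrow> real" and pm pp :: real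
  assumes young: "young_function G g"
    and pm_gt_1: "1 < pm" and pm_less_pp: "pm < pp"
    and growth: "\<And>t. t > 0 \<Longrightarrow> pm - 1 \<le> t * deriv g t / g t \<and> t * deriv g t / g t \<le> pp - 1"
begin

lemma g_pos: "t > 0 \<Longrightarrow> g t > 0"
  using young by (simp add: young_function_def)

lemma g_0 [simp]: "g 0 = 0"
  using young by (simp add: young_function_def)

lemma g_mono: "0 \<le> a \<Longrightarrow> a \<le> b \<Longrightarrow> g a \<le> g b"
  using young by (auto simp: young_function_def mono_on_def)

lemma g_nonneg: "t \<ge> 0 \<Longrightarrow> g t \<ge> 0"
  using g_mono[of 0 t] by simp

lemma g_has_integral_diff:
  assumes "0 \<le> a" "a \<le> b" shows "(g has_integral (G b - G a)) {a..b}"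
proof -
  have i: "(g has_integral G t) {0..t}" if "t \<ge> 0" for t
    using young that by (simp add: young_function_def)
  have "g integrable_on {0..b}" using i[of b] assms by (auto simp: has_integral_integrable)
  hence "g integrable_on {a..b}"
    by (rule integrable_on_subinterval) (use assms in auto)
  hence J: "(g has_integral integral {a..b} g) {a..b}" by (simp add: has_integral_integral)
  have "(g has_integral (G a + integral {a..b} g)) {0..b}"
    by (rule has_integral_combine[OF _ _ i J]) (use assms in auto)
  hence "G a + integral {a..b} g = G b"
    using i[of b] assms by (meson has_integral_unique order_trans)
  hence "integral {a..b} g = G b - G a" by simp
  thus ?thesis using J by simp
qed

lemma G_diff_bounds:
  assumes "0 \<le> a" "a \<le> b"
  shows "(b - a) * g a \<le> G b - G a" "G b - G a \<le> (b - a) * g b"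
proof -
  have c: "((\<lambda>_. c) has_integral ((b - a) * c)) {a..b}" for c :: real
    using has_integral_const_real[of c a b] assms by simp
  show "(b - a) * g a \<le> G b - G a"
    by (rule has_integral_le[OF c g_has_integral_diff[OF assms]]) (use assms in \<open>auto intro: g_mono\<close>)
  show "G b - G a \<le> (b - a) * g b"
    by (rule has_integral_le[OF g_has_integral_diff[OF assms] c]) (use assms in \<open>auto intro: g_mono\<close>)
qed

lemma G_tangent:
  assumes "0 \<le> a" "0 \<le> b" shows "(b - a) * g a \<le> G b - G a"
proof (cases "a \<le> b")
  case True thus ?thesis using G_diff_bounds(1) assms by blast
next
  case False thus ?thesis using G_diff_bounds(2)[of b a] assms by (simp add: algebra_simps)
qed

lemma G_0 [simp]: "G 0 = 0"
proof -
  have "(g has_integral G 0) {0..0}" using young unfolding young_function_def by blast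
  moreover have "(g has_integral 0) {0..0}" using has_integral_refl(2)[of g 0] by simp
  ultimately show ?thesis by (rule has_integral_unique)
qed

lemma G_mono: "0 \<le> a \<Longrightarrow> a \<le> b \<Longrightarrow> G a \<le> G b"
  using G_diff_bounds(1)[of a b] g_nonneg[of a] mult_nonneg_nonneg[of "b - a" "g a"] by linarith

lemma G_nonneg: "t \<ge> 0 \<Longrightarrow> G t \<ge> 0"
  using G_mono[of 0 t] by simp

lemma G_convex:
  assumes "0 \<le> a" "0 \<le> b" "0 \<le> x" "0 \<le> y" "x + y = 1"
  shows "G (x * a + y * b) \<le> x * G a + y * G b"
proof -
  define m where "m = x * a + y * b"
  have m: "0 \<le> m" using assms by (simp add: m_def)
  have "x * ((a - m) * g m) \<le> x * (G a - G m)"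
    using G_tangent[OF m assms(1)] assms by (intro mult_left_mono) auto
  moreover have "y * ((b - m) * g m) \<le> y * (G b - G m)"
    using G_tangent[OF m assms(2)] assms by (intro mult_left_mono) auto
  moreover have "x * ((a - m) * g m) + y * ((b - m) * g m) = (m - (x + y) * m) * g m"
    by (simp add: m_def algebra_simps)
  moreover have "x * (G a - G m) + y * (G b - G m) = x * G a + y * G b - (x + y) * G m"
    by (simp add: algebra_simps)
  ultimately show ?thesis using assms(5) by (simp add: m_def)
qed

lemma G_scale_le: "0 \<le> t \<Longrightarrow> 0 \<le> l \<Longrightarrow> l \<le> 1 \<Longrightarrow> G (l * t) \<le> l * G t"
  using G_convex[of t 0 l "1 - l"] by simp

section \<open>Power-type scaling bounds from the growth condition\<close>

lemma g_has_derivative: "t > 0 \<Longrightarrow> (g has_real_derivative deriv g t) (at t)"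
  using young by (simp add: young_function_def DERIV_deriv_iff_real_differentiable)

text \<open>The sign of this derivative is the sign of \<open>t * deriv g t - q * g t\<close>, which
  the growth condition decides for \<open>q = pp - 1\<close> and \<open>q = pm - 1\<close>.\<close>

lemma g_powr_has_derivative:
  assumes "t > 0"
  shows "((\<lambda>x. g x * x powr (- q)) has_real_derivative
    (t powr (- q - 1) * (t * deriv g t - q * g t))) (at t)"
proof -
  have "((\<lambda>x. x powr (- q)) has_real_derivative (- q * t powr (- q - 1))) (at t)"
    using assms by (auto intro!: derivative_eq_intros)
  moreover have "t powr (- q) = t powr (- q - 1) * t"
    using assms by (simp add: powr_diff)
  ultimately show ?thesis
    using assms by (auto intro!: derivative_eq_intros g_has_derivative simp: algebra_simps)
qed

text \<open>The upper growth bound makes \<open>g t * t powr (- (pp - 1))\<close> non-increasing on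
  the positive half line; compare its values at \<open>t\<close> and \<open>l * t\<close>.\<close>

lemma g_scale_up:
  assumes "1 \<le> l" "0 \<le> t" shows "g (l * t) \<le> l powr (pp - 1) * g t"
proof (cases "t = 0")
  case False
  hence t: "t > 0" using assms by simp
  have "g (l * t) * (l * t) powr (- (pp - 1)) \<le> g t * t powr (- (pp - 1))"
  proof (rule DERIV_nonpos_imp_nonincreasing[where f = \<open>\<lambda>x. g x * x powr (- (pp - 1))\<close>])
    show "t \<le> l * t" using assms t by simp
    fix x assume x: "t \<le> x" "x \<le> l * t"
    have "x * deriv g x \<le> (pp - 1) * g x"
      using growth[of x] g_pos[of x] x t by (simp add: field_simps)
    hence "x powr (- (pp - 1) - 1) * (x * deriv g x - (pp - 1) * g x) \<le> 0"
      by (intro mult_nonneg_nonpos) auto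
    thus "\<exists>y. ((\<lambda>x. g x * x powr (- (pp - 1))) has_real_derivative y) (at x) \<and> y \<le> 0"
      using g_powr_has_derivative[of x] x t by (metis order_less_le_trans)
  qed
  hence "g (l * t) * (l powr (- (pp - 1)) * t powr (- (pp - 1))) \<le> g t * t powr (- (pp - 1))"
    using assms by (simp add: powr_mult)
  hence "(g (l * t) * l powr (- (pp - 1))) * t powr (- (pp - 1)) \<le> g t * t powr (- (pp - 1))"
    by (simp add: mult.assoc)
  hence "g (l * t) * l powr (- (pp - 1)) \<le> g t" using t by simp
  hence "(g (l * t) * l powr (- (pp - 1))) * l powr (pp - 1) \<le> g t * l powr (pp - 1)"
    by (rule mult_right_mono) simp
  moreover have "l powr (- (pp - 1)) * l powr (pp - 1) = 1"
    using assms by (simp add: powr_add[symmetric])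
  ultimately show ?thesis by (simp only: mult.assoc) (simp add: mult.commute)
qed simp

text \<open>The lower growth bound makes \<open>g t * t powr (- (pm - 1))\<close> non-decreasing.
  Since \<open>pm > 1\<close>, shrinking the argument shrinks \<open>g\<close> by a positive power,
  the source of the small factor in \<open>G_norm_expand\<close>.\<close>

lemma g_scale_down:
  assumes "0 \<le> l" "l \<le> 1" "0 \<le> t" shows "g (l * t) \<le> l powr (pm - 1) * g t"
proof (cases "t = 0 \<or> l = 0")
  case False
  hence t: "t > 0" "l > 0" using assms by auto
  have "g (l * t) * (l * t) powr (- (pm - 1)) \<le> g t * t powr (- (pm - 1))"
  proof (rule DERIV_nonneg_imp_nondecreasing[where f = \<open>\<lambda>x. g x * x powr (- (pm - 1))\<close>])
    show "l * t \<le> t" using assms t by simp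
    fix x assume x: "l * t \<le> x" "x \<le> t"
    hence x0: "x > 0" using t by (meson mult_pos_pos order_less_le_trans)
    have "x * deriv g x \<ge> (pm - 1) * g x"
      using growth[of x] g_pos[of x] x0 by (simp add: field_simps)
    hence "x powr (- (pm - 1) - 1) * (x * deriv g x - (pm - 1) * g x) \<ge> 0"
      by (intro mult_nonneg_nonneg) auto
    thus "\<exists>y. ((\<lambda>x. g x * x powr (- (pm - 1))) has_real_derivative y) (at x) \<and> 0 \<le> y"
      using g_powr_has_derivative[of x] x0 by metis
  qed
  hence "g (l * t) * (l powr (- (pm - 1)) * t powr (- (pm - 1))) \<le> g t * t powr (- (pm - 1))"
    using assms by (simp add: powr_mult)
  hence "(g (l * t) * l powr (- (pm - 1))) * t powr (- (pm - 1)) \<le> g t * t powr (- (pm - 1))"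
    by (simp add: mult.assoc)
  hence "g (l * t) * l powr (- (pm - 1)) \<le> g t" using t by simp
  hence "(g (l * t) * l powr (- (pm - 1))) * l powr (pm - 1) \<le> g t * l powr (pm - 1)"
    by (rule mult_right_mono) simp
  moreover have "l powr (- (pm - 1)) * l powr (pm - 1) = 1"
    using t by (simp add: powr_add[symmetric])
  ultimately show ?thesis by (simp only: mult.assoc) (simp add: mult.commute)
qed auto

text \<open>A convenient, not a sharp, constant for bounding \<open>t * g t\<close> by a multiple of
  \<open>G t\<close>; its value is what the halving argument in \<open>t_g_le_G\<close>
  produces.\<close>

definition growth_const :: real where "growth_const = 2 powr pp"

lemma growth_const_pos: "growth_const > 0"
  by (simp add: growth_const_def)

text \<open>\<open>G t\<close> is at least the integral of \<open>g\<close> over the upper half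
  \<open>{t/2..t}\<close>, hence at least \<open>t/2 * g (t/2)\<close>, and doubling the argument
  costs \<open>g\<close> at most the factor \<open>2 powr (pp - 1)\<close>.\<close>

lemma t_g_le_G:
  assumes "0 \<le> t" shows "t * g t \<le> growth_const * G t"
proof -
  have "g (2 * (t / 2)) \<le> 2 powr (pp - 1) * g (t / 2)"
    by (rule g_scale_up) (use assms in auto)
  hence "t * g t \<le> t * (2 powr (pp - 1) * g (t / 2))"
    using assms by (intro mult_left_mono) auto
  also have "\<dots> = growth_const * ((t - t / 2) * g (t / 2))"
    by (simp add: growth_const_def powr_diff)
  also have "\<dots> \<le> growth_const * (G t - G (t / 2))"
    using G_diff_bounds(1)[of "t/2" t] assms growth_const_pos by (intro mult_left_mono) auto
  also have "\<dots> \<le> growth_const * G t"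
    using G_nonneg[of "t/2"] assms growth_const_pos by (intro mult_left_mono) auto
  finally show ?thesis .
qed

lemma G_le_t_g: "0 \<le> t \<Longrightarrow> G t \<le> t * g t"
  using G_diff_bounds(2)[of 0 t] by simp

text \<open>The form of the factor serves two purposes: it is finite for every \<open>l\<close>,
  which carries finiteness of the modular between scales, and it tends to 1 as \<open>l\<close>
  decreases to 1, which fixes the modular at norm 1.\<close>

lemma G_scale_up:
  assumes "1 \<le> l" "0 \<le> t"
  shows "G (l * t) \<le> (1 + growth_const * ((l - 1) * l powr (pp - 1))) * G t"
proof -
  have le: "t \<le> l * t" using assms by (simp add: mult_le_cancel_right1)
  have "G (l * t) - G t \<le> (l * t - t) * g (l * t)"
    using G_diff_bounds(2)[of t "l * t"] le assms by simp
  also have "\<dots> \<le> (l * t - t) * (l powr (pp - 1) * g t)"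
    using le assms g_scale_up by (intro mult_left_mono) auto
  also have "\<dots> = (l - 1) * l powr (pp - 1) * (t * g t)" by (simp add: algebra_simps)
  also have "\<dots> \<le> (l - 1) * l powr (pp - 1) * (growth_const * G t)"
    using assms t_g_le_G by (intro mult_left_mono) auto
  finally show ?thesis by (simp add: algebra_simps)
qed

text \<open>Takes the place of Young's inequality with the conjugate function: replace both
  arguments by their maximum and apply \<open>t_g_le_G\<close>.\<close>

lemma g_times_le_G:
  assumes "0 \<le> a" "0 \<le> b" shows "g a * b \<le> growth_const * (G a + G b)"
proof -
  define m where "m = max a b"
  have "g a * b \<le> g m * m"
    using assms by (intro mult_mono g_mono g_nonneg) (auto simp: m_def)
  also have "\<dots> \<le> growth_const * G m" using t_g_le_G[of m] assms by (simp add: m_def mult.commute)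
  also have "\<dots> \<le> growth_const * (G a + G b)"
    using G_nonneg assms growth_const_pos by (intro mult_left_mono) (auto simp: m_def max_def)
  finally show ?thesis .
qed

text \<open>The tangent inequality at 1. It lets the modular control the L^1 norm on a set of finite
  measure, see \<open>L1_le_lux\<close>.\<close>

lemma t_le_G: "0 \<le> t \<Longrightarrow> t \<le> 1 + G t / g 1"
  using G_tangent[of 1 t] G_nonneg[of 1] g_pos[of 1] by (simp add: field_simps)

lemma G_pos: "t > 0 \<Longrightarrow> G t > 0"
  using t_g_le_G[of t] g_pos[of t] growth_const_pos
  by (metis less_le_trans mult_pos_pos order_less_imp_le zero_less_mult_pos)

text \<open>Nothing is known about \<open>G\<close> at negative arguments. Precomposing with
  \<open>max 0\<close> gives a function that is monotone on the whole line, hence Borel.\<close>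

lemma measurable_G_nonneg:
  assumes [measurable]: "f \<in> borel_measurable M" and "\<And>x. f x \<ge> 0"
  shows "(\<lambda>x. G (f x)) \<in> borel_measurable M"
proof -
  have [measurable]: "(\<lambda>t. G (max 0 t)) \<in> borel_measurable borel"
    by (rule borel_measurable_mono) (auto simp: mono_def intro!: G_mono)
  have "(\<lambda>x. G (max 0 (f x))) \<in> borel_measurable M" by measurable
  thus ?thesis using assms by simp
qed

lemma measurable_g_nonneg:
  assumes [measurable]: "f \<in> borel_measurable M" and "\<And>x. f x \<ge> 0"
  shows "(\<lambda>x. g (f x)) \<in> borel_measurable M"
proof -
  have [measurable]: "(\<lambda>t. g (max 0 t)) \<in> borel_measurable borel"
    by (rule borel_measurable_mono) (auto simp: mono_def intro!: g_mono)
  have "(\<lambda>x. g (max 0 (f x))) \<in> borel_measurable M" by measurable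
  thus ?thesis using assms by simp
qed

section \<open>The gradient of G(|a|) and its variation\<close>

definition flux :: "'e::real_inner \<Rightarrow> 'e" where
  "flux a = (g (norm a) / norm a) *\<^sub>R a"

lemma flux_0 [simp]: "flux 0 = 0" by (simp add: flux_def)

lemma flux_inner_self: "flux a \<bullet> a = g (norm a) * norm a"
  by (cases "a = 0") (auto simp: flux_def dot_square_norm power2_eq_square)

lemma norm_flux: "norm (flux a) = g (norm a)"
  using g_nonneg[of "norm a"] by (cases "a = 0") (auto simp: flux_def)

text \<open>\<open>flux a\<close> is a subgradient of the convex function G(|a|): Cauchy-Schwarz
  bounds \<open>norm (a + h) - norm a\<close> below by the component of \<open>h\<close> along
  \<open>a\<close>, and the scalar tangent inequality does the rest.\<close>

lemma G_norm_tangent: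
  fixes a h :: "'e::real_inner"
  shows "flux a \<bullet> h \<le> G (norm (a + h)) - G (norm a)"
proof (cases "a = 0")
  case True thus ?thesis by (simp add: G_nonneg)
next
  case False
  have "(a + h) \<bullet> a \<le> norm (a + h) * norm a" by (rule norm_cauchy_schwarz)
  hence "norm a * norm a + h \<bullet> a \<le> norm (a + h) * norm a"
    by (simp add: inner_add_left dot_square_norm power2_eq_square)
  hence "(h \<bullet> a) / norm a \<le> norm (a + h) - norm a"
    using False by (simp add: field_simps)
  hence "g (norm a) * ((h \<bullet> a) / norm a) \<le> g (norm a) * (norm (a + h) - norm a)"
    by (intro mult_left_mono g_nonneg) auto
  also have "\<dots> \<le> G (norm (a + h)) - G (norm a)"
    using G_tangent[of "norm a" "norm (a + h)"] by (simp add: mult.commute)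
  finally show ?thesis by (simp add: flux_def inner_commute)
qed

text \<open>Bounds the relative variation of \<open>flux\<close> under a relative perturbation of
  size \<theta>: the difference of powers accounts for the change of length, the summand
  \<open>2 * \<theta>\<close> for the change of direction.\<close>

definition osc :: "real \<Rightarrow> real" where
  "osc \<theta> = (1 + \<theta>) powr (pp - 1) - (1 - \<theta>) powr (pp - 1) + 2 * \<theta>"

lemma osc_tendsto_0: "(osc \<longlongrightarrow> 0) (at_right 0)"
proof -
  have "(osc \<longlongrightarrow> (1 + 0) powr (pp - 1) - (1 - 0) powr (pp - 1) + 2 * 0) (at_right 0)"
    unfolding osc_def by (intro tendsto_intros) auto
  thus ?thesis by simp
qed

lemma flux_diff_le:
  fixes a h :: "'e::real_inner"
  assumes "0 < \<theta>" "\<theta> < 1" "norm h \<le> \<theta> * norm a"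
  shows "norm (flux (a + h) - flux a) \<le> osc \<theta> * g (norm a)"
proof (cases "a = 0")
  case True thus ?thesis using assms by simp
next
  case False
  define b where "b = norm (a + h)"
  have na: "norm a > 0" using False by simp
  have b_lo: "(1 - \<theta>) * norm a \<le> b"
    using assms(3) norm_diff_ineq[of a h] by (simp add: b_def algebra_simps)
  have b_hi: "b \<le> (1 + \<theta>) * norm a"
    using assms(3) norm_triangle_ineq[of a h] by (simp add: b_def algebra_simps)
  have b_pos: "b > 0" using b_lo na assms by (meson diff_gt_0_iff_gt mult_pos_pos order_less_le_trans)
  have hi: "g b \<le> (1 + \<theta>) powr (pp - 1) * g (norm a)"
    using g_mono[OF _ b_hi] b_pos g_scale_up[of "1 + \<theta>" "norm a"] assms by simp
  \<comment> \<open>A lower bound for \<open>g\<close> at the smaller argument comes from scaling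
    back up by \<open>1 / (1 - \<theta>)\<close>, so the exponent \<open>pp - 1\<close> appears on
    both sides of \<open>osc\<close>.\<close>
  have "g (1 / (1 - \<theta>) * ((1 - \<theta>) * norm a)) \<le> (1 / (1 - \<theta>)) powr (pp - 1) * g ((1 - \<theta>) * norm a)"
    using assms by (intro g_scale_up) auto
  hence "(1 - \<theta>) powr (pp - 1) * g (norm a) \<le> g ((1 - \<theta>) * norm a)"
    using assms by (simp add: powr_divide pos_divide_le_eq pos_le_divide_eq mult.commute)
  hence lo: "(1 - \<theta>) powr (pp - 1) * g (norm a) \<le> g b"
    using g_mono[OF _ b_lo] assms by simp
  have p1: "1 \<le> (1 + \<theta>) powr (pp - 1)"
    using assms pm_gt_1 pm_less_pp by (intro ge_one_powr_ge_zero) auto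
  have p2: "(1 - \<theta>) powr (pp - 1) \<le> 1"
    using assms pm_gt_1 pm_less_pp by (intro powr_le1) auto
  have ga: "g (norm a) \<ge> 0" by (simp add: g_nonneg)
  have gd: "\<bar>g b - g (norm a)\<bar> \<le> ((1 + \<theta>) powr (pp - 1) - (1 - \<theta>) powr (pp - 1)) * g (norm a)"
    using hi lo mult_right_mono[OF p1 ga] mult_right_mono[OF p2 ga] by (simp add: algebra_simps)
  \<comment> \<open>The difference of the two unit vectors is split into the increment over
    \<open>norm a\<close> and a correction of the length; each part is at most
    \<open>norm h / norm a\<close>.\<close>
  have "norm ((1 / b) *\<^sub>R (a + h) - (1 / norm a) *\<^sub>R a) = norm ((1 / norm a) *\<^sub>R h + (1 / b - 1 / norm a) *\<^sub>R (a + h))"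
    by (simp add: algebra_simps)
  also have "\<dots> \<le> norm h / norm a + \<bar>1 / b - 1 / norm a\<bar> * b"
    by (rule norm_triangle_le) (simp add: b_def)
  also have "\<bar>1 / b - 1 / norm a\<bar> * b = \<bar>norm a - b\<bar> / norm a"
    using b_pos na by (simp add: abs_if field_simps)
  also have "\<bar>norm a - b\<bar> \<le> norm h" unfolding b_def
    using norm_triangle_ineq3[of a "a + h"] by simp
  finally have "norm ((1 / b) *\<^sub>R (a + h) - (1 / norm a) *\<^sub>R a) \<le> 2 * (norm h / norm a)"
    using na by (simp add: divide_right_mono)
  also have "norm h / norm a \<le> \<theta>" using assms(3) na by (simp add: field_simps)
  finally have dir: "norm ((1 / b) *\<^sub>R (a + h) - (1 / norm a) *\<^sub>R a) \<le> 2 * \<theta>" by simp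
  \<comment> \<open>Change of length along the new direction, plus change of direction at the old
    length.\<close>
  have "flux (a + h) - flux a = ((g b - g (norm a)) / b) *\<^sub>R (a + h)
      + g (norm a) *\<^sub>R ((1 / b) *\<^sub>R (a + h) - (1 / norm a) *\<^sub>R a)"
    by (simp add: flux_def b_def[symmetric] algebra_simps diff_divide_distrib)
  hence "norm (flux (a + h) - flux a) \<le> \<bar>g b - g (norm a)\<bar> / b * b
      + g (norm a) * norm ((1 / b) *\<^sub>R (a + h) - (1 / norm a) *\<^sub>R a)"
    using norm_triangle_ineq[of "((g b - g (norm a)) / b) *\<^sub>R (a + h)"
      "g (norm a) *\<^sub>R ((1 / b) *\<^sub>R (a + h) - (1 / norm a) *\<^sub>R a)"] b_pos ga
    by (simp add: b_def[symmetric] abs_divide)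
  also have "\<dots> \<le> ((1 + \<theta>) powr (pp - 1) - (1 - \<theta>) powr (pp - 1)) * g (norm a) + g (norm a) * (2 * \<theta>)"
    using gd dir ga b_pos by (intro add_mono mult_left_mono) auto
  finally show ?thesis by (simp add: osc_def algebra_simps)
qed

text \<open>The increment enters as a size \<nu> and a profile \<open>U\<close>, so that after
  integration, with the modulars of \<open>a\<close> and \<open>U\<close> equal to 1, the bracket is
  small by the choice of \<theta> and then of \<nu>, uniformly in \<open>U\<close>.\<close>

lemma G_norm_expand:
  fixes a U :: "'e::real_inner"
  assumes "0 < \<theta>" "\<theta> < 1" "0 < \<nu>" "\<nu> \<le> 1"
  shows "G (norm (a + \<nu> *\<^sub>R U)) - G (norm a) - \<nu> * (flux a \<bullet> U)
    \<le> \<nu> * (osc \<theta> * growth_const * (G (norm a) + G (norm U))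
         + 2 * (1 + 1 / \<theta>) powr (pp - 1) * \<nu> powr (pm - 1) * growth_const * G (norm U))"
proof -
  define h where "h = \<nu> *\<^sub>R U"
  have osc: "osc \<theta> \<ge> 0"
    using powr_mono2[of "pp - 1" "1 - \<theta>" "1 + \<theta>"] assms pm_gt_1 pm_less_pp by (simp add: osc_def)
  \<comment> \<open>The tangent inequality at the far end point \<open>a + h\<close> turns the
    remainder into a difference of fluxes paired with the increment.\<close>
  have "G (norm (a + h)) - G (norm a) \<le> flux (a + h) \<bullet> h"
    using G_norm_tangent[of "a + h" "- h"] by (simp add: algebra_simps)
  hence "G (norm (a + h)) - G (norm a) - \<nu> * (flux a \<bullet> U) \<le> \<nu> * ((flux (a + h) - flux a) \<bullet> U)"
    by (simp add: h_def inner_diff_left algebra_simps)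
  also have "\<dots> \<le> \<nu> * (norm (flux (a + h) - flux a) * norm U)"
    using assms norm_cauchy_schwarz by (intro mult_left_mono) auto
  also have "norm (flux (a + h) - flux a) * norm U \<le> osc \<theta> * growth_const * (G (norm a) + G (norm U))
         + 2 * (1 + 1 / \<theta>) powr (pp - 1) * \<nu> powr (pm - 1) * growth_const * G (norm U)"
  proof (cases "norm h \<le> \<theta> * norm a")
    case True
    have "norm (flux (a + h) - flux a) * norm U \<le> osc \<theta> * g (norm a) * norm U"
      using flux_diff_le[OF assms(1,2) True] by (intro mult_right_mono) auto
    also have "\<dots> \<le> osc \<theta> * (growth_const * (G (norm a) + G (norm U)))"
      unfolding mult.assoc using osc g_times_le_G by (intro mult_left_mono) auto
    also have "\<dots> \<le> osc \<theta> * (growth_const * (G (norm a) + G (norm U))) +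
        2 * (1 + 1 / \<theta>) powr (pp - 1) * \<nu> powr (pm - 1) * growth_const * G (norm U)"
      using growth_const_pos by (simp add: G_nonneg)
    finally show ?thesis by (simp add: mult.assoc)
  next
    case False
    \<comment> \<open>Since \<open>norm a < norm h / \<theta>\<close> here, \<open>K\<close>
      dominates both \<open>norm a\<close> and \<open>norm (a + h)\<close>, and the two fluxes can
      be estimated separately.\<close>
    define K where "K = (1 + 1 / \<theta>) * norm h"
    have K: "K = norm h + norm h / \<theta>" by (simp add: K_def algebra_simps)
    have k: "norm a \<le> norm h / \<theta>" using False assms by (simp add: field_simps)
    have nh: "norm a \<le> K" "norm (a + h) \<le> K"
      using k norm_triangle_ineq[of a h] norm_ge_zero[of h] K by linarith+
    have "norm (flux (a + h) - flux a) \<le> g (norm (a + h)) + g (norm a)"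
      using norm_triangle_ineq4[of "flux (a + h)" "flux a"] by (simp add: norm_flux)
    also have "\<dots> \<le> 2 * g K"
      using g_mono[OF _ nh(1)] g_mono[OF _ nh(2)] by simp
    also have "g K \<le> (1 + 1 / \<theta>) powr (pp - 1) * g (norm h)"
      unfolding K_def using assms by (intro g_scale_up) auto
    \<comment> \<open>The power of \<nu> gained here is what makes this region negligible.\<close>
    also have "g (norm h) \<le> \<nu> powr (pm - 1) * g (norm U)"
      using g_scale_down[of \<nu> "norm U"] assms by (simp add: h_def)
    finally have "norm (flux (a + h) - flux a) \<le> 2 * (1 + 1 / \<theta>) powr (pp - 1) * \<nu> powr (pm - 1) * g (norm U)"
      by (simp add: mult.assoc mult_left_mono)
    hence "norm (flux (a + h) - flux a) * norm U
        \<le> (2 * (1 + 1 / \<theta>) powr (pp - 1) * \<nu> powr (pm - 1) * g (norm U)) * norm U"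
      by (rule mult_right_mono) simp
    also have "\<dots> = 2 * (1 + 1 / \<theta>) powr (pp - 1) * \<nu> powr (pm - 1) * (norm U * g (norm U))"
      by simp
    also have "\<dots> \<le> 2 * (1 + 1 / \<theta>) powr (pp - 1) * \<nu> powr (pm - 1) * (growth_const * G (norm U))"
      using t_g_le_G[of "norm U"] by (intro mult_left_mono) auto
    also have "\<dots> \<le> osc \<theta> * growth_const * (G (norm a) + G (norm U)) + \<dots>"
      using osc growth_const_pos by (simp add: G_nonneg)
    finally show ?thesis by (simp add: mult.assoc)
  qed
  finally show ?thesis using assms by (simp add: h_def mult_left_mono)
qed

section \<open>Luxemburg norms of vector-valued functions\<close>

definition modular :: "'m measure \<Rightarrow> ('m \<Rightarrow> 'e::euclidean_space) \<Rightarrow> real \<Rightarrow> ennreal" where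
  "modular M F \<tau> = (\<integral>\<^sup>+x. ennreal (G (norm (F x) / \<tau>)) \<partial>M)"

definition lux :: "'m measure \<Rightarrow> ('m \<Rightarrow> 'e::euclidean_space) \<Rightarrow> ennreal" where
  "lux M F = luxemburg (modular M F)"

definition nrm :: "'m measure \<Rightarrow> ('m \<Rightarrow> 'e::euclidean_space) \<Rightarrow> real" where
  "nrm M F = enn2real (lux M F)"

definition orlicz_space :: "'m measure \<Rightarrow> ('m \<Rightarrow> 'e::euclidean_space) set" where
  "orlicz_space M = {F \<in> borel_measurable M. lux M F < \<infinity>}"

text \<open>Real-valued counterpart of \<open>modular\<close> at scale 1. The two agree on
  \<open>orlicz_space\<close>, where the doubling bound makes the modular finite; see
  \<open>modular_eq_rmod\<close>.\<close>

definition rmod :: "'m measure \<Rightarrow> ('m \<Rightarrow> 'e::euclidean_space) \<Rightarrow> real" where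
  "rmod M F = (\<integral>x. G (norm (F x)) \<partial>M)"

lemma orlicz_space_measurable: "F \<in> orlicz_space M \<Longrightarrow> F \<in> borel_measurable M"
  by (simp add: orlicz_space_def)

lemma measurable_G_norm [measurable]:
  "F \<in> borel_measurable M \<Longrightarrow> (\<lambda>x. G (norm (F x))) \<in> borel_measurable M"
  by (rule measurable_G_nonneg) auto

lemma measurable_flux [measurable]:
  fixes F :: "'m \<Rightarrow> 'e::euclidean_space"
  assumes [measurable]: "F \<in> borel_measurable M"
  shows "(\<lambda>x. flux (F x)) \<in> borel_measurable M"
proof -
  have [measurable]: "(\<lambda>x. g (norm (F x))) \<in> borel_measurable M"
    by (rule measurable_g_nonneg) auto
  show ?thesis unfolding flux_def by measurable
qed

lemma lux_le: "\<tau> > 0 \<Longrightarrow> modular M F \<tau> \<le> 1 \<Longrightarrow> lux M F \<le> ennreal \<tau>"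
  unfolding lux_def luxemburg_def by (rule Inf_lower) auto

lemma modular_antimono:
  assumes "0 < a" "a \<le> b" shows "modular M F b \<le> modular M F a"
  unfolding modular_def
  by (intro nn_integral_mono ennreal_leI G_mono) (use assms in \<open>auto intro!: divide_left_mono\<close>)

lemma modular_le_1:
  assumes "lux M F < ennreal c" shows "modular M F c \<le> 1"
proof -
  obtain \<tau> where t: "\<tau> > 0" "modular M F \<tau> \<le> 1" "ennreal \<tau> < ennreal c"
    using assms unfolding lux_def luxemburg_def by (auto simp: Inf_less_iff)
  hence "\<tau> \<le> c" by (metis ennreal_less_iff less_eq_real_def)
  thus ?thesis using modular_antimono[OF t(1)] t(2) by (meson order_trans)
qed

lemma lux_eq_nrm: "F \<in> orlicz_space M \<Longrightarrow> lux M F = ennreal (nrm M F)"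
  by (simp add: orlicz_space_def nrm_def)

lemma nrm_nonneg [simp]: "nrm M F \<ge> 0"
  by (simp add: nrm_def)

lemma modular_scale_up:
  assumes [measurable]: "F \<in> borel_measurable M" and "1 \<le> l"
  shows "modular M (\<lambda>x. l *\<^sub>R F x) 1
    \<le> ennreal (1 + growth_const * ((l - 1) * l powr (pp - 1))) * modular M F 1"
proof -
  define K where "K = 1 + growth_const * ((l - 1) * l powr (pp - 1))"
  have K: "K \<ge> 0" using assms growth_const_pos by (simp add: K_def)
  have "modular M (\<lambda>x. l *\<^sub>R F x) 1 \<le> (\<integral>\<^sup>+x. ennreal K * ennreal (G (norm (F x))) \<partial>M)"
    unfolding modular_def
  proof (intro nn_integral_mono)
    fix x
    have "G (norm (l *\<^sub>R F x) / 1) \<le> K * G (norm (F x))"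
      using G_scale_up[of l "norm (F x)"] assms by (simp add: K_def)
    thus "ennreal (G (norm (l *\<^sub>R F x) / 1)) \<le> ennreal K * ennreal (G (norm (F x)))"
      using K by (simp add: ennreal_mult[symmetric] G_nonneg ennreal_leI)
  qed
  also have "\<dots> = ennreal K * modular M F 1"
    unfolding modular_def by (subst nn_integral_cmult) auto
  finally show ?thesis by (simp add: K_def)
qed

text \<open>A finite norm provides one scale at which the modular is at most 1; the doubling bound
  carries finiteness to every smaller scale.\<close>

lemma modular_finite:
  assumes "F \<in> orlicz_space M" "\<tau> > 0" shows "modular M F \<tau> < \<infinity>"
proof -
  \<comment> \<open>Strictly above the norm, so that the modular is at most 1 there, and not below
    \<tau>, so that the dilation factor \<open>c / \<tau>\<close> is at least 1.\<close>
  define c where "c = max \<tau> (nrm M F + 1)"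
  have c: "c > 0" "c \<ge> \<tau>" using assms by (auto simp: c_def)
  have "lux M F < ennreal c"
    unfolding lux_eq_nrm[OF assms(1)] by (subst ennreal_less_iff) (auto simp: c_def)
  hence m: "modular M F c \<le> 1" by (rule modular_le_1)
  have "modular M F \<tau> = modular M (\<lambda>x. (c / \<tau>) *\<^sub>R ((1 / c) *\<^sub>R F x)) 1"
  proof -
    have "norm ((c / \<tau>) *\<^sub>R ((1 / c) *\<^sub>R F x)) / 1 = norm (F x) / \<tau>" for x
      using assms c by simp
    thus ?thesis by (simp only: modular_def)
  qed
  also have "\<dots> \<le> ennreal (1 + growth_const * ((c / \<tau> - 1) * (c / \<tau>) powr (pp - 1))) * modular M (\<lambda>x. (1 / c) *\<^sub>R F x) 1"
    using orlicz_space_measurable[OF assms(1)] assms c by (intro modular_scale_up) auto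
  also have "modular M (\<lambda>x. (1 / c) *\<^sub>R F x) 1 = modular M F c"
    using c by (simp add: modular_def)
  also have "ennreal (1 + growth_const * ((c / \<tau> - 1) * (c / \<tau>) powr (pp - 1))) * modular M F c < \<infinity>"
    using m by (auto simp: ennreal_mult_less_top intro: order_le_less_trans)
  finally show ?thesis .
qed

lemma lux_scaleR_le:
  assumes "c \<noteq> 0" shows "lux M (\<lambda>x. c *\<^sub>R F x) \<le> ennreal \<bar>c\<bar> * lux M F"
proof (cases "lux M F = \<infinity>")
  case True thus ?thesis using assms by (simp add: ennreal_mult_top)
next
  case False
  then obtain r where r: "lux M F = ennreal r" "r \<ge> 0" by (cases "lux M F") auto
  have "lux M (\<lambda>x. c *\<^sub>R F x) \<le> ennreal (\<bar>c\<bar> * r) + ennreal e" if "e > 0" for e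
  proof -
    define t where "t = r + e / \<bar>c\<bar>"
    have t: "t > r" using that assms by (simp add: t_def)
    hence "modular M F t \<le> 1" using r by (intro modular_le_1) (simp add: ennreal_less_iff)
    hence "modular M (\<lambda>x. c *\<^sub>R F x) (\<bar>c\<bar> * t) \<le> 1" using assms by (simp add: modular_def)
    hence "lux M (\<lambda>x. c *\<^sub>R F x) \<le> ennreal (\<bar>c\<bar> * t)" using t r assms by (intro lux_le) auto
    also have "\<bar>c\<bar> * t = \<bar>c\<bar> * r + e" using assms by (simp add: t_def algebra_simps)
    finally show ?thesis using r that by simp
  qed
  hence "lux M (\<lambda>x. c *\<^sub>R F x) \<le> ennreal (\<bar>c\<bar> * r)" by (rule ennreal_le_epsilon)
  thus ?thesis using r by (simp add: ennreal_mult)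
qed

lemma lux_AE_zero: 
  assumes "AE x in M. F x = 0" shows "lux M F = 0"
proof -
  have "modular M F \<tau> = 0" if "\<tau> > 0" for \<tau>
  proof -
    have "modular M F \<tau> = (\<integral>\<^sup>+x. 0 \<partial>M)"
      unfolding modular_def by (rule nn_integral_cong_AE) (use assms in auto)
    thus ?thesis by simp
  qed
  hence "lux M F \<le> 0 + ennreal e" if "e > 0" for e
    using lux_le[of e M F] that by simp
  hence "lux M F \<le> 0" by (rule ennreal_le_epsilon)
  thus ?thesis by simp
qed

lemma lux_scaleR: "lux M (\<lambda>x. c *\<^sub>R F x) = ennreal \<bar>c\<bar> * lux M F"
proof (cases "c = 0")
  case True thus ?thesis by (simp add: lux_AE_zero)
next
  case False
  have "ennreal \<bar>c\<bar> * lux M (\<lambda>x. (1 / c) *\<^sub>R (c *\<^sub>R F x))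
      \<le> ennreal \<bar>c\<bar> * (ennreal \<bar>1 / c\<bar> * lux M (\<lambda>x. c *\<^sub>R F x))"
    using False by (intro mult_left_mono lux_scaleR_le) auto
  also have "\<dots> = lux M (\<lambda>x. c *\<^sub>R F x)"
    using False by (simp add: mult.assoc[symmetric] ennreal_mult[symmetric] abs_mult[symmetric])
  finally have "ennreal \<bar>c\<bar> * lux M F \<le> lux M (\<lambda>x. c *\<^sub>R F x)" using False by simp
  thus ?thesis using lux_scaleR_le[OF False, of M F] by (rule antisym[rotated])
qed

lemma nrm_scaleR: "nrm M (\<lambda>x. c *\<^sub>R F x) = \<bar>c\<bar> * nrm M F"
  by (simp add: nrm_def lux_scaleR enn2real_mult)

lemma orlicz_space_scaleR: "F \<in> orlicz_space M \<Longrightarrow> (\<lambda>x. c *\<^sub>R F x) \<in> orlicz_space M"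
  by (auto simp: orlicz_space_def lux_scaleR ennreal_mult_less_top)

text \<open>For scales \<open>a\<close>, \<open>b\<close> slightly above the two norms, the sum
  divided by \<open>a + b\<close> is a convex combination of \<open>F / a\<close> and
  \<open>H / b\<close>, so convexity of \<open>G\<close> keeps the modular below 1.\<close>

lemma lux_triangle:
  assumes [measurable]: "F \<in> borel_measurable M" "H \<in> borel_measurable M"
  shows "lux M (\<lambda>x. F x + H x) \<le> lux M F + lux M H"
proof (cases "lux M F = \<infinity> \<or> lux M H = \<infinity>")
  case True thus ?thesis by auto
next
  case False
  then obtain r q where r: "lux M F = ennreal r" "r \<ge> 0" and q: "lux M H = ennreal q" "q \<ge> 0"
    by (cases "lux M F"; cases "lux M H") auto
  have "lux M (\<lambda>x. F x + H x) \<le> ennreal (r + q) + ennreal e" if "e > 0" for e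
  proof -
    define a b where "a = r + e / 2" and "b = q + e / 2"
    have ab: "a > 0" "b > 0" "a > r" "b > q" using that r q by (auto simp: a_def b_def)
    have m: "modular M F a \<le> 1" "modular M H b \<le> 1"
      using r q ab by (auto intro!: modular_le_1 simp: ennreal_less_iff)
    define x y where "x = a / (a + b)" and "y = b / (a + b)"
    have xy: "x \<ge> 0" "y \<ge> 0" "x + y = 1" using ab by (auto simp: x_def y_def add_divide_distrib[symmetric])
    have meas: "(\<lambda>z. G (norm (F z) / a)) \<in> borel_measurable M" "(\<lambda>z. G (norm (H z) / b)) \<in> borel_measurable M"
      using ab by (auto intro!: measurable_G_nonneg)
    have "modular M (\<lambda>x. F x + H x) (a + b)
        \<le> (\<integral>\<^sup>+z. ennreal x * ennreal (G (norm (F z) / a)) + ennreal y * ennreal (G (norm (H z) / b)) \<partial>M)"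
      unfolding modular_def
    proof (intro nn_integral_mono)
      fix z
      have "norm (F z + H z) / (a + b) \<le> (norm (F z) + norm (H z)) / (a + b)"
        using ab by (intro divide_right_mono norm_triangle_ineq) auto
      also have "\<dots> = x * (norm (F z) / a) + y * (norm (H z) / b)"
        using ab by (simp add: x_def y_def add_divide_distrib)
      finally have "G (norm (F z + H z) / (a + b)) \<le> G (x * (norm (F z) / a) + y * (norm (H z) / b))"
        using ab by (intro G_mono) auto
      also have "\<dots> \<le> x * G (norm (F z) / a) + y * G (norm (H z) / b)"
        using ab xy by (intro G_convex) auto
      finally show "ennreal (G (norm (F z + H z) / (a + b)))
          \<le> ennreal x * ennreal (G (norm (F z) / a)) + ennreal y * ennreal (G (norm (H z) / b))"
        using ab xy by (simp add: ennreal_mult[symmetric] ennreal_plus[symmetric] G_nonneg ennreal_leI del: ennreal_plus)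
    qed
    also have "\<dots> = ennreal x * modular M F a + ennreal y * modular M H b"
      unfolding modular_def using meas by (simp add: nn_integral_add nn_integral_cmult)
    also have "\<dots> \<le> ennreal x * 1 + ennreal y * 1"
      by (intro add_mono mult_left_mono m) auto
    also have "\<dots> = 1" using xy by (simp add: ennreal_plus[symmetric] del: ennreal_plus)
    finally have "lux M (\<lambda>x. F x + H x) \<le> ennreal (a + b)" using ab by (intro lux_le) auto
    also have "a + b = r + q + e" by (simp add: a_def b_def)
    finally show ?thesis using r q that by simp
  qed
  hence "lux M (\<lambda>x. F x + H x) \<le> ennreal (r + q)" by (rule ennreal_le_epsilon)
  thus ?thesis using r q by simp
qed

lemma orlicz_space_add:
  assumes "F \<in> orlicz_space M" "H \<in> orlicz_space M"
  shows "(\<lambda>x. F x + H x) \<in> orlicz_space M"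
  using assms lux_triangle[of F M H] by (auto simp: orlicz_space_def less_top[symmetric] top_unique)

lemma nrm_triangle:
  assumes "F \<in> orlicz_space M" "H \<in> orlicz_space M"
  shows "nrm M (\<lambda>x. F x + H x) \<le> nrm M F + nrm M H"
proof -
  have "lux M (\<lambda>x. F x + H x) \<le> lux M F + lux M H"
    using assms by (intro lux_triangle orlicz_space_measurable)
  hence "ennreal (nrm M (\<lambda>x. F x + H x)) \<le> ennreal (nrm M F + nrm M H)"
    using assms by (simp add: lux_eq_nrm orlicz_space_add)
  thus ?thesis by (simp del: ennreal_plus)
qed

section \<open>The real-valued modular and its value on the unit sphere\<close>

lemma integrable_G:
  assumes "F \<in> orlicz_space M" shows "integrable M (\<lambda>x. G (norm (F x)))"
proof (rule integrableI_nonneg)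
  show "(\<lambda>x. G (norm (F x))) \<in> borel_measurable M" using orlicz_space_measurable[OF assms] by measurable
  show "(\<integral>\<^sup>+x. ennreal (G (norm (F x))) \<partial>M) < \<infinity>"
    using modular_finite[OF assms, of 1] by (simp add: modular_def)
qed (auto simp: G_nonneg)

lemma modular_eq_rmod:
  assumes "F \<in> orlicz_space M" "\<tau> > 0"
  shows "modular M F \<tau> = ennreal (rmod M (\<lambda>x. (1 / \<tau>) *\<^sub>R F x))"
proof -
  have "(\<integral>\<^sup>+x. ennreal (G (norm ((1 / \<tau>) *\<^sub>R F x))) \<partial>M) = ennreal (rmod M (\<lambda>x. (1 / \<tau>) *\<^sub>R F x))"
    unfolding rmod_def
    by (rule nn_integral_eq_integral[OF integrable_G[OF orlicz_space_scaleR[OF assms(1)]]])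
      (auto simp: G_nonneg)
  thus ?thesis using assms by (simp add: modular_def)
qed

lemma rmod_nonneg: "rmod M F \<ge> 0"
  unfolding rmod_def by (intro integral_nonneg_AE) (auto simp: G_nonneg)

lemma nrm_le:
  assumes "F \<in> orlicz_space M" "\<tau> > 0" "rmod M (\<lambda>x. (1 / \<tau>) *\<^sub>R F x) \<le> 1"
  shows "nrm M F \<le> \<tau>"
proof -
  have "modular M F \<tau> \<le> 1" using assms by (simp add: modular_eq_rmod)
  hence "lux M F \<le> ennreal \<tau>" using assms by (intro lux_le)
  thus ?thesis using assms by (simp add: lux_eq_nrm)
qed

lemma rmod_le_1:
  assumes "F \<in> orlicz_space M" "nrm M F < \<tau>"
  shows "rmod M (\<lambda>x. (1 / \<tau>) *\<^sub>R F x) \<le> 1"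
proof -
  have t: "\<tau> > 0" using assms nrm_nonneg[of M F] by linarith
  have "modular M F \<tau> \<le> 1"
    using assms t by (intro modular_le_1) (simp add: lux_eq_nrm ennreal_less_iff)
  thus ?thesis using assms t by (simp add: modular_eq_rmod)
qed

lemma rmod_scale_up:
  assumes "F \<in> orlicz_space M" "1 \<le> l"
  shows "rmod M (\<lambda>x. l *\<^sub>R F x) \<le> (1 + growth_const * ((l - 1) * l powr (pp - 1))) * rmod M F"
proof -
  have "rmod M (\<lambda>x. l *\<^sub>R F x) \<le> (\<integral>x. (1 + growth_const * ((l - 1) * l powr (pp - 1))) * G (norm (F x)) \<partial>M)"
    unfolding rmod_def
  proof (rule integral_mono)
    show "integrable M (\<lambda>x. G (norm (l *\<^sub>R F x)))"
      by (rule integrable_G[OF orlicz_space_scaleR[OF assms(1)]])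
    show "integrable M (\<lambda>x. (1 + growth_const * ((l - 1) * l powr (pp - 1))) * G (norm (F x)))"
      using integrable_G[OF assms(1)] by simp
    fix x show "G (norm (l *\<^sub>R F x)) \<le> (1 + growth_const * ((l - 1) * l powr (pp - 1))) * G (norm (F x))"
      using G_scale_up[of l "norm (F x)"] assms by simp
  qed
  thus ?thesis by (simp add: rmod_def)
qed

text \<open>For \<open>\<tau> \<le> 1\<close> convexity gives
  \<open>G t \<le> \<tau> * G (t / \<tau>)\<close>, so a modular bounded by 1 at every scale forces
  the modular at scale 1 to be at most every such \<tau>.\<close>

lemma nrm_0_imp_AE:
  assumes "F \<in> orlicz_space M" "nrm M F = 0" shows "AE x in M. F x = 0"
proof -
  have le: "rmod M F \<le> \<tau>" if t: "0 < \<tau>" "\<tau> \<le> 1" for \<tau>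
  proof -
    have "rmod M F \<le> (\<integral>x. \<tau> * G (norm ((1 / \<tau>) *\<^sub>R F x)) \<partial>M)"
      unfolding rmod_def
    proof (rule integral_mono)
      show "integrable M (\<lambda>x. G (norm (F x)))" by (rule integrable_G[OF assms(1)])
      show "integrable M (\<lambda>x. \<tau> * G (norm ((1 / \<tau>) *\<^sub>R F x)))"
        by (intro integrable_mult_right integrable_G orlicz_space_scaleR assms(1))
      fix x show "G (norm (F x)) \<le> \<tau> * G (norm ((1 / \<tau>) *\<^sub>R F x))"
        using G_scale_le[of "norm ((1 / \<tau>) *\<^sub>R F x)" \<tau>] t by simp
    qed
    also have "\<dots> = \<tau> * rmod M (\<lambda>x. (1 / \<tau>) *\<^sub>R F x)" by (simp add: rmod_def)
    also have "\<dots> \<le> \<tau> * 1" using t assms by (intro mult_left_mono rmod_le_1) auto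
    finally show ?thesis by simp
  qed
  have "rmod M F \<le> 0 + e" if "e > 0" for e
    using le[of "min e 1"] that by auto
  hence "rmod M F = 0" using rmod_nonneg[of M F] field_le_epsilon[of "rmod M F" 0] by (meson antisym)
  hence "AE x in M. G (norm (F x)) = 0"
    using integral_nonneg_eq_0_iff_AE[OF integrable_G[OF assms(1)]] by (simp add: rmod_def G_nonneg)
  thus ?thesis
  proof (rule AE_mp, intro AE_I2 impI)
    fix x assume "G (norm (F x)) = 0"
    thus "F x = 0" using G_pos[of "norm (F x)"] by force
  qed
qed

lemma growth_factor_tendsto:
  "((\<lambda>l. (1 + growth_const * ((l - 1) * l powr (pp - 1))) * c) \<longlongrightarrow> c) (at_right 1)"
proof -
  have "((\<lambda>l. (1 + growth_const * ((l - 1) * l powr (pp - 1))) * c) \<longlongrightarrow>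
     (1 + growth_const * ((1 - 1) * 1 powr (pp - 1))) * c) (at_right 1)"
    by (intro tendsto_intros) auto
  thus ?thesis by simp
qed

text \<open>Both halves use that dilating by \<open>l\<close> slightly above 1 multiplies the
  modular by a factor near 1. The modular of \<open>F\<close> is at most that factor, because
  \<open>F / l\<close> has norm below 1; and if it were below 1, some dilate would still have
  modular at most 1 and the norm would be at most \<open>1 / l\<close>.\<close>

lemma rmod_at_nrm:
  assumes "F \<in> orlicz_space M" "nrm M F = 1" shows "rmod M F = 1"
proof (rule antisym)
  have "rmod M F \<le> (1 + growth_const * ((l - 1) * l powr (pp - 1))) * 1" if "l > 1" for l
  proof -
    have "rmod M F = rmod M (\<lambda>x. l *\<^sub>R ((1 / l) *\<^sub>R F x))" using that by simp
    also have "\<dots> \<le> (1 + growth_const * ((l - 1) * l powr (pp - 1))) * rmod M (\<lambda>x. (1 / l) *\<^sub>R F x)"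
      using that assms by (intro rmod_scale_up orlicz_space_scaleR) auto
    also have "\<dots> \<le> (1 + growth_const * ((l - 1) * l powr (pp - 1))) * 1"
      using that assms growth_const_pos by (intro mult_left_mono rmod_le_1) auto
    finally show ?thesis .
  qed
  hence "\<forall>\<^sub>F l in at_right 1. rmod M F \<le> (1 + growth_const * ((l - 1) * l powr (pp - 1))) * 1"
    using eventually_at_right_less by (rule eventually_mono[rotated]) 
  thus "rmod M F \<le> 1"
    using growth_factor_tendsto[of 1] by (intro tendsto_lowerbound) auto
next
  show "1 \<le> rmod M F"
  proof (rule ccontr)
    assume "\<not> 1 \<le> rmod M F"
    hence "\<forall>\<^sub>F l in at_right 1. (1 + growth_const * ((l - 1) * l powr (pp - 1))) * rmod M F < 1"
      using order_tendstoD(2)[OF growth_factor_tendsto[of "rmod M F"]] by simp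
    hence "\<forall>\<^sub>F l in at_right 1. l > 1 \<and> (1 + growth_const * ((l - 1) * l powr (pp - 1))) * rmod M F < 1"
      using eventually_at_right_less by (auto simp: eventually_conj_iff)
    then obtain l where l: "l > 1" "(1 + growth_const * ((l - 1) * l powr (pp - 1))) * rmod M F < 1"
      using eventually_happens'[OF trivial_limit_at_right_real] by blast
    have "rmod M (\<lambda>x. (1 / (1 / l)) *\<^sub>R F x) \<le> 1"
      using rmod_scale_up[OF assms(1), of l] l by simp
    hence "nrm M F \<le> 1 / l" using l assms by (intro nrm_le) auto
    thus False using l assms by simp
  qed
qed

lemma rmod_normalized:
  assumes "F \<in> orlicz_space M" "nrm M F > 0"
  shows "rmod M (\<lambda>x. (1 / nrm M F) *\<^sub>R F x) = 1"
  using assms by (intro rmod_at_nrm orlicz_space_scaleR) (simp_all add: nrm_scaleR)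

section \<open>Frechet differentiability of the Luxemburg norm\<close>

text \<open>The common shape of both sides of the eigenvalue equation. It depends on
  \<open>F\<close> only through the normalised function, and it gives the derivative of the norm up
  to the factor \<open>nrm M F / dual_form M F F\<close>.\<close>

definition dual_form :: "'m measure \<Rightarrow> ('m \<Rightarrow> 'e::euclidean_space) \<Rightarrow> ('m \<Rightarrow> 'e) \<Rightarrow> real" where
  "dual_form M F V = (\<integral>x. flux ((1 / nrm M F) *\<^sub>R F x) \<bullet> V x \<partial>M)"

lemma lux_cong_AE:
  assumes "AE x in M. F x = H x" shows "lux M F = lux M H"
proof -
  have "modular M F = modular M H"
    unfolding modular_def using assms by (intro ext nn_integral_cong_AE) auto
  thus ?thesis by (simp add: lux_def)
qed

lemma nrm_cong_AE:
  "AE x in M. F x = H x \<Longrightarrow> nrm M F = nrm M H"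
  by (simp add: nrm_def lux_cong_AE)

lemma flux_inner_bound:
  fixes a b :: "'e::euclidean_space"
  shows "\<bar>flux a \<bullet> b\<bar> \<le> growth_const * (G (norm a) + G (norm b))"
proof -
  have "\<bar>flux a \<bullet> b\<bar> \<le> g (norm a) * norm b"
    using Cauchy_Schwarz_ineq2[of "flux a" b] by (simp add: norm_flux)
  also have "\<dots> \<le> growth_const * (G (norm a) + G (norm b))"
    by (rule g_times_le_G) auto
  finally show ?thesis .
qed

lemma integrable_flux:
  assumes "F \<in> orlicz_space M" "V \<in> orlicz_space M"
  shows "integrable M (\<lambda>x. flux (F x) \<bullet> V x)"
proof (rule Bochner_Integration.integrable_bound)
  show "integrable M (\<lambda>x. growth_const * (G (norm (F x)) + G (norm (V x))))"
    using assms by (intro integrable_mult_right Bochner_Integration.integrable_add integrable_G)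
  show "(\<lambda>x. flux (F x) \<bullet> V x) \<in> borel_measurable M"
    using assms[THEN orlicz_space_measurable] by measurable
  show "AE x in M. norm (flux (F x) \<bullet> V x) \<le> norm (growth_const * (G (norm (F x)) + G (norm (V x))))"
  proof (intro AE_I2)
    fix x
    have "0 \<le> growth_const * (G (norm (F x)) + G (norm (V x)))"
      using growth_const_pos by (simp add: G_nonneg)
    thus "norm (flux (F x) \<bullet> V x) \<le> norm (growth_const * (G (norm (F x)) + G (norm (V x))))"
      using flux_inner_bound[of "F x" "V x"] by simp
  qed
qed

lemma dual_form_lincomb:
  assumes "F \<in> orlicz_space M" "V \<in> orlicz_space M" "W \<in> orlicz_space M"
  shows "dual_form M F (\<lambda>x. a *\<^sub>R V x + b *\<^sub>R W x) = a * dual_form M F V + b * dual_form M F W"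
proof -
  have i: "integrable M (\<lambda>x. flux ((1 / nrm M F) *\<^sub>R F x) \<bullet> V x)"
    "integrable M (\<lambda>x. flux ((1 / nrm M F) *\<^sub>R F x) \<bullet> W x)"
    using assms by (auto intro!: integrable_flux orlicz_space_scaleR)
  show ?thesis unfolding dual_form_def using i by (simp add: inner_add_right)
qed

lemma dual_form_cong_AE:
  assumes "AE x in M. V x = W x" "F \<in> orlicz_space M" "V \<in> borel_measurable M" "W \<in> borel_measurable M"
  shows "dual_form M F V = dual_form M F W"
  unfolding dual_form_def
proof (rule integral_cong_AE)
  note [measurable] = assms(3,4) orlicz_space_measurable[OF assms(2)]
  show "(\<lambda>x. flux ((1 / nrm M F) *\<^sub>R F x) \<bullet> V x) \<in> borel_measurable M" by measurable
  show "(\<lambda>x. flux ((1 / nrm M F) *\<^sub>R F x) \<bullet> W x) \<in> borel_measurable M" by measurable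
  show "AE x in M. flux ((1 / nrm M F) *\<^sub>R F x) \<bullet> V x = flux ((1 / nrm M F) *\<^sub>R F x) \<bullet> W x"
    using assms(1) by eventually_elim simp
qed

text \<open>Integrate \<open>G t \<le> t * g t\<close> at the normalised function, whose modular is
  1. This keeps the denominators in the derivative formula positive.\<close>

lemma dual_form_self_ge:
  assumes "F \<in> orlicz_space M" "nrm M F > 0"
  shows "nrm M F \<le> dual_form M F F"
proof -
  let ?E = "\<lambda>x. (1 / nrm M F) *\<^sub>R F x"
  have sp: "?E \<in> orlicz_space M" using assms by (intro orlicz_space_scaleR)
  have "1 = rmod M ?E" using rmod_normalized[OF assms] by simp
  also have "\<dots> \<le> (\<integral>x. flux (?E x) \<bullet> ?E x \<partial>M)"
    unfolding rmod_def
  proof (rule integral_mono[OF integrable_G[OF sp] integrable_flux[OF sp sp]])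
    fix x show "G (norm (?E x)) \<le> flux (?E x) \<bullet> ?E x"
      unfolding flux_inner_self using G_le_t_g[of "norm (?E x)"] by (simp add: mult.commute)
  qed
  also have "\<dots> = (1 / nrm M F) * dual_form M F F"
    unfolding dual_form_def by simp
  finally show ?thesis using assms by (simp add: field_simps)
qed

text \<open>Convexity gives the lower bound. For the upper bound the pointwise estimate
  \<open>G_norm_expand\<close> is integrated with \<nu> the norm of \<open>W\<close> and
  \<open>U\<close> the normalised \<open>W\<close>.\<close>

lemma rmod_frechet:
  fixes F :: "'m \<Rightarrow> 'e::euclidean_space"
  assumes F: "F \<in> orlicz_space M" "nrm M F = 1" and e: "\<epsilon> > 0"
  obtains \<delta> where "\<delta> > 0" "\<And>W :: 'm \<Rightarrow> 'e. W \<in> orlicz_space M \<Longrightarrow> nrm M W < \<delta> \<Longrightarrow>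
    \<bar>rmod M (\<lambda>x. F x + W x) - 1 - dual_form M F W\<bar> \<le> \<epsilon> * nrm M W"
proof -
  let ?C = growth_const
  \<comment> \<open>The modulars of \<open>F\<close> and of the normalised increment add up to 2, so
    this bound on \<open>osc \<theta>\<close> leaves an error of at most
    \<open>\<epsilon> / 2\<close>.\<close>
  have "\<forall>\<^sub>F \<theta> in at_right 0. osc \<theta> < \<epsilon> / (4 * ?C)"
    using order_tendstoD(2)[OF osc_tendsto_0] e growth_const_pos by simp
  moreover have "\<forall>\<^sub>F \<theta> in at_right (0::real). \<theta> < 1" 
    by (rule order_tendstoD(2)[OF tendsto_ident_at]) auto
  moreover have "\<forall>\<^sub>F \<theta> in at_right (0::real). \<theta> > 0" by (rule eventually_at_right_less)
  ultimately have "\<forall>\<^sub>F \<theta> in at_right 0. osc \<theta> < \<epsilon> / (4 * ?C) \<and> \<theta> < 1 \<and> \<theta> > 0"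
    by eventually_elim auto
  then obtain \<theta> where th: "osc \<theta> < \<epsilon> / (4 * ?C)" "\<theta> < 1" "\<theta> > 0"
    using eventually_happens'[OF trivial_limit_at_right_real] by blast
  \<comment> \<open>Depends on \<theta> and grows without bound as \<theta> tends to 0; this is why
    \<delta> is chosen only after \<theta>.\<close>
  define K where "K = 2 * (1 + 1 / \<theta>) powr (pp - 1) * ?C"
  have K: "K \<ge> 0" using growth_const_pos by (simp add: K_def)
  have "((\<lambda>\<nu>. K * \<nu> powr (pm - 1)) \<longlongrightarrow> K * 0 powr (pm - 1)) (at_right 0)"
    using pm_gt_1 by (intro tendsto_intros) (auto simp: eventually_at_filter)
  hence "\<forall>\<^sub>F \<nu> in at_right 0. K * \<nu> powr (pm - 1) < \<epsilon> / 2"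
    using e by (intro order_tendstoD(2)[where a = "\<epsilon> / 2"]) auto
  moreover have "\<forall>\<^sub>F \<theta> in at_right (0::real). \<theta> < 1"
    by (rule order_tendstoD(2)[OF tendsto_ident_at]) auto
  moreover have "\<forall>\<^sub>F \<theta> in at_right (0::real). \<theta> > 0" by (rule eventually_at_right_less)
  ultimately have "\<forall>\<^sub>F \<nu> in at_right 0. K * \<nu> powr (pm - 1) < \<epsilon> / 2 \<and> \<nu> < 1 \<and> \<nu> > 0"
    by eventually_elim auto
  then obtain \<delta> where d: "K * \<delta> powr (pm - 1) < \<epsilon> / 2" "\<delta> < 1" "\<delta> > 0"
    using eventually_happens'[OF trivial_limit_at_right_real] by blast
  show thesis
  proof (rule that[OF d(3)])
    fix W :: "'m \<Rightarrow> 'e"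
    assume W: "W \<in> orlicz_space M" "nrm M W < \<delta>"
    define \<nu> where "\<nu> = nrm M W"
    have FW: "(\<lambda>x. F x + W x) \<in> orlicz_space M" using F W by (intro orlicz_space_add)
    have one: "rmod M F = 1" using F by (rule rmod_at_nrm)
    have df: "dual_form M F W = (\<integral>x. flux (F x) \<bullet> W x \<partial>M)"
      using F by (simp add: dual_form_def)
    have diff: "rmod M (\<lambda>x. F x + W x) - 1 - dual_form M F W
      = (\<integral>x. G (norm (F x + W x)) - G (norm (F x)) - flux (F x) \<bullet> W x \<partial>M)"
      using integrable_G[OF FW] integrable_G[OF F(1)] integrable_flux[OF F(1) W(1)]
      by (simp add: one[symmetric] df) (simp add: rmod_def)
    have int: "integrable M (\<lambda>x. G (norm (F x + W x)) - G (norm (F x)) - flux (F x) \<bullet> W x)"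
      using integrable_G[OF FW] integrable_G[OF F(1)] integrable_flux[OF F(1) W(1)] by auto
    have lower: "0 \<le> rmod M (\<lambda>x. F x + W x) - 1 - dual_form M F W"
      unfolding diff using G_norm_tangent by (intro integral_nonneg_AE) (auto simp: algebra_simps)
    have upper: "rmod M (\<lambda>x. F x + W x) - 1 - dual_form M F W \<le> \<epsilon> * nrm M W"
    proof (cases "\<nu> = 0")
      case True
      \<comment> \<open>An increment of norm 0 cannot be normalised, but it vanishes almost
        everywhere and so does the remainder.\<close>
      have z: "AE x in M. W x = 0" using nrm_0_imp_AE[OF W(1)] True by (simp add: \<nu>_def)
      have "(\<integral>x. G (norm (F x + W x)) - G (norm (F x)) - flux (F x) \<bullet> W x \<partial>M) = (\<integral>x. 0 \<partial>M)"
        using borel_measurable_integrable[OF int] z by (intro integral_cong_AE) auto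
      thus ?thesis using diff e by simp
    next
      case False
      hence nu: "\<nu> > 0" "\<nu> \<le> 1" using nrm_nonneg[of M W] W d unfolding \<nu>_def by linarith+
      let ?U = "\<lambda>x. (1 / \<nu>) *\<^sub>R W x"
      have U: "?U \<in> orlicz_space M" using W by (intro orlicz_space_scaleR)
      have U1: "rmod M ?U = 1" using rmod_normalized[OF W(1)] nu by (simp add: \<nu>_def)
      let ?b = "\<lambda>x. \<nu> * (osc \<theta> * ?C * (G (norm (F x)) + G (norm (?U x)))
         + 2 * (1 + 1 / \<theta>) powr (pp - 1) * \<nu> powr (pm - 1) * ?C * G (norm (?U x)))"
      have "rmod M (\<lambda>x. F x + W x) - 1 - dual_form M F W \<le> (\<integral>x. ?b x \<partial>M)"
        unfolding diff
      proof (rule integral_mono[OF int])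
        show "integrable M ?b" using integrable_G[OF F(1)] integrable_G[OF U] by auto
        fix x
        show "G (norm (F x + W x)) - G (norm (F x)) - flux (F x) \<bullet> W x \<le> ?b x"
          using G_norm_expand[OF th(3,2) nu, of "F x" "?U x"] nu by simp
      qed
      also have "(\<integral>x. ?b x \<partial>M) = \<nu> * (osc \<theta> * ?C * (rmod M F + rmod M ?U)
         + 2 * (1 + 1 / \<theta>) powr (pp - 1) * \<nu> powr (pm - 1) * ?C * rmod M ?U)"
        unfolding rmod_def using integrable_G[OF F(1)] integrable_G[OF U] by simp
      also have "\<dots> = \<nu> * (2 * ?C * osc \<theta> + K * \<nu> powr (pm - 1))"
        by (simp add: one U1 K_def)
      also have "\<dots> \<le> \<nu> * (\<epsilon> / 2 + \<epsilon> / 2)"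
      proof (intro mult_left_mono add_mono)
        show "2 * ?C * osc \<theta> \<le> \<epsilon> / 2" using th growth_const_pos by (simp add: field_simps)
        have "\<nu> powr (pm - 1) \<le> \<delta> powr (pm - 1)"
          using W nu pm_gt_1 by (intro powr_mono2) (auto simp: \<nu>_def)
        hence "K * \<nu> powr (pm - 1) \<le> K * \<delta> powr (pm - 1)" using K by (rule mult_left_mono)
        thus "K * \<nu> powr (pm - 1) \<le> \<epsilon> / 2" using d by simp
      qed (use nu in auto)
      finally show ?thesis by (simp add: \<nu>_def mult.commute)
    qed
    show "\<bar>rmod M (\<lambda>x. F x + W x) - 1 - dual_form M F W\<bar> \<le> \<epsilon> * nrm M W"
      using lower upper by simp
  qed
qed

text \<open>The rescaled perturbation \<open>W = (F + V) / \<nu> - F\<close> with \<open>\<nu> = nrm M (F + V)\<close> leaves the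
  modular at its value \<open>1\<close>, so the expansion of the modular at \<open>F\<close> determines \<open>\<nu>\<close> to first order.\<close>

lemma nrm_frechet_normalized:
  fixes F :: "'m \<Rightarrow> 'e::euclidean_space"
  assumes F: "F \<in> orlicz_space M" "nrm M F = 1" and e: "\<epsilon> > 0"
  obtains \<delta> where "\<delta> > 0" "\<And>V :: 'm \<Rightarrow> 'e. V \<in> orlicz_space M \<Longrightarrow> nrm M V < \<delta> \<Longrightarrow>
    \<bar>nrm M (\<lambda>x. F x + V x) - 1 - dual_form M F V / dual_form M F F\<bar> \<le> \<epsilon> * nrm M V"
proof -
  obtain \<delta>0 where d0: "\<delta>0 > 0" "\<And>W :: 'm \<Rightarrow> 'e. W \<in> orlicz_space M \<Longrightarrow> nrm M W < \<delta>0 \<Longrightarrow>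
    \<bar>rmod M (\<lambda>x. F x + W x) - 1 - dual_form M F W\<bar> \<le> \<epsilon> / 2 * nrm M W"
    using rmod_frechet[OF F, of "\<epsilon> / 2"] e by auto
  have AF: "dual_form M F F \<ge> 1" using dual_form_self_ge[of F M] F by simp
  show thesis
  proof (rule that)
    \<comment> \<open>The bound 1/2 keeps \<nu> above 1/2; then the rescaled perturbation has norm
      at most four times that of \<open>V\<close>, hence below \<open>\<delta>0\<close>.\<close>
    show "min (1 / 2) (\<delta>0 / 4) > 0" using d0 by simp
    fix V :: "'m \<Rightarrow> 'e"
    assume V: "V \<in> orlicz_space M" "nrm M V < min (1 / 2) (\<delta>0 / 4)"
    define \<nu> where "\<nu> = nrm M (\<lambda>x. F x + V x)"
    have FV: "(\<lambda>x. F x + V x) \<in> orlicz_space M" using F V by (intro orlicz_space_add)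
    have "\<nu> \<le> 1 + nrm M V" using nrm_triangle[OF F(1) V(1)] F by (simp add: \<nu>_def)
    moreover have "nrm M F \<le> \<nu> + nrm M (\<lambda>x. (-1) *\<^sub>R V x)"
      using nrm_triangle[OF FV orlicz_space_scaleR[OF V(1), of "-1"]] by (simp add: \<nu>_def)
    hence "1 \<le> \<nu> + nrm M V" using nrm_scaleR[of M "-1" V] F by simp
    ultimately have near: "\<bar>\<nu> - 1\<bar> \<le> nrm M V" by linarith
    hence nu: "\<nu> > 1 / 2" using V by linarith
    let ?W = "\<lambda>x. (1 / \<nu>) *\<^sub>R (V x + (1 - \<nu>) *\<^sub>R F x)"
    have W: "?W \<in> orlicz_space M" using F V by (intro orlicz_space_scaleR orlicz_space_add)
    have "nrm M (\<lambda>x. V x + (1 - \<nu>) *\<^sub>R F x) \<le> nrm M V + \<bar>1 - \<nu>\<bar>"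
      using nrm_triangle[OF V(1) orlicz_space_scaleR[OF F(1)], of "1 - \<nu>"] F by (simp add: nrm_scaleR)
    hence two: "\<nu> * nrm M ?W \<le> 2 * nrm M V"
      using near nu unfolding nrm_scaleR by simp
    moreover have "1 / 2 * nrm M ?W \<le> \<nu> * nrm M ?W" using nu by (intro mult_right_mono) auto
    ultimately have small: "nrm M ?W < \<delta>0" using V by linarith
    have sum: "F x + ?W x = (1 / \<nu>) *\<^sub>R (F x + V x)" for x
    proof -
      have "F x + ?W x = (1 + (1 - \<nu>) / \<nu>) *\<^sub>R F x + (1 / \<nu>) *\<^sub>R V x"
        by (simp add: scaleR_add_right scaleR_add_left)
      also have "1 + (1 - \<nu>) / \<nu> = 1 / \<nu>" using nu by (simp add: field_simps)
      finally show ?thesis by (simp add: scaleR_add_right)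
    qed
    have "rmod M (\<lambda>x. F x + ?W x) = 1"
      unfolding sum using rmod_normalized[OF FV] nu by (simp add: \<nu>_def)
    \<comment> \<open>The modular has not changed, so the linear term alone is the remainder and
      inherits its smallness.\<close>
    hence "\<bar>dual_form M F ?W\<bar> \<le> \<epsilon> / 2 * nrm M ?W"
      using d0(2)[OF W small] by simp
    hence "\<nu> * \<bar>dual_form M F ?W\<bar> \<le> \<nu> * (\<epsilon> / 2 * nrm M ?W)"
      using nu by (intro mult_left_mono) auto
    also have "\<dots> = \<epsilon> / 2 * (\<nu> * nrm M ?W)" by simp
    also have "\<dots> \<le> \<epsilon> / 2 * (2 * nrm M V)" using two e by (intro mult_left_mono) auto
    finally have est: "\<nu> * \<bar>dual_form M F ?W\<bar> \<le> \<epsilon> * nrm M V" by simp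
    have "dual_form M F ?W = dual_form M F (\<lambda>x. (1 / \<nu>) *\<^sub>R V x + ((1 - \<nu>) / \<nu>) *\<^sub>R F x)"
      by (simp add: scaleR_add_right)
    also have "\<dots> = 1 / \<nu> * dual_form M F V + (1 - \<nu>) / \<nu> * dual_form M F F"
      by (rule dual_form_lincomb[OF F(1) V(1) F(1)])
    finally have key: "\<nu> * dual_form M F ?W = dual_form M F V + (1 - \<nu>) * dual_form M F F"
      using nu by (simp add: field_simps)
    \<comment> \<open>Solving \<open>key\<close> for \<nu>: the error is the small linear term
      divided by \<open>dual_form M F F\<close>, which is at least 1.\<close>
    have "\<nu> - 1 - dual_form M F V / dual_form M F F = - (\<nu> * dual_form M F ?W) / dual_form M F F"
      unfolding key using AF by (simp add: field_simps)
    hence "\<bar>\<nu> - 1 - dual_form M F V / dual_form M F F\<bar> = \<nu> * \<bar>dual_form M F ?W\<bar> / dual_form M F F"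
      using AF nu by (simp add: abs_mult abs_divide)
    also have "\<dots> \<le> \<nu> * \<bar>dual_form M F ?W\<bar> / 1"
      using AF nu by (intro divide_left_mono) auto
    finally show "\<bar>nrm M (\<lambda>x. F x + V x) - 1 - dual_form M F V / dual_form M F F\<bar> \<le> \<epsilon> * nrm M V"
      using est by (simp add: \<nu>_def)
  qed
qed

text \<open>Homogeneity reduces this to norm 1: \<open>dual_form M F\<close> is unchanged when
  \<open>F\<close> is normalised, and the remaining quantities scale by
  \<open>nrm M F\<close>.\<close>

theorem nrm_frechet:
  fixes F :: "'m \<Rightarrow> 'e::euclidean_space"
  assumes F: "F \<in> orlicz_space M" "nrm M F > 0" and e: "\<epsilon> > 0"
  obtains \<delta> where "\<delta> > 0" "\<And>V :: 'm \<Rightarrow> 'e. V \<in> orlicz_space M \<Longrightarrow> nrm M V < \<delta> \<Longrightarrow>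
    \<bar>nrm M (\<lambda>x. F x + V x) - nrm M F - nrm M F * dual_form M F V / dual_form M F F\<bar> \<le> \<epsilon> * nrm M V"
proof -
  define N where "N = nrm M F"
  have N: "N > 0" using F by (simp add: N_def)
  let ?E = "\<lambda>x. (1 / N) *\<^sub>R F x"
  have E: "?E \<in> orlicz_space M" "nrm M ?E = 1"
    using F N by (auto intro: orlicz_space_scaleR simp: nrm_scaleR N_def)
  have df: "dual_form M ?E V = dual_form M F V" for V :: "'m \<Rightarrow> 'e"
    using N E(2) by (simp add: dual_form_def N_def)
  obtain \<delta> where d: "\<delta> > 0" "\<And>V :: 'm \<Rightarrow> 'e. V \<in> orlicz_space M \<Longrightarrow> nrm M V < \<delta> \<Longrightarrow>
    \<bar>nrm M (\<lambda>x. ?E x + V x) - 1 - dual_form M ?E V / dual_form M ?E ?E\<bar> \<le> \<epsilon> * nrm M V"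
    using nrm_frechet_normalized[OF E e] by blast
  have sc: "dual_form M F (\<lambda>x. c *\<^sub>R V x) = c * dual_form M F V" for c and V :: "'m \<Rightarrow> 'e"
    by (simp add: dual_form_def)
  show thesis
  proof (rule that)
    show "N * \<delta> > 0" using N d by simp
    fix V :: "'m \<Rightarrow> 'e"
    assume V: "V \<in> orlicz_space M" "nrm M V < N * \<delta>"
    let ?V = "\<lambda>x. (1 / N) *\<^sub>R V x"
    have nV: "nrm M ?V = nrm M V / N" using N by (simp add: nrm_scaleR)
    have eq: "nrm M (\<lambda>x. ?E x + ?V x) = nrm M (\<lambda>x. F x + V x) / N"
      using nrm_scaleR[of M "1 / N" "\<lambda>x. F x + V x"] N by (simp add: scaleR_add_right)
    have "\<bar>nrm M (\<lambda>x. ?E x + ?V x) - 1 - dual_form M ?E ?V / dual_form M ?E ?E\<bar> \<le> \<epsilon> * nrm M ?V"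
      using V N by (intro d(2) orlicz_space_scaleR) (auto simp: nV field_simps)
    hence "N * \<bar>nrm M (\<lambda>x. F x + V x) / N - 1 - dual_form M F V / dual_form M F F\<bar> \<le> N * (\<epsilon> * (nrm M V / N))"
      unfolding df sc eq nV using N by (intro mult_left_mono) auto
    moreover have "N * \<bar>nrm M (\<lambda>x. F x + V x) / N - 1 - dual_form M F V / dual_form M F F\<bar>
      = \<bar>N * (nrm M (\<lambda>x. F x + V x) / N - 1 - dual_form M F V / dual_form M F F)\<bar>"
      using N by (simp add: abs_mult)
    moreover have "N * (nrm M (\<lambda>x. F x + V x) / N - 1 - dual_form M F V / dual_form M F F)
      = nrm M (\<lambda>x. F x + V x) - N - N * dual_form M F V / dual_form M F F"
      using N by (simp add: algebra_simps)
    ultimately show "\<bar>nrm M (\<lambda>x. F x + V x) - nrm M F - nrm M F * dual_form M F V / dual_form M F F\<bar> \<le> \<epsilon> * nrm M V"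
      using N by (simp add: N_def)
  qed
qed

end

section \<open>Smooth functions and the fundamental lemma\<close>

lemma C_k_imp_differentiable: "C_k (Suc k) f \<Longrightarrow> f differentiable (at x)"
  by simp

lemma C_k_SucD: "C_k (Suc k) f \<Longrightarrow> C_k k f"
proof (induction k arbitrary: f)
  case 0
  thus ?case by (simp add: differentiable_imp_continuous_within continuous_at_imp_continuous_on)
next
  case (Suc k)
  have "C_k (Suc k) (\<lambda>x. frechet_derivative f (at x) b)" if "b \<in> Basis" for b
    using Suc.prems that unfolding C_k.simps(2)[of "Suc k"] by blast
  hence "C_k k (\<lambda>x. frechet_derivative f (at x) b)" if "b \<in> Basis" for b
    using Suc.IH that by blast
  moreover have "f differentiable (at x)" for x
    using Suc.prems by (rule C_k_imp_differentiable)
  ultimately show ?case by simp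
qed

lemma frechet_derivative_eqI:
  "(f has_derivative f') (at x) \<Longrightarrow> frechet_derivative f (at x) = f'"
  using frechet_derivative_at by metis

lemma C_k_SucI:
  assumes "\<And>x. (f has_derivative f' x) (at x)" "\<And>b. b \<in> Basis \<Longrightarrow> C_k k (\<lambda>x. f' x b)"
  shows "C_k (Suc k) f"
proof -
  have "f differentiable (at x)" for x using assms(1) by (auto simp: differentiable_def)
  moreover have "frechet_derivative f (at x) = f' x" for x
    by (rule frechet_derivative_eqI[OF assms(1)])
  ultimately show ?thesis using assms(2) by simp
qed

lemma C_k_Suc_has_derivative:
  "C_k (Suc k) f \<Longrightarrow> (f has_derivative frechet_derivative f (at x)) (at x)"
  using C_k_imp_differentiable frechet_derivative_works by blast

lemma C_k_Suc_deriv: "C_k (Suc k) f \<Longrightarrow> b \<in> Basis \<Longrightarrow> C_k k (\<lambda>x. frechet_derivative f (at x) b)"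
  by simp

lemma C_k_const [simp]: "C_k k (\<lambda>_. c)"
proof (induction k arbitrary: c)
  case (Suc k)
  show ?case by (rule C_k_SucI[where f' = "\<lambda>_ _. 0"]) (auto intro: Suc)
qed simp

lemma C_k_add: "C_k k f \<Longrightarrow> C_k k h \<Longrightarrow> C_k k (\<lambda>x. f x + h x)"
proof (induction k arbitrary: f h)
  case (Suc k)
  show ?case
  proof (rule C_k_SucI)
    show "((\<lambda>x. f x + h x) has_derivative
      (\<lambda>b. frechet_derivative f (at x) b + frechet_derivative h (at x) b)) (at x)" for x
      by (intro has_derivative_add C_k_Suc_has_derivative[OF Suc.prems(1)]
        C_k_Suc_has_derivative[OF Suc.prems(2)])
    show "C_k k (\<lambda>x. frechet_derivative f (at x) b + frechet_derivative h (at x) b)" if "b \<in> Basis" for b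
      using Suc.prems that by (intro Suc.IH C_k_Suc_deriv)
  qed
qed (auto intro: continuous_on_add)

lemma C_k_mult: "C_k k f \<Longrightarrow> C_k k h \<Longrightarrow> C_k k (\<lambda>x. f x * h x)"
proof (induction k arbitrary: f h)
  case (Suc k)
  show ?case
  proof (rule C_k_SucI)
    show "((\<lambda>x. f x * h x) has_derivative
      (\<lambda>b. f x * frechet_derivative h (at x) b + frechet_derivative f (at x) b * h x)) (at x)" for x
      by (intro has_derivative_mult C_k_Suc_has_derivative[OF Suc.prems(1)]
        C_k_Suc_has_derivative[OF Suc.prems(2)])
    show "C_k k (\<lambda>x. f x * frechet_derivative h (at x) b + frechet_derivative f (at x) b * h x)"
      if "b \<in> Basis" for b
      by (intro C_k_add Suc.IH C_k_Suc_deriv Suc.prems C_k_SucD[OF Suc.prems(1)]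
          C_k_SucD[OF Suc.prems(2)] that)
  qed
qed (auto intro: continuous_on_mult)

lemma C_k_inner_const: "C_k k (\<lambda>x. x \<bullet> c)"
proof (cases k)
  case (Suc j)
  show ?thesis unfolding Suc
    by (rule C_k_SucI[where f' = "\<lambda>_ h. h \<bullet> c"]) (auto intro!: derivative_eq_intros)
qed (auto intro!: continuous_intros)

lemma C_k_prod: "finite A \<Longrightarrow> (\<And>i. i \<in> A \<Longrightarrow> C_k k (f i)) \<Longrightarrow> C_k k (\<lambda>x. \<Prod>i\<in>A. f i x)"
  by (induction A rule: finite_induct) (auto intro: C_k_mult)

section \<open>Smooth bumps filling a box\<close>

definition flat_exp :: "nat \<Rightarrow> real \<Rightarrow> real" where
  "flat_exp m x = (if x \<le> 0 then 0 else exp (- 1 / x) / x ^ m)"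

lemma flat_exp_tendsto_0: "(flat_exp m \<longlongrightarrow> 0) (at_right 0)"
proof -
  have "((\<lambda>x. (inverse x) ^ m / exp (inverse x)) \<longlongrightarrow> 0) (at_right (0::real))"
    using filterlim_compose[OF tendsto_power_div_exp_0 filterlim_inverse_at_top_right] .
  moreover have "\<forall>\<^sub>F x in at_right (0::real). (inverse x) ^ m / exp (inverse x) = flat_exp m x"
    using eventually_at_right_less[of 0]
    by eventually_elim (auto simp: flat_exp_def exp_minus field_simps power_inverse)
  ultimately show ?thesis by (rule Lim_transform_eventually)
qed

text \<open>The index \<open>m\<close> is there to make the family closed under differentiation. At
  0 the right difference quotient of \<open>flat_exp m\<close> is \<open>flat_exp (m + 1)\<close>,
  which tends to 0.\<close>

lemma flat_exp_has_derivative: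
  "(flat_exp m has_real_derivative (flat_exp (m + 2) x - real m * flat_exp (m + 1) x)) (at x)"
proof -
  consider "x > 0" | "x < 0" | "x = 0" by linarith
  thus ?thesis
  proof cases
    case 1
    have "((\<lambda>x. exp (- 1 / x) / x ^ m) has_real_derivative (flat_exp (m + 2) x - real m * flat_exp (m + 1) x)) (at x)"
    proof (cases m)
      case 0
      show ?thesis using 1 unfolding 0
        by (auto intro!: derivative_eq_intros simp: flat_exp_def field_simps power2_eq_square)
    next
      case (Suc j)
      show ?thesis using 1 unfolding Suc
        by (auto intro!: derivative_eq_intros simp: flat_exp_def)
          (cases j; simp add: field_simps power2_eq_square)
    qed
    thus ?thesis
    proof (rule has_field_derivative_transform_within_open[where S = "{0<..}"])
      show "exp (- 1 / y) / y ^ m = flat_exp m y" if "y \<in> {0<..}" for y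
        using that by (simp add: flat_exp_def)
    qed (use 1 in auto)
  next
    case 2
    have "((\<lambda>_. 0) has_real_derivative 0) (at x)" by simp
    hence "(flat_exp m has_real_derivative 0) (at x)"
    proof (rule has_field_derivative_transform_within_open[where S = "{..<0}"])
      show "0 = flat_exp m y" if "y \<in> {..<0}" for y
        using that by (simp add: flat_exp_def)
    qed (use 2 in auto)
    thus ?thesis using 2 by (simp add: flat_exp_def)
  next
    case 3
    have "((\<lambda>h. (flat_exp m (0 + h) - flat_exp m 0) / h) \<longlongrightarrow> 0) (at 0)"
    proof (rule filterlim_split_at)
      have "\<forall>\<^sub>F h in at_left (0::real). 0 = (flat_exp m (0 + h) - flat_exp m 0) / h"
        using eventually_at_left_real[of "-1" 0] by (auto elim!: eventually_mono simp: flat_exp_def)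
      thus "((\<lambda>h. (flat_exp m (0 + h) - flat_exp m 0) / h) \<longlongrightarrow> 0) (at_left 0)"
        by (rule Lim_transform_eventually[OF tendsto_const])
      have "\<forall>\<^sub>F h in at_right (0::real). flat_exp (m + 1) h = (flat_exp m (0 + h) - flat_exp m 0) / h"
        using eventually_at_right_less[of 0] by eventually_elim (auto simp: flat_exp_def)
      thus "((\<lambda>h. (flat_exp m (0 + h) - flat_exp m 0) / h) \<longlongrightarrow> 0) (at_right 0)"
        by (rule Lim_transform_eventually[OF flat_exp_tendsto_0])
    qed
    hence "(flat_exp m has_real_derivative 0) (at 0)"
      by (simp add: DERIV_def)
    thus ?thesis using 3 by (simp add: flat_exp_def)
  qed
qed

text \<open>The chain rule reproduces members of the same family composed with \<open>w\<close>, so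
  one induction over \<open>k\<close> with \<open>m\<close> arbitrary suffices.\<close>

lemma C_k_flat_exp:
  assumes "\<And>j. C_k j w" shows "C_k k (\<lambda>x. flat_exp m (w x))"
proof (induction k arbitrary: m)
  case 0
  have "continuous_on UNIV w" using assms[of 0] by simp
  moreover have "continuous_on UNIV (flat_exp m)"
    by (rule DERIV_continuous_on) (auto intro: flat_exp_has_derivative DERIV_subset)
  ultimately show ?case
    using continuous_on_compose2[of UNIV "flat_exp m" UNIV w] by simp
next
  case (Suc k)
  show ?case
  proof (rule C_k_SucI)
    show "((\<lambda>x. flat_exp m (w x)) has_derivative
      (\<lambda>b. frechet_derivative w (at x) b * (flat_exp (m + 2) (w x) + (- real m) * flat_exp (m + 1) (w x)))) (at x)" for x
      using DERIV_compose_FDERIV[OF flat_exp_has_derivative C_k_Suc_has_derivative[OF assms]] by simp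
    show "C_k k (\<lambda>x. frechet_derivative w (at x) b * (flat_exp (m + 2) (w x) + (- real m) * flat_exp (m + 1) (w x)))"
      if "b \<in> Basis" for b
      using that by (intro C_k_mult C_k_add Suc.IH C_k_const C_k_Suc_deriv[OF assms])
  qed
qed

text \<open>The product is a smooth weight that is positive exactly on the open box. Applying
  exp(-1/y) to growing multiples of it drives the values to 1 inside while they stay 0 outside;
  \<open>Suc n\<close> keeps the multiple positive at \<open>n = 0\<close>.\<close>

definition box_bump :: "'a::euclidean_space \<Rightarrow> 'a \<Rightarrow> nat \<Rightarrow> 'a \<Rightarrow> real" where
  "box_bump a b n x =
     flat_exp 0 (real (Suc n) * (\<Prod>i\<in>Basis. flat_exp 0 (x \<bullet> i - a \<bullet> i) * flat_exp 0 (b \<bullet> i - x \<bullet> i)))"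

lemma flat_exp_nonneg: "flat_exp m x \<ge> 0"
  by (simp add: flat_exp_def)

lemma flat_exp_0_le_1: "flat_exp 0 x \<le> 1"
  by (simp add: flat_exp_def)

lemma flat_exp_pos_iff: "flat_exp m x > 0 \<longleftrightarrow> x > 0"
  by (auto simp: flat_exp_def)

lemma box_bump_nonneg: "box_bump a b n x \<ge> 0"
  by (simp add: box_bump_def flat_exp_nonneg)

lemma box_bump_le_1: "box_bump a b n x \<le> 1"
  by (simp add: box_bump_def flat_exp_0_le_1)

lemma C_k_box_bump: "C_k k (box_bump a b n)"
proof -
  have "C_k k (\<lambda>x. flat_exp 0 (real (Suc n) *
      (\<Prod>i\<in>Basis. flat_exp 0 (x \<bullet> i + (- (a \<bullet> i))) * flat_exp 0 (b \<bullet> i + (- 1) * (x \<bullet> i)))))"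
    by (intro C_k_flat_exp C_k_mult C_k_const C_k_prod C_k_add C_k_inner_const) auto
  thus ?thesis unfolding box_bump_def[abs_def] by simp
qed

lemma box_weight_pos_iff:
  fixes x :: "'a::euclidean_space"
  shows "(\<Prod>i\<in>Basis. flat_exp 0 (x \<bullet> i - a \<bullet> i) * flat_exp 0 (b \<bullet> i - x \<bullet> i)) > 0 \<longleftrightarrow> x \<in> box a b"
proof
  assume "x \<in> box a b"
  thus "(\<Prod>i\<in>Basis. flat_exp 0 (x \<bullet> i - a \<bullet> i) * flat_exp 0 (b \<bullet> i - x \<bullet> i)) > 0"
    by (intro prod_pos mult_pos_pos) (auto simp: flat_exp_pos_iff mem_box)
next
  assume p: "(\<Prod>i\<in>Basis. flat_exp 0 (x \<bullet> i - a \<bullet> i) * flat_exp 0 (b \<bullet> i - x \<bullet> i)) > 0"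
  have "a \<bullet> i < x \<bullet> i \<and> x \<bullet> i < b \<bullet> i" if "i \<in> Basis" for i
  proof -
    have "flat_exp 0 (x \<bullet> i - a \<bullet> i) * flat_exp 0 (b \<bullet> i - x \<bullet> i) \<noteq> 0"
    proof
      assume "flat_exp 0 (x \<bullet> i - a \<bullet> i) * flat_exp 0 (b \<bullet> i - x \<bullet> i) = 0"
      hence "(\<Prod>i\<in>Basis. flat_exp 0 (x \<bullet> i - a \<bullet> i) * flat_exp 0 (b \<bullet> i - x \<bullet> i)) = 0"
        using that by (intro prod_zero) auto
      thus False using p by (simp only: less_irrefl)
    qed
    hence "flat_exp 0 (x \<bullet> i - a \<bullet> i) \<noteq> 0" "flat_exp 0 (b \<bullet> i - x \<bullet> i) \<noteq> 0" by auto
    hence "flat_exp 0 (x \<bullet> i - a \<bullet> i) > 0" "flat_exp 0 (b \<bullet> i - x \<bullet> i) > 0"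
      using flat_exp_nonneg by (metis less_eq_real_def)+
    thus ?thesis by (simp add: flat_exp_pos_iff)
  qed
  thus "x \<in> box a b" by (simp add: mem_box)
qed

lemma box_bump_pos_iff: "box_bump a b n x > 0 \<longleftrightarrow> x \<in> box a b"
  unfolding box_bump_def flat_exp_pos_iff zero_less_mult_iff box_weight_pos_iff by auto

lemma box_bump_zero: "x \<notin> box a b \<Longrightarrow> box_bump a b n x = 0"
  using box_bump_pos_iff box_bump_nonneg by (metis less_eq_real_def)

lemma box_bump_tendsto: "(\<lambda>n. box_bump a b n x) \<longlonglongrightarrow> indicator (box a b) x"
proof (cases "x \<in> box a b")
  case True
  define w where "w = (\<Prod>i\<in>Basis. flat_exp 0 (x \<bullet> i - a \<bullet> i) * flat_exp 0 (b \<bullet> i - x \<bullet> i))"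
  have w: "w > 0" using True box_weight_pos_iff w_def by metis
  have "(\<lambda>n. exp (- (1 / w) * inverse (real (Suc n)))) \<longlonglongrightarrow> exp (- (1 / w) * 0)"
    by (intro tendsto_intros LIMSEQ_inverse_real_of_nat)
  moreover have "box_bump a b n x = exp (- (1 / w) * inverse (real (Suc n)))" for n
  proof -
    have "box_bump a b n x = flat_exp 0 (real (Suc n) * w)" by (simp only: box_bump_def w_def)
    also have "\<dots> = exp (- 1 / (real (Suc n) * w))"
      using mult_pos_pos[OF _ w, of "real (Suc n)"] by (simp add: flat_exp_def del: of_nat_Suc)
    also have "- 1 / (real (Suc n) * w) = - (1 / w) * inverse (real (Suc n))"
      by (simp add: divide_inverse mult.commute del: of_nat_Suc)
    finally show ?thesis .
  qed
  ultimately show ?thesis using True by simp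
qed (simp add: box_bump_zero)

lemma box_bump_test_function:
  assumes "cbox a b \<subseteq> \<Omega>" shows "box_bump a b n \<in> test_functions \<Omega>"
proof -
  have "{x. box_bump a b n x \<noteq> 0} \<subseteq> cbox a b"
    using box_bump_zero box_subset_cbox by blast
  hence "closure {x. box_bump a b n x \<noteq> 0} \<subseteq> cbox a b"
    by (simp add: closure_minimal closed_cbox)
  moreover from this have "compact (closure {x. box_bump a b n x \<noteq> 0})"
    by (meson bounded_cbox bounded_subset closed_closure compact_eq_bounded_closed)
  ultimately show ?thesis using assms C_k_box_bump by (auto simp: test_functions_def)
qed

text \<open>The bumps are admissible test functions and converge boundedly to the indicator of the
  open box, so orthogonality passes to that indicator; the faces of the box are a null set. The
  conclusion is a gauge integral because the differentiation theorem used next is stated for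
  it.\<close>

lemma box_integral_zero:
  fixes f :: "'a::euclidean_space \<Rightarrow> real"
  assumes "cbox a b \<subseteq> \<Omega>" "set_integrable lborel (cbox a b) f"
    and orth: "\<And>\<phi>. \<phi> \<in> test_functions \<Omega> \<Longrightarrow> (LINT x:\<Omega>|lborel. f x * \<phi> x) = 0"
  shows "integral (cbox a b) f = 0"
proof -
  have fm: "(\<lambda>x. indicator (cbox a b) x * f x) \<in> borel_measurable lborel"
    using assms(2) by (auto simp: set_integrable_def dest: borel_measurable_integrable)
  have bm: "box_bump a b n \<in> borel_measurable borel" for n
    using C_k_box_bump[of 0 a b n] by (auto intro: borel_measurable_continuous_onI)
  have "(\<lambda>n. \<integral>x. (indicator (cbox a b) x * f x) * box_bump a b n x \<partial>lborel)
    \<longlonglongrightarrow> (\<integral>x. (indicator (cbox a b) x * f x) * indicator (box a b) x \<partial>lborel)"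
  proof (rule integral_dominated_convergence)
    show "integrable lborel (\<lambda>x. \<bar>indicator (cbox a b) x * f x\<bar>)"
      using assms(2) by (auto simp: set_integrable_def)
    show "AE x in lborel. (\<lambda>n. (indicator (cbox a b) x * f x) * box_bump a b n x)
        \<longlonglongrightarrow> (indicator (cbox a b) x * f x) * indicator (box a b) x"
      by (intro AE_I2 tendsto_intros box_bump_tendsto)
    show "AE x in lborel. norm ((indicator (cbox a b) x * f x) * box_bump a b n x) \<le> \<bar>indicator (cbox a b) x * f x\<bar>" for n
      using box_bump_nonneg[of a b n] box_bump_le_1[of a b n]
      by (intro AE_I2) (auto simp: abs_mult mult_left_le split: split_indicator)
  qed (use fm bm in measurable)
  moreover have "(\<integral>x. (indicator (cbox a b) x * f x) * box_bump a b n x \<partial>lborel) = 0" for n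
  proof -
    have "(indicator (cbox a b) x * f x) * box_bump a b n x = indicator \<Omega> x *\<^sub>R (f x * box_bump a b n x)" for x
      using assms(1) box_bump_zero[of x a b n] box_subset_cbox[of a b]
      by (auto split: split_indicator)
    thus ?thesis
      using orth[OF box_bump_test_function[OF assms(1)]] unfolding set_lebesgue_integral_def by presburger
  qed
  ultimately have "(\<integral>x. (indicator (cbox a b) x * f x) * indicator (box a b) x \<partial>lborel) = 0"
    by (simp only: LIMSEQ_const_iff)
  moreover have "(\<lambda>x. (indicator (cbox a b) x * f x) * indicator (box a b) x) = (\<lambda>x. indicator (box a b) x *\<^sub>R f x)"
    using box_subset_cbox[of a b] by (intro ext) (auto split: split_indicator)
  ultimately have z: "(LINT x:box a b|lborel. f x) = 0" by (simp add: set_lebesgue_integral_def)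
  have "set_integrable lborel (box a b) f"
    by (rule set_integrable_subset[OF assms(2)]) (auto simp: box_subset_cbox)
  hence "integral (box a b) f = 0" using z by (simp add: set_borel_integral_eq_integral(2))
  thus ?thesis by (simp add: integral_open_interval)
qed

text \<open>All integrals over small cubes inside the open set vanish, so the Lebesgue
  differentiation theorem gives \<open>f x = 0\<close> at almost every point of each box. Countably
  many boxes exhaust the open set.\<close>

lemma fundamental_lemma:
  fixes f :: "'a::euclidean_space \<Rightarrow> real"
  assumes "open \<Omega>"
    and loc: "\<And>K. compact K \<Longrightarrow> K \<subseteq> \<Omega> \<Longrightarrow> set_integrable lborel K f"
    and orth: "\<And>\<phi>. \<phi> \<in> test_functions \<Omega> \<Longrightarrow> (LINT x:\<Omega>|lborel. f x * \<phi> x) = 0"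
  shows "AE x in lborel. x \<in> \<Omega> \<longrightarrow> f x = 0"
proof -
  have on_box: "AE x in lborel. x \<in> cbox c d \<longrightarrow> f x = 0" if cd: "cbox c d \<subseteq> \<Omega>" for c d
  proof -
    \<comment> \<open>Integrability of \<open>f\<close> is only local, while the differentiation
      theorem asks for integrability on every box; hence the truncation.\<close>
    define F where "F = (\<lambda>x. indicator (cbox c d) x * f x)"
    have "set_integrable lborel (cbox c d) f" using loc cd compact_cbox by blast
    hence F: "integrable lborel F" by (simp add: F_def set_integrable_def)
    have Fi: "F integrable_on cbox a b" for a b
    proof -
      have "set_integrable lborel (cbox a b) F" unfolding set_integrable_def
        using F by (intro integrable_mult_indicator) auto
      thus ?thesis by (rule set_borel_integral_eq_integral(1))
    qed
    obtain N where N: "negligible N"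
      "\<And>x e. x \<notin> N \<Longrightarrow> 0 < e \<Longrightarrow> \<exists>\<delta>>0. \<forall>h. 0 < h \<and> h < \<delta> \<longrightarrow>
         norm (integral (cbox x (x + h *\<^sub>R One)) F /\<^sub>R h ^ DIM('a) - F x) < e"
      using integrable_ccontinuous_explicit[of F, OF Fi] by blast
    have "f x = 0" if x: "x \<notin> N" "x \<in> box c d" for x
    proof (rule ccontr)
      assume "f x \<noteq> 0"
      hence Fx: "F x \<noteq> 0" using x box_subset_cbox[of c d] by (auto simp: F_def)
      then obtain \<delta> where d: "\<delta> > 0" "\<And>h. 0 < h \<Longrightarrow> h < \<delta> \<Longrightarrow>
          norm (integral (cbox x (x + h *\<^sub>R One)) F /\<^sub>R h ^ DIM('a) - F x) < norm (F x)"
        using N(2)[OF x(1), of "norm (F x)"] by auto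
      obtain r where r: "r > 0" "ball x r \<subseteq> box c d"
        using x open_contains_ball[of "box c d"] open_box by blast
      \<comment> \<open>Small enough for the differentiation estimate, and such that the cube of
        side \<open>h\<close> with corner \<open>x\<close> lies in \<open>ball x r\<close>: the
        distance to \<open>x\<close> is at most the sum of the coordinate differences, hence at most
        \<open>h * DIM('a)\<close>.\<close>
      define h where "h = min (\<delta> / 2) (r / (2 * real DIM('a)))"
      have h: "0 < h" "h < \<delta>" "h * real DIM('a) < r"
      proof -
        show "0 < h" "h < \<delta>" using d r by (auto simp: h_def)
        have "h * real DIM('a) \<le> r / (2 * real DIM('a)) * real DIM('a)"
          by (intro mult_right_mono) (auto simp: h_def)
        also have "\<dots> < r" using r by simp
        finally show "h * real DIM('a) < r" .
      qed
      have sub: "cbox x (x + h *\<^sub>R One) \<subseteq> cbox c d"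
      proof
        fix y assume y: "y \<in> cbox x (x + h *\<^sub>R One)"
        have "norm (y - x) \<le> (\<Sum>i\<in>Basis. \<bar>(y - x) \<bullet> i\<bar>)" by (rule norm_le_l1)
        also have "\<dots> \<le> (\<Sum>i\<in>(Basis::'a set). h)"
          using y by (intro sum_mono) (auto simp: mem_box inner_diff_left inner_add_left)
        also have "\<dots> < r" using h by (simp add: mult.commute)
        finally have "y \<in> ball x r" by (simp add: dist_norm norm_minus_commute)
        thus "y \<in> cbox c d" using r box_subset_cbox by blast
      qed
      have "integral (cbox x (x + h *\<^sub>R One)) F = integral (cbox x (x + h *\<^sub>R One)) f"
        using sub by (intro integral_cong) (auto simp: F_def)
      also have "\<dots> = 0"
        using sub cd loc by (intro box_integral_zero[OF _ _ orth]) auto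
      finally show False using d(2)[OF h(1,2)] by simp
    qed
    hence "{x. \<not> (x \<in> cbox c d \<longrightarrow> f x = 0)} \<subseteq> N \<union> (cbox c d - box c d)" by blast
    moreover have "negligible (N \<union> (cbox c d - box c d))"
      using N negligible_frontier_interval by (intro negligible_Un) auto
    ultimately have "negligible {x. \<not> (x \<in> cbox c d \<longrightarrow> f x = 0)}"
      by (rule negligible_subset[rotated])
    hence "AE x in lebesgue. x \<in> cbox c d \<longrightarrow> f x = 0"
      by (simp add: negligible_iff_null_sets AE_iff_null_sets eventually_ae_filter) blast
    thus ?thesis by (simp add: AE_completion_iff)
  qed
  obtain D where D: "countable D" "\<And>X. X \<in> D \<Longrightarrow> X \<subseteq> \<Omega> \<and> (\<exists>a b. X = cbox a b)" "\<Union>D = \<Omega>"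
    using open_countable_Union_open_cbox[OF assms(1)] by (metis Pow_iff subset_iff)
  have "AE x in lborel. \<forall>X\<in>D. x \<in> X \<longrightarrow> f x = 0"
    using D on_box by (subst AE_ball_countable) (auto, metis)
  thus ?thesis by (rule AE_mp) (use D(3) in auto)
qed

section \<open>Weak gradients\<close>

lemma integrable_continuous_bounded_support:
  fixes f :: "'a::euclidean_space \<Rightarrow> real"
  assumes "continuous_on UNIV f" "\<And>x. norm x > R \<Longrightarrow> f x = 0"
  shows "integrable lborel f"
proof -
  have "integrable lborel (\<lambda>x. indicator (cball 0 R) x *\<^sub>R f x)"
    using assms(1) continuous_on_subset by (intro borel_integrable_compact) auto
  moreover have "(\<lambda>x. indicator (cball 0 R) x *\<^sub>R f x) = f"
    using assms(2) by (intro ext) (auto split: split_indicator)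
  ultimately show ?thesis by (simp only:)
qed

text \<open>By translation invariance every difference quotient in direction \<open>b\<close> has
  integral zero, and dominated convergence passes to the derivative.\<close>

lemma integral_derivative_compact_support:
  fixes f :: "'a::euclidean_space \<Rightarrow> real"
  assumes f': "\<And>x. (f has_derivative f' x) (at x)"
    and cont: "continuous_on UNIV (\<lambda>x. f' x b)"
    and supp: "\<And>x. norm x > R \<Longrightarrow> f x = 0"
  shows "(\<integral>x. f' x b \<partial>lborel) = 0"
proof -
  \<comment> \<open>Step sizes of at most 1 keep the supports of all difference quotients inside the
    ball of radius \<open>R + norm b\<close>.\<close>
  define h where "h n = inverse (real (Suc n))" for n
  have h: "0 < h n" "h n \<le> 1" for n by (auto simp: h_def field_simps)
  have h0: "h \<longlonglongrightarrow> 0" unfolding h_def by (rule LIMSEQ_inverse_real_of_nat)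
  define q where "q n x = (f (x + h n *\<^sub>R b) - f x) / h n" for n x
  have fc: "continuous_on UNIV f"
    using f' has_derivative_continuous_on[of UNIV f f'] by (simp add: has_derivative_at_withinI)
  have fi: "integrable lborel f" by (rule integrable_continuous_bounded_support[OF fc supp])
  have shift: "integrable lborel (\<lambda>x. f (c + x))" "(\<integral>x. f (c + x) \<partial>lborel) = (\<integral>x. f x \<partial>lborel)" for c
  proof -
    have "distr lborel borel ((+) c) = (lborel :: 'a measure)" by (rule lborel_distr_plus)
    moreover have "integrable (distr lborel borel ((+) c)) f \<longleftrightarrow> integrable lborel (\<lambda>x. f (c + x))"
      using fi by (intro integrable_distr_eq) auto
    moreover have "(\<integral>x. f x \<partial>distr lborel borel ((+) c)) = (\<integral>x. f (c + x) \<partial>lborel)"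
      using fi by (intro integral_distr) auto
    ultimately show "integrable lborel (\<lambda>x. f (c + x))" "(\<integral>x. f (c + x) \<partial>lborel) = (\<integral>x. f x \<partial>lborel)"
      using fi by auto
  qed
  have q0: "(\<integral>x. q n x \<partial>lborel) = 0" for n
  proof -
    have "(\<integral>x. f (h n *\<^sub>R b + x) - f x \<partial>lborel) = 0"
      using shift[of "h n *\<^sub>R b"] fi by simp
    thus ?thesis unfolding q_def by (simp add: add.commute)
  qed
  have line: "((\<lambda>t. f (x + t *\<^sub>R b)) has_real_derivative f' (x + t *\<^sub>R b) b) (at t)" for x t
  proof -
    have "((\<lambda>t. x + t *\<^sub>R b) has_derivative (\<lambda>s. s *\<^sub>R b)) (at t)"
      by (auto intro!: derivative_eq_intros)
    from has_derivative_compose[OF this f'] have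
      "((\<lambda>t. f (x + t *\<^sub>R b)) has_derivative (\<lambda>s. f' (x + t *\<^sub>R b) (s *\<^sub>R b))) (at t)" .
    moreover have "f' (x + t *\<^sub>R b) (s *\<^sub>R b) = f' (x + t *\<^sub>R b) b * s" for s
      using linear_scale[OF has_derivative_linear[OF f'], of "x + t *\<^sub>R b" s b] by simp
    ultimately show ?thesis by (simp add: has_field_derivative_def)
  qed
  \<comment> \<open>The mean value theorem evaluates the derivative at a point at most
    \<open>norm b\<close> away from the ball of radius \<open>R + norm b\<close>.\<close>
  have "bounded ((\<lambda>x. f' x b) ` cball 0 (R + 2 * norm b))"
    using cont continuous_on_subset by (intro compact_imp_bounded compact_continuous_image) auto
  then obtain B where "\<forall>y\<in>(\<lambda>x. f' x b) ` cball 0 (R + 2 * norm b). norm y \<le> B"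
    unfolding bounded_iff by blast
  hence B: "\<bar>f' x b\<bar> \<le> B" if "norm x \<le> R + 2 * norm b" for x
    using that by simp
  have bound: "norm (q n x) \<le> indicator (cball 0 (R + norm b)) x *\<^sub>R B" for n x
  proof (cases "norm x \<le> R + norm b")
    case True
    obtain z where z: "0 < z" "z < h n" "f (x + h n *\<^sub>R b) - f (x + 0 *\<^sub>R b) = (h n - 0) * f' (x + z *\<^sub>R b) b"
      using MVT2[OF h(1)[of n], of "\<lambda>t. f (x + t *\<^sub>R b)" "\<lambda>t. f' (x + t *\<^sub>R b) b"] line by blast
    hence "q n x = f' (x + z *\<^sub>R b) b" using h(1)[of n] by (simp add: q_def)
    moreover have "norm (x + z *\<^sub>R b) \<le> norm x + 1 * norm b"
    proof (rule norm_triangle_le, intro add_left_mono)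
      show "norm (z *\<^sub>R b) \<le> 1 * norm b"
        using z h(2)[of n] unfolding norm_scaleR by (intro mult_right_mono) auto
    qed
    ultimately show ?thesis using True B[of "x + z *\<^sub>R b"] by simp
  next
    case False
    have "norm x \<le> norm (x + h n *\<^sub>R b) + norm (h n *\<^sub>R b)"
      using norm_triangle_ineq4[of "x + h n *\<^sub>R b" "h n *\<^sub>R b"] by simp
    moreover have "norm (h n *\<^sub>R b) \<le> 1 * norm b"
      using h[of n] unfolding norm_scaleR by (intro mult_right_mono) auto
    ultimately have "norm (x + h n *\<^sub>R b) > R" "norm x > R"
      using False norm_ge_zero[of b] by linarith+
    hence "q n x = 0" using supp by (simp add: q_def)
    thus ?thesis using False by simp
  qed
  have "(\<lambda>n. \<integral>x. q n x \<partial>lborel) \<longlonglongrightarrow> (\<integral>x. f' x b \<partial>lborel)"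
  proof (rule integral_dominated_convergence)
    show "(\<lambda>x. f' x b) \<in> borel_measurable lborel"
      using cont by (auto intro: borel_measurable_continuous_onI)
    have [measurable]: "f \<in> borel_measurable borel" using fc by (rule borel_measurable_continuous_onI)
    show "q n \<in> borel_measurable lborel" for n unfolding q_def by measurable
    show "integrable lborel (\<lambda>x::'a. indicator (cball 0 (R + norm b)) x *\<^sub>R B)"
      by (intro borel_integrable_compact) auto
    show "AE x in lborel. (\<lambda>n. q n x) \<longlonglongrightarrow> f' x b"
    proof (intro AE_I2)
      fix x
      have "((\<lambda>t. (f (x + (0 + t) *\<^sub>R b) - f (x + 0 *\<^sub>R b)) / t) \<longlongrightarrow> f' (x + 0 *\<^sub>R b) b) (at 0)"
        using line[of x 0] unfolding DERIV_def .
      moreover have "filterlim h (at 0) sequentially"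
        using h0 h(1) by (auto simp: filterlim_at intro!: always_eventually) (metis less_irrefl)
      ultimately have "(\<lambda>n. (f (x + (0 + h n) *\<^sub>R b) - f (x + 0 *\<^sub>R b)) / h n) \<longlonglongrightarrow> f' (x + 0 *\<^sub>R b) b"
        by (rule filterlim_compose)
      thus "(\<lambda>n. q n x) \<longlonglongrightarrow> f' x b" by (simp add: q_def)
    qed
    show "AE x in lborel. norm (q n x) \<le> indicator (cball 0 (R + norm b)) x *\<^sub>R B" for n
      by (intro AE_I2 bound)
  qed
  thus ?thesis by (simp add: q0 LIMSEQ_const_iff)
qed

lemma test_function_C_k: "\<phi> \<in> test_functions \<Omega> \<Longrightarrow> C_k k \<phi>"
  by (simp add: test_functions_def)

lemma test_function_support:
  assumes "\<phi> \<in> test_functions \<Omega>"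
  shows "\<exists>K. compact K \<and> K \<subseteq> \<Omega> \<and>
    (\<forall>x. x \<notin> K \<longrightarrow> \<phi> x = 0 \<and> (\<forall>b. frechet_derivative \<phi> (at x) b = 0))"
proof (intro exI conjI allI impI)
  let ?K = "closure {x. \<phi> x \<noteq> 0}"
  show "compact ?K" "?K \<subseteq> \<Omega>" using assms by (auto simp: test_functions_def)
  have z: "\<phi> x = 0" if "x \<notin> ?K" for x using that closure_subset[of "{x. \<phi> x \<noteq> 0}"] by auto
  thus "\<phi> x = 0" if "x \<notin> ?K" for x using that .
  fix x b assume x: "x \<notin> ?K"
  have "((\<lambda>_. 0) has_derivative (\<lambda>_. 0)) (at x)" by simp
  hence "(\<phi> has_derivative (\<lambda>_. 0)) (at x)"
  proof (rule has_derivative_transform_within_open[where s = "- ?K"])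
    show "open (- ?K)" by (rule open_Compl) (rule closed_closure)
    show "x \<in> - ?K" using x by blast
    show "0 = \<phi> y" if "y \<in> - ?K" for y by (rule z[symmetric]) (use that in blast)
  qed
  thus "frechet_derivative \<phi> (at x) b = 0" by (simp add: frechet_derivative_eqI)
qed

lemma test_function_has_derivative:
  "\<phi> \<in> test_functions \<Omega> \<Longrightarrow> (\<phi> has_derivative frechet_derivative \<phi> (at x)) (at x)"
  using C_k_Suc_has_derivative test_function_C_k by blast

lemma test_function_continuous: "\<phi> \<in> test_functions \<Omega> \<Longrightarrow> continuous_on UNIV \<phi>"
  using test_function_C_k[of \<phi> \<Omega> 0] by simp

lemma test_function_deriv_continuous:
  "\<phi> \<in> test_functions \<Omega> \<Longrightarrow> b \<in> Basis \<Longrightarrow> continuous_on UNIV (\<lambda>x. frechet_derivative \<phi> (at x) b)"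
  using test_function_C_k[of \<phi> \<Omega> "Suc 0"] C_k_Suc_deriv[of 0 \<phi> b] by simp

lemma set_integrable_mult_compact_support:
  fixes f h :: "'a::euclidean_space \<Rightarrow> real"
  assumes K: "compact K" "K \<subseteq> \<Omega>" "\<And>x. x \<notin> K \<Longrightarrow> h x = 0"
    and h: "continuous_on UNIV h" and f: "set_integrable lborel K f"
  shows "set_integrable lborel \<Omega> (\<lambda>x. f x * h x)"
proof -
  have "bounded (h ` K)"
    by (intro compact_imp_bounded compact_continuous_image continuous_on_subset[OF h] K(1)) auto
  then obtain B where B: "\<And>x. x \<in> K \<Longrightarrow> \<bar>h x\<bar> \<le> B" unfolding bounded_iff by auto
  have [measurable]: "h \<in> borel_measurable borel" using h by (rule borel_measurable_continuous_onI)
  have fi: "integrable lborel (\<lambda>x. indicator K x *\<^sub>R f x)" using f by (simp add: set_integrable_def)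
  have fm [measurable]: "(\<lambda>x. indicator K x *\<^sub>R f x) \<in> borel_measurable lborel"
    using fi by (rule borel_measurable_integrable)
  have "integrable lborel (\<lambda>x. (indicator K x *\<^sub>R f x) * h x)"
  proof (rule Bochner_Integration.integrable_bound)
    show "integrable lborel (\<lambda>x. B * (indicator K x *\<^sub>R f x))" using fi by (rule integrable_mult_right)
    show "AE x in lborel. norm ((indicator K x *\<^sub>R f x) * h x) \<le> norm (B * (indicator K x *\<^sub>R f x))"
    proof (intro AE_I2)
      fix x show "norm ((indicator K x *\<^sub>R f x) * h x) \<le> norm (B * (indicator K x *\<^sub>R f x))"
      proof (cases "x \<in> K")
        case True
        have "\<bar>f x\<bar> * \<bar>h x\<bar> \<le> \<bar>f x\<bar> * \<bar>B\<bar>" using B[OF True] by (intro mult_left_mono) auto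
        thus ?thesis using True by (simp add: abs_mult mult.commute)
      qed simp
    qed
  qed measurable
  moreover have "(\<lambda>x. (indicator K x *\<^sub>R f x) * h x) = (\<lambda>x. indicator \<Omega> x *\<^sub>R (f x * h x))"
    using K by (intro ext) (auto split: split_indicator)
  ultimately show ?thesis by (simp only: set_integrable_def)
qed

lemma set_integrable_inner_Basis:
  "set_integrable lborel K V \<Longrightarrow> set_integrable lborel K (\<lambda>x. V x \<bullet> b)"
  unfolding set_integrable_def using integrable_inner_left[of b lborel "\<lambda>x. indicator K x *\<^sub>R V x"]
  by (cases "b = 0") auto

context
  fixes \<Omega> :: "'a::euclidean_space set" and u :: "'a \<Rightarrow> real" and V :: "'a \<Rightarrow> 'a"
  assumes wg: "weak_gradient \<Omega> u V"
begin

lemma weak_gradient_integrable_deriv: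
  assumes "\<phi> \<in> test_functions \<Omega>" "b \<in> Basis"
  shows "set_integrable lborel \<Omega> (\<lambda>x. u x * frechet_derivative \<phi> (at x) b)"
proof -
  obtain K where K: "compact K" "K \<subseteq> \<Omega>" "\<And>x. x \<notin> K \<Longrightarrow> \<phi> x = 0"
      "\<And>x b. x \<notin> K \<Longrightarrow> frechet_derivative \<phi> (at x) b = 0"
    using test_function_support[OF assms(1)] by blast
  show ?thesis
    by (rule set_integrable_mult_compact_support[OF K(1,2) K(4) test_function_deriv_continuous[OF assms]])
      (use wg K in \<open>auto simp: weak_gradient_def\<close>)
qed

lemma weak_gradient_integrable_inner:
  assumes "\<phi> \<in> test_functions \<Omega>"
  shows "set_integrable lborel \<Omega> (\<lambda>x. (V x \<bullet> b) * \<phi> x)"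
proof -
  obtain K where K: "compact K" "K \<subseteq> \<Omega>" "\<And>x. x \<notin> K \<Longrightarrow> \<phi> x = 0"
      "\<And>x b. x \<notin> K \<Longrightarrow> frechet_derivative \<phi> (at x) b = 0"
    using test_function_support[OF assms(1)] by blast
  show ?thesis
    by (rule set_integrable_mult_compact_support[OF K(1,2,3) test_function_continuous[OF assms]])
      (use wg K in \<open>auto simp: weak_gradient_def intro: set_integrable_inner_Basis\<close>)
qed

lemma weak_gradient_eq:
  assumes "\<phi> \<in> test_functions \<Omega>" "b \<in> Basis"
  shows "(LINT x:\<Omega>|lborel. u x * frechet_derivative \<phi> (at x) b) = - (LINT x:\<Omega>|lborel. (V x \<bullet> b) * \<phi> x)"
  using wg assms by (simp add: weak_gradient_def)

end

text \<open>The fundamental lemma, applied to each coordinate. It determines the arbitrary choice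
  made by \<open>grad\<close> up to null sets, and so makes \<open>grad\<close> linear almost
  everywhere.\<close>

lemma weak_gradient_unique:
  assumes "open \<Omega>" and V: "weak_gradient \<Omega> u V" and W: "weak_gradient \<Omega> u W"
  shows "AE x in lborel. x \<in> \<Omega> \<longrightarrow> V x = W x"
proof -
  have "AE x in lborel. x \<in> \<Omega> \<longrightarrow> V x \<bullet> b - W x \<bullet> b = 0" if b: "b \<in> Basis" for b
  proof (rule fundamental_lemma[OF assms(1)])
    fix K assume "compact K" "K \<subseteq> \<Omega>"
    thus "set_integrable lborel K (\<lambda>x. V x \<bullet> b - W x \<bullet> b)"
      using V W by (intro set_integral_diff set_integrable_inner_Basis) (auto simp: weak_gradient_def)
  next
    fix \<phi> assume phi: "\<phi> \<in> test_functions \<Omega>"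
    have "(LINT x:\<Omega>|lborel. (V x \<bullet> b) * \<phi> x - (W x \<bullet> b) * \<phi> x)
      = (LINT x:\<Omega>|lborel. (V x \<bullet> b) * \<phi> x) - (LINT x:\<Omega>|lborel. (W x \<bullet> b) * \<phi> x)"
      by (intro set_integral_diff weak_gradient_integrable_inner[OF V phi] weak_gradient_integrable_inner[OF W phi])
    also have "\<dots> = 0" using weak_gradient_eq[OF V phi b] weak_gradient_eq[OF W phi b] by simp
    finally show "(LINT x:\<Omega>|lborel. (V x \<bullet> b - W x \<bullet> b) * \<phi> x) = 0"
      by (simp add: left_diff_distrib)
  qed
  hence "AE x in lborel. \<forall>b\<in>Basis. x \<in> \<Omega> \<longrightarrow> V x \<bullet> b - W x \<bullet> b = 0"
    by (intro AE_finite_allI) auto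
  thus ?thesis
  proof eventually_elim
    case (elim x)
    thus ?case by (auto simp: euclidean_eq_iff[of "V x" "W x"] inner_diff_left)
  qed
qed

lemma weak_gradient_lincomb:
  assumes V: "weak_gradient \<Omega> u V" and W: "weak_gradient \<Omega> v W"
  shows "weak_gradient \<Omega> (\<lambda>x. a * u x + c * v x) (\<lambda>x. a *\<^sub>R V x + c *\<^sub>R W x)"
  unfolding weak_gradient_def
proof (intro conjI allI impI ballI)
  show "(\<lambda>x. a *\<^sub>R V x + c *\<^sub>R W x) \<in> borel_measurable borel"
    using V W by (auto simp: weak_gradient_def)
next
  fix K assume "compact K \<and> K \<subseteq> \<Omega>"
  thus "set_integrable lborel K (\<lambda>x. a * u x + c * v x)"
    using V W by (intro set_integral_add set_integrable_mult_right) (auto simp: weak_gradient_def)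
next
  fix K assume "compact K \<and> K \<subseteq> \<Omega>"
  thus "set_integrable lborel K (\<lambda>x. a *\<^sub>R V x + c *\<^sub>R W x)"
    using V W by (intro set_integral_add set_integrable_scaleR_right) (auto simp: weak_gradient_def)
next
  fix \<phi> b assume phi: "\<phi> \<in> test_functions \<Omega>" and b: "b \<in> (Basis :: 'a set)"
  have "(LINT x:\<Omega>|lborel. (a * u x + c * v x) * frechet_derivative \<phi> (at x) b)
    = (LINT x:\<Omega>|lborel. a * (u x * frechet_derivative \<phi> (at x) b) + c * (v x * frechet_derivative \<phi> (at x) b))"
    by (simp add: algebra_simps)
  also have "\<dots> = a * (LINT x:\<Omega>|lborel. u x * frechet_derivative \<phi> (at x) b) + c * (LINT x:\<Omega>|lborel. v x * frechet_derivative \<phi> (at x) b)"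
    using weak_gradient_integrable_deriv[OF V phi b] weak_gradient_integrable_deriv[OF W phi b]
    by (subst set_integral_add) (auto intro: set_integrable_mult_right)
  also have "\<dots> = - (a * (LINT x:\<Omega>|lborel. (V x \<bullet> b) * \<phi> x) + c * (LINT x:\<Omega>|lborel. (W x \<bullet> b) * \<phi> x))"
    using weak_gradient_eq[OF V phi b] weak_gradient_eq[OF W phi b] by simp
  also have "a * (LINT x:\<Omega>|lborel. (V x \<bullet> b) * \<phi> x) + c * (LINT x:\<Omega>|lborel. (W x \<bullet> b) * \<phi> x)
    = (LINT x:\<Omega>|lborel. a * ((V x \<bullet> b) * \<phi> x) + c * ((W x \<bullet> b) * \<phi> x))"
    using weak_gradient_integrable_inner[OF V phi] weak_gradient_integrable_inner[OF W phi]
    by (subst set_integral_add) (auto intro: set_integrable_mult_right)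
  also have "\<dots> = (LINT x:\<Omega>|lborel. ((a *\<^sub>R V x + c *\<^sub>R W x) \<bullet> b) * \<phi> x)"
    by (simp add: inner_add_left algebra_simps)
  finally show "(LINT x:\<Omega>|lborel. (a * u x + c * v x) * frechet_derivative \<phi> (at x) b)
     = - (LINT x:\<Omega>|lborel. ((a *\<^sub>R V x + c *\<^sub>R W x) \<bullet> b) * \<phi> x)" .
qed

text \<open>Integration by parts is the vanishing of the integral of a derivative of
  \<open>\<phi> * \<psi>\<close>. The lemma is needed because membership in \<open>W0_sG\<close>
  speaks of \<open>grad\<close> of differences with test functions.\<close>

lemma test_function_weak_gradient:
  fixes \<phi> :: "'a::euclidean_space \<Rightarrow> real"
  assumes phi: "\<phi> \<in> test_functions \<Omega>"
  shows "weak_gradient \<Omega> \<phi> (\<lambda>x. \<Sum>b\<in>Basis. frechet_derivative \<phi> (at x) b *\<^sub>R b)"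
proof -
  let ?V = "\<lambda>x. \<Sum>b\<in>Basis. frechet_derivative \<phi> (at x) b *\<^sub>R b"
  have Vc: "continuous_on UNIV ?V"
    by (intro continuous_intros test_function_deriv_continuous[OF phi])
  have loc: "set_integrable lborel K \<phi>" "set_integrable lborel K ?V"
    "set_integrable lborel K (\<lambda>x. frechet_derivative \<phi> (at x) b)"
    if "compact K" "b \<in> Basis" for K b
    unfolding set_integrable_def
    by (intro borel_integrable_compact that(1) continuous_on_subset[OF test_function_continuous[OF phi]]
        continuous_on_subset[OF Vc] continuous_on_subset[OF test_function_deriv_continuous[OF phi that(2)]] subset_UNIV)+
  have ibp: "(LINT x:\<Omega>|lborel. \<phi> x * frechet_derivative \<psi> (at x) b) = - (LINT x:\<Omega>|lborel. (?V x \<bullet> b) * \<psi> x)"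
    if psi: "\<psi> \<in> test_functions \<Omega>" and b: "b \<in> Basis" for \<psi> b
  proof -
    obtain K where K: "compact K" "K \<subseteq> \<Omega>" "\<And>x. x \<notin> K \<Longrightarrow> \<psi> x = 0"
      "\<And>x b. x \<notin> K \<Longrightarrow> frechet_derivative \<psi> (at x) b = 0"
      using test_function_support[OF psi] by blast
    have Vb: "?V x \<bullet> b = frechet_derivative \<phi> (at x) b" for x
      using b by (simp add: inner_sum_left inner_Basis if_distrib cong: if_cong)
    let ?D = "\<lambda>x b. \<phi> x * frechet_derivative \<psi> (at x) b + frechet_derivative \<phi> (at x) b * \<psi> x"
    obtain R where R: "\<And>x. x \<in> K \<Longrightarrow> norm x \<le> R"
      using compact_imp_bounded[OF K(1)] unfolding bounded_iff by blast
    have z: "(\<integral>x. ?D x b \<partial>lborel) = 0"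
    proof (rule integral_derivative_compact_support[where f = "\<lambda>x. \<phi> x * \<psi> x" and f' = ?D and R = R])
      show "((\<lambda>x. \<phi> x * \<psi> x) has_derivative ?D x) (at x)" for x
        by (intro has_derivative_mult test_function_has_derivative[OF phi] test_function_has_derivative[OF psi])
      show "continuous_on UNIV (\<lambda>x. ?D x b)"
        by (intro continuous_intros test_function_deriv_continuous[OF phi b] test_function_deriv_continuous[OF psi b]
          test_function_continuous[OF phi] test_function_continuous[OF psi])
      show "\<phi> x * \<psi> x = 0" if "norm x > R" for x using that R[of x] K(3)[of x] by force
    qed
    \<comment> \<open>Both terms contain \<psi> or its derivative and vanish off \<open>K\<close>,
      so integrating over \<Omega> or over the whole space makes no difference.\<close>
    have eq: "(\<lambda>x. ?D x b) = (\<lambda>x. indicator \<Omega> x *\<^sub>R ?D x b)"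
    proof
      fix x show "?D x b = indicator \<Omega> x *\<^sub>R ?D x b"
        using K by (cases "x \<in> K") auto
    qed
    have "(LINT x:\<Omega>|lborel. ?D x b) = 0" unfolding set_lebesgue_integral_def
      by (rule trans[OF arg_cong[where f = "integral\<^sup>L lborel", OF eq[symmetric]] z])
    moreover have "(LINT x:\<Omega>|lborel. ?D x b) = (LINT x:\<Omega>|lborel. \<phi> x * frechet_derivative \<psi> (at x) b)
      + (LINT x:\<Omega>|lborel. frechet_derivative \<phi> (at x) b * \<psi> x)"
    proof (rule set_integral_add)
      show "set_integrable lborel \<Omega> (\<lambda>x. \<phi> x * frechet_derivative \<psi> (at x) b)"
        by (rule set_integrable_mult_compact_support[OF K(1,2)])
          (use K loc[OF K(1) b] test_function_deriv_continuous[OF psi b] in auto)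
      show "set_integrable lborel \<Omega> (\<lambda>x. frechet_derivative \<phi> (at x) b * \<psi> x)"
        by (rule set_integrable_mult_compact_support[OF K(1,2)])
          (use K loc[OF K(1) b] test_function_continuous[OF psi] in auto)
    qed
    ultimately show ?thesis unfolding Vb by simp
  qed
  show ?thesis unfolding weak_gradient_def
    using borel_measurable_continuous_onI[OF Vc] loc(1,2)[OF _ SOME_Basis] ibp
    by (intro conjI allI impI ballI) simp_all
qed

lemma weak_gradient_grad: "weak_gradient \<Omega> u V \<Longrightarrow> weak_gradient \<Omega> u (grad \<Omega> u)"
  using someI[of "weak_gradient \<Omega> u" V] by (simp add: grad_def)

lemma grad_lincomb_AE:
  assumes "open \<Omega>" "weak_gradient \<Omega> u V" "weak_gradient \<Omega> v W"
  shows "AE x in lborel. x \<in> \<Omega> \<longrightarrow> grad \<Omega> (\<lambda>x. a * u x + c * v x) x = a *\<^sub>R grad \<Omega> u x + c *\<^sub>R grad \<Omega> v x"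
proof -
  have "weak_gradient \<Omega> (\<lambda>x. a * u x + c * v x) (\<lambda>x. a *\<^sub>R grad \<Omega> u x + c *\<^sub>R grad \<Omega> v x)"
    using assms by (intro weak_gradient_lincomb weak_gradient_grad)
  thus ?thesis using weak_gradient_unique[OF assms(1) weak_gradient_grad] by blast
qed

lemma test_functions_lincomb:
  assumes "\<phi> \<in> test_functions \<Omega>" "\<psi> \<in> test_functions \<Omega>"
  shows "(\<lambda>x. a * \<phi> x + c * \<psi> x) \<in> test_functions \<Omega>"
proof -
  let ?K = "closure {x. \<phi> x \<noteq> 0} \<union> closure {x. \<psi> x \<noteq> 0}"
  have K: "compact ?K" "?K \<subseteq> \<Omega>" using assms by (auto simp: test_functions_def)
  have "{x. a * \<phi> x + c * \<psi> x \<noteq> 0} \<subseteq> ?K"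
  proof
    fix x assume "x \<in> {x. a * \<phi> x + c * \<psi> x \<noteq> 0}"
    hence "\<phi> x \<noteq> 0 \<or> \<psi> x \<noteq> 0" by auto
    thus "x \<in> ?K"
      using closure_subset[of "{x. \<phi> x \<noteq> 0}"] closure_subset[of "{x. \<psi> x \<noteq> 0}"] by blast
  qed
  hence sub: "closure {x. a * \<phi> x + c * \<psi> x \<noteq> 0} \<subseteq> ?K"
    using K compact_imp_closed closure_minimal by blast
  hence "compact (closure {x. a * \<phi> x + c * \<psi> x \<noteq> 0})"
    using K compact_Int_closed[of ?K "closure {x. a * \<phi> x + c * \<psi> x \<noteq> 0}"] by (simp add: Int_absorb1)
  moreover have "C_k k (\<lambda>x. a * \<phi> x + c * \<psi> x)" for k
    using assms by (intro C_k_add C_k_mult C_k_const) (auto simp: test_functions_def)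
  ultimately show ?thesis using sub K by (auto simp: test_functions_def)
qed

section \<open>The space \<open>W0_sG\<close>\<close>

text \<open>A density on the whole space, so that its measurable functions are the Borel functions
  and set integrals over \<Omega> become plain integrals.\<close>

definition domain_measure :: "'a::euclidean_space set \<Rightarrow> 'a measure" where
  "domain_measure \<Omega> = density lborel (\<lambda>x. ennreal (indicator \<Omega> x))"

text \<open>The factor \<open>1 - s\<close> of the fractional modular is absorbed into the measure,
  which makes the seminorm a plain Luxemburg norm of \<open>D_s s u\<close>.\<close>

definition pair_measure_s :: "real \<Rightarrow> ('a::euclidean_space \<times> 'a) measure" where
  "pair_measure_s s = density mu (\<lambda>_. ennreal (1 - s))"

lemma measurable_domain_measure [simp]: "borel_measurable (domain_measure \<Omega>) = borel_measurable borel"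
  by (auto simp: domain_measure_def measurable_def)

lemma measurable_pair_measure_s [simp]:
  "borel_measurable (pair_measure_s s) = borel_measurable (lborel \<Otimes>\<^sub>M lborel)"
  by (auto simp: pair_measure_s_def mu_def measurable_def)

lemma measurable_ennreal_indicator:
  assumes "open \<Omega>" shows "(\<lambda>x. ennreal (indicator \<Omega> x)) \<in> borel_measurable lborel"
proof -
  have [measurable]: "\<Omega> \<in> sets borel" using assms by (rule borel_open)
  show ?thesis by measurable
qed

lemma AE_domain_measure:
  assumes "open \<Omega>"
  shows "(AE x in domain_measure \<Omega>. P x) \<longleftrightarrow> (AE x in lborel. x \<in> \<Omega> \<longrightarrow> P x)"
proof -
  have "(AE x in domain_measure \<Omega>. P x) \<longleftrightarrow> (AE x in lborel. 0 < ennreal (indicator \<Omega> x) \<longrightarrow> P x)"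
    unfolding domain_measure_def by (rule AE_density[OF measurable_ennreal_indicator[OF assms]])
  also have "\<dots> \<longleftrightarrow> (AE x in lborel. x \<in> \<Omega> \<longrightarrow> P x)"
    by (intro AE_cong) (auto split: split_indicator)
  finally show ?thesis .
qed

lemma measurable_mu_density [measurable]:
  "(\<lambda>(x, y). ennreal (1 / norm (x - y) ^ DIM('a)))
     \<in> borel_measurable (lborel \<Otimes>\<^sub>M (lborel :: 'a::euclidean_space measure))"
  by measurable

text \<open>On the diagonal the density of \<open>mu\<close> is 1/0 = 0, so diagonal points carry no
  weight; elsewhere both density factors are positive.\<close>

lemma AE_pair_measure_s:
  fixes P :: "'a::euclidean_space \<times> 'a \<Rightarrow> bool"
  assumes "s < 1"
  shows "(AE z in pair_measure_s s. P z) \<longleftrightarrow> (AE z in lborel \<Otimes>\<^sub>M lborel. fst z \<noteq> snd z \<longrightarrow> P z)"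
proof -
  have "(AE z in pair_measure_s s. P z) \<longleftrightarrow> (AE z in mu. P z)"
    unfolding pair_measure_s_def using assms by (subst AE_density) (auto simp: mu_def)
  also have "\<dots> \<longleftrightarrow> (AE z in lborel \<Otimes>\<^sub>M lborel. fst z \<noteq> snd z \<longrightarrow> P z)"
    unfolding mu_def AE_density[OF measurable_mu_density]
  proof (rule AE_cong)
    fix z :: "'a \<times> 'a"
    have "0 < ennreal (1 / norm (fst z - snd z) ^ DIM('a)) \<longleftrightarrow> fst z \<noteq> snd z"
      by (cases "fst z = snd z") (simp_all add: zero_power[OF DIM_positive])
    thus "((0 < (case z of (x, y) \<Rightarrow> ennreal (1 / norm (x - y) ^ DIM('a)))) \<longrightarrow> P z)
      \<longleftrightarrow> (fst z \<noteq> snd z \<longrightarrow> P z)"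
      by (simp only: case_prod_beta)
  qed
  finally show ?thesis .
qed

lemma measurable_D_s [measurable]:
  assumes [measurable]: "u \<in> borel_measurable borel"
  shows "D_s s u \<in> borel_measurable (lborel \<Otimes>\<^sub>M lborel)"
  unfolding D_s_def by measurable

lemma D_s_lincomb: "D_s s (\<lambda>x. a * u x + b * v x) z = a *\<^sub>R D_s s u z + b *\<^sub>R D_s s v z"
  by (simp add: D_s_def case_prod_beta algebra_simps add_divide_distrib diff_divide_distrib)

lemma luxemburg_cong:
  assumes "\<And>\<tau>. \<tau> > 0 \<Longrightarrow> \<rho> \<tau> = \<sigma> \<tau>" shows "luxemburg \<rho> = luxemburg \<sigma>"
proof -
  have "{ennreal \<tau> |\<tau>. \<tau> > 0 \<and> \<rho> \<tau> \<le> 1} = {ennreal \<tau> |\<tau>. \<tau> > 0 \<and> \<sigma> \<tau> \<le> 1}"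
    using assms by auto
  thus ?thesis by (simp add: luxemburg_def)
qed

section \<open>Norms of the function space as Luxemburg norms; linearity of the closure\<close>

context orlicz
begin

lemma modular_domain_measure:
  fixes F :: "'a::euclidean_space \<Rightarrow> 'e::euclidean_space"
  assumes "open \<Omega>" "F \<in> borel_measurable borel" "\<tau> > 0"
  shows "modular (domain_measure \<Omega>) F \<tau> = (\<integral>\<^sup>+x\<in>\<Omega>. ennreal (G (norm (F x) / \<tau>)) \<partial>lborel)"
proof -
  have [measurable]: "(\<lambda>x. G (norm (F x) / \<tau>)) \<in> borel_measurable borel"
    using assms by (intro measurable_G_nonneg) auto
  have [measurable]: "\<Omega> \<in> sets borel" using assms by auto
  have "modular (domain_measure \<Omega>) F \<tau>
    = (\<integral>\<^sup>+x. ennreal (indicator \<Omega> x) * ennreal (G (norm (F x) / \<tau>)) \<partial>lborel)"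
    unfolding modular_def domain_measure_def
    by (rule nn_integral_density[OF measurable_ennreal_indicator[OF assms(1)]]) measurable
  also have "\<dots> = (\<integral>\<^sup>+x\<in>\<Omega>. ennreal (G (norm (F x) / \<tau>)) \<partial>lborel)"
    by (intro nn_integral_cong) (auto split: split_indicator)
  finally show ?thesis .
qed

lemma norm_G_eq_lux:
  assumes "open \<Omega>" "u \<in> borel_measurable borel"
  shows "norm_G G \<Omega> u = lux (domain_measure \<Omega>) u"
  unfolding norm_G_def lux_def
  by (rule luxemburg_cong) (simp add: modular_domain_measure[OF assms])

lemma norm_grad_G_eq_lux:
  assumes "open \<Omega>" "weak_gradient \<Omega> u V"
  shows "norm_grad_G G \<Omega> u = lux (domain_measure \<Omega>) (grad \<Omega> u)"
proof -
  have "grad \<Omega> u \<in> borel_measurable borel"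
    using weak_gradient_grad[OF assms(2)] by (simp add: weak_gradient_def)
  thus ?thesis unfolding norm_grad_G_def lux_def
    using assms by (intro luxemburg_cong) (simp add: modular_domain_measure)
qed

lemma seminorm_sG_eq_lux:
  assumes "u \<in> borel_measurable borel"
  shows "seminorm_sG G s u = lux (pair_measure_s s) (D_s s u)"
  unfolding seminorm_sG_def lux_def
proof (rule luxemburg_cong)
  fix \<tau> :: real assume t: "\<tau> > 0"
  have m: "(\<lambda>z. G (norm (D_s s u z) / \<tau>)) \<in> borel_measurable (lborel \<Otimes>\<^sub>M lborel)"
    using assms t by (intro measurable_G_nonneg) auto
  have m': "(\<lambda>z. ennreal (G (norm (D_s s u z) / \<tau>))) \<in> borel_measurable mu"
    using m by (simp add: mu_def)
  have "modular (pair_measure_s s) (D_s s u) \<tau> = (\<integral>\<^sup>+z. ennreal (1 - s) * ennreal (G (norm (D_s s u z) / \<tau>)) \<partial>mu)"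
    unfolding modular_def pair_measure_s_def by (subst nn_integral_density[OF _ m']) auto
  also have "\<dots> = ennreal (1 - s) * (\<integral>\<^sup>+z. ennreal (G (norm (D_s s u z) / \<tau>)) \<partial>mu)"
    by (rule nn_integral_cmult[OF m'])
  finally show "ennreal (1 - s) * (\<integral>\<^sup>+z. ennreal (G (\<bar>D_s s u z\<bar> / \<tau>)) \<partial>mu)
    = modular (pair_measure_s s) (D_s s u) \<tau>" by simp
qed

lemma lux_lincomb:
  assumes "F \<in> borel_measurable M" "H \<in> borel_measurable M"
  shows "lux M (\<lambda>x. a *\<^sub>R F x + b *\<^sub>R H x) \<le> ennreal \<bar>a\<bar> * lux M F + ennreal \<bar>b\<bar> * lux M H"
  using lux_triangle[of "\<lambda>x. a *\<^sub>R F x" M "\<lambda>x. b *\<^sub>R H x"] assms by (simp add: lux_scaleR)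

text \<open>Just enough structure to rewrite the norms as Luxemburg norms. Differences
  \<open>u - \<phi>\<close> belong to it without any prior knowledge that their norms are
  finite.\<close>

definition pre_sobolev :: "real \<Rightarrow> 'a::euclidean_space set \<Rightarrow> ('a \<Rightarrow> real) set" where
  "pre_sobolev s \<Omega> = {u \<in> borel_measurable borel. s = 1 \<longrightarrow> (\<exists>V. weak_gradient \<Omega> u V)}"

lemma pre_sobolev_lincomb:
  "u \<in> pre_sobolev s \<Omega> \<Longrightarrow> v \<in> pre_sobolev s \<Omega> \<Longrightarrow> (\<lambda>x. a * u x + b * v x) \<in> pre_sobolev s \<Omega>"
  using weak_gradient_lincomb unfolding pre_sobolev_def by auto blast+

lemma test_function_pre_sobolev: "\<phi> \<in> test_functions \<Omega> \<Longrightarrow> \<phi> \<in> pre_sobolev s \<Omega>"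
  using test_function_weak_gradient borel_measurable_continuous_onI[OF test_function_continuous]
  unfolding pre_sobolev_def by blast

lemma W_norm_lincomb:
  assumes "open \<Omega>" and u: "u \<in> pre_sobolev s \<Omega>" and v: "v \<in> pre_sobolev s \<Omega>"
  shows "W_norm G s \<Omega> (\<lambda>x. a * u x + b * v x) \<le> ennreal \<bar>a\<bar> * W_norm G s \<Omega> u + ennreal \<bar>b\<bar> * W_norm G s \<Omega> v"
proof -
  have m: "u \<in> borel_measurable borel" "v \<in> borel_measurable borel"
    using u v by (auto simp: pre_sobolev_def)
  have 1: "norm_G G \<Omega> (\<lambda>x. a * u x + b * v x) \<le> ennreal \<bar>a\<bar> * norm_G G \<Omega> u + ennreal \<bar>b\<bar> * norm_G G \<Omega> v"
    using m assms(1) lux_lincomb[of u "domain_measure \<Omega>" v a b] by (simp add: norm_G_eq_lux)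
  have 2: "energy_norm G s \<Omega> (\<lambda>x. a * u x + b * v x)
    \<le> ennreal \<bar>a\<bar> * energy_norm G s \<Omega> u + ennreal \<bar>b\<bar> * energy_norm G s \<Omega> v"
  proof (cases "s = 1")
    case True
    then obtain U V where UV: "weak_gradient \<Omega> u U" "weak_gradient \<Omega> v V"
      using u v by (auto simp: pre_sobolev_def)
    have gm: "grad \<Omega> u \<in> borel_measurable borel" "grad \<Omega> v \<in> borel_measurable borel"
      using UV[THEN weak_gradient_grad] by (auto simp: weak_gradient_def)
    have "norm_grad_G G \<Omega> (\<lambda>x. a * u x + b * v x) = lux (domain_measure \<Omega>) (grad \<Omega> (\<lambda>x. a * u x + b * v x))"
      by (rule norm_grad_G_eq_lux[OF assms(1) weak_gradient_lincomb[OF UV]])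
    also have "\<dots> = lux (domain_measure \<Omega>) (\<lambda>x. a *\<^sub>R grad \<Omega> u x + b *\<^sub>R grad \<Omega> v x)"
      using grad_lincomb_AE[OF assms(1) UV, of a b] assms(1) by (intro lux_cong_AE) (simp add: AE_domain_measure)
    also have "\<dots> \<le> ennreal \<bar>a\<bar> * norm_grad_G G \<Omega> u + ennreal \<bar>b\<bar> * norm_grad_G G \<Omega> v"
      unfolding norm_grad_G_eq_lux[OF assms(1) UV(1)] norm_grad_G_eq_lux[OF assms(1) UV(2)]
      using gm by (intro lux_lincomb) auto
    finally show ?thesis using True by (simp add: energy_norm_def)
  next
    case False
    have "seminorm_sG G s (\<lambda>x. a * u x + b * v x) = lux (pair_measure_s s) (\<lambda>z. a *\<^sub>R D_s s u z + b *\<^sub>R D_s s v z)"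
      using m by (simp add: seminorm_sG_eq_lux D_s_lincomb[abs_def])
    also have "\<dots> \<le> ennreal \<bar>a\<bar> * seminorm_sG G s u + ennreal \<bar>b\<bar> * seminorm_sG G s v"
      unfolding seminorm_sG_eq_lux[OF m(1)] seminorm_sG_eq_lux[OF m(2)]
      using m by (intro lux_lincomb) auto
    finally show ?thesis using False by (simp add: energy_norm_def)
  qed
  show ?thesis using add_mono[OF 1 2] by (simp add: W_norm_def distrib_left ac_simps)
qed

lemma W0_subset_pre_sobolev: "u \<in> W0_sG G s \<Omega> \<Longrightarrow> u \<in> pre_sobolev s \<Omega>"
  by (auto simp: W0_sG_def W_sG_def pre_sobolev_def)

lemma W0_norm_finite: "u \<in> W0_sG G s \<Omega> \<Longrightarrow> W_norm G s \<Omega> u < \<infinity>"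
  by (auto simp: W0_sG_def W_sG_def)

lemma W0_approx:
  assumes "u \<in> W0_sG G s \<Omega>" "\<epsilon> > 0"
  obtains \<phi> where "\<phi> \<in> test_functions \<Omega>" "W_norm G s \<Omega> (\<lambda>x. u x - \<phi> x) < ennreal \<epsilon>"
  using assms by (auto simp: W0_sG_def)

lemma W0_lincomb:
  assumes "open \<Omega>" and u: "u \<in> W0_sG G s \<Omega>" and v: "v \<in> W0_sG G s \<Omega>"
  shows "(\<lambda>x. a * u x + b * v x) \<in> W0_sG G s \<Omega>"
proof -
  let ?w = "\<lambda>x. a * u x + b * v x"
  note pre = W0_subset_pre_sobolev[OF u] W0_subset_pre_sobolev[OF v]
  have "?w \<in> pre_sobolev s \<Omega>" by (rule pre_sobolev_lincomb[OF pre])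
  moreover have "AE x in lborel. x \<notin> \<Omega> \<longrightarrow> ?w x = 0"
  proof -
    have "AE x in lborel. x \<notin> \<Omega> \<longrightarrow> u x = 0" "AE x in lborel. x \<notin> \<Omega> \<longrightarrow> v x = 0"
      using u v by (auto simp: W0_sG_def W_sG_def)
    thus ?thesis by eventually_elim auto
  qed
  moreover have "W_norm G s \<Omega> ?w < \<infinity>"
    using W_norm_lincomb[OF assms(1) pre, of a b] W0_norm_finite[OF u] W0_norm_finite[OF v]
    by (auto simp: ennreal_mult_less_top intro: order_le_less_trans)
  ultimately have W: "?w \<in> W_sG G s \<Omega>" by (auto simp: W_sG_def pre_sobolev_def)
  have "\<exists>\<eta>\<in>test_functions \<Omega>. W_norm G s \<Omega> (\<lambda>x. ?w x - \<eta> x) < ennreal \<epsilon>" if e: "\<epsilon> > 0" for \<epsilon>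
  proof -
    \<comment> \<open>The summand 1 covers \<open>a = b = 0\<close> and makes the final inequality
      strict.\<close>
    define d where "d = \<epsilon> / (\<bar>a\<bar> + \<bar>b\<bar> + 1)"
    have d: "d > 0" using e by (simp add: d_def)
    obtain \<phi> where phi: "\<phi> \<in> test_functions \<Omega>" "W_norm G s \<Omega> (\<lambda>x. u x - \<phi> x) < ennreal d"
      by (rule W0_approx[OF u d])
    obtain \<psi> where psi: "\<psi> \<in> test_functions \<Omega>" "W_norm G s \<Omega> (\<lambda>x. v x - \<psi> x) < ennreal d"
      by (rule W0_approx[OF v d])
    have p: "(\<lambda>x. u x - \<phi> x) \<in> pre_sobolev s \<Omega>" "(\<lambda>x. v x - \<psi> x) \<in> pre_sobolev s \<Omega>"
      using pre_sobolev_lincomb[OF pre(1) test_function_pre_sobolev[OF phi(1)], of 1 "-1"]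
        pre_sobolev_lincomb[OF pre(2) test_function_pre_sobolev[OF psi(1)], of 1 "-1"] by auto
    have "W_norm G s \<Omega> (\<lambda>x. ?w x - (a * \<phi> x + b * \<psi> x))
      = W_norm G s \<Omega> (\<lambda>x. a * (u x - \<phi> x) + b * (v x - \<psi> x))"
      by (simp add: algebra_simps)
    also have "\<dots> \<le> ennreal \<bar>a\<bar> * W_norm G s \<Omega> (\<lambda>x. u x - \<phi> x) + ennreal \<bar>b\<bar> * W_norm G s \<Omega> (\<lambda>x. v x - \<psi> x)"
      by (rule W_norm_lincomb[OF assms(1) p])
    also have "\<dots> \<le> ennreal \<bar>a\<bar> * ennreal d + ennreal \<bar>b\<bar> * ennreal d"
      using phi psi by (intro add_mono mult_left_mono) auto
    also have "\<dots> = ennreal ((\<bar>a\<bar> + \<bar>b\<bar>) * d)"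
      using d by (simp add: ennreal_mult[symmetric] ennreal_plus[symmetric] distrib_right del: ennreal_plus)
    also have "\<dots> < ennreal \<epsilon>"
      using e by (intro ennreal_lessI) (auto simp: d_def field_simps add_pos_nonneg)
    finally show ?thesis by (rule bexI[OF _ test_functions_lincomb[OF phi(1) psi(1)]])
  qed
  thus ?thesis using W by (simp add: W0_sG_def)
qed

end

section \<open>Functions of zero energy\<close>

text \<open>The divergence of \<open>x \<mapsto> (x \<bullet> b) (sqrt (1 + \<phi>\<^sup>2) - 1) b\<close> integrates to zero. The smooth
  substitute for \<open>\<bar>\<phi>\<bar>\<close> avoids differentiating the absolute value.\<close>

lemma poincare_sqrt:
  fixes \<phi> :: "'a::euclidean_space \<Rightarrow> real"
  assumes phi: "\<phi> \<in> test_functions \<Omega>" and b: "b \<in> Basis" and R: "\<Omega> \<subseteq> cball 0 R"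
  shows "integrable lborel (\<lambda>x. sqrt (1 + (\<phi> x)\<^sup>2) - 1)"
    and "integrable lborel (\<lambda>x. \<bar>frechet_derivative \<phi> (at x) b\<bar>)"
    and "(\<integral>x. sqrt (1 + (\<phi> x)\<^sup>2) - 1 \<partial>lborel) \<le> R * (\<integral>x. \<bar>frechet_derivative \<phi> (at x) b\<bar> \<partial>lborel)"
proof -
  let ?d = "\<lambda>x b. frechet_derivative \<phi> (at x) b"
  obtain K where K: "compact K" "K \<subseteq> \<Omega>" "\<And>x. x \<notin> K \<Longrightarrow> \<phi> x = 0"
      "\<And>x b. x \<notin> K \<Longrightarrow> ?d x b = 0"
    using test_function_support[OF phi] by blast
  have out: "\<phi> x = 0" "?d x c = 0" if "norm x > R" for x c
  proof -
    have "x \<notin> K" using that K(2) R by auto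
    thus "\<phi> x = 0" "?d x c = 0" using K(3,4) by blast+
  qed
  have pos: "1 + t\<^sup>2 > 0" for t :: real by (simp add: add_pos_nonneg)
  have nz: "sqrt (1 + t\<^sup>2) \<noteq> 0" for t :: real
    using pos[of t] by (metis real_sqrt_eq_zero_cancel_iff less_irrefl)
  have nz': "1 + t\<^sup>2 \<noteq> 0" for t :: real using pos[of t] by simp
  have phc: "continuous_on UNIV \<phi>" by (rule test_function_continuous[OF phi])
  have dc: "continuous_on UNIV (\<lambda>x. ?d x b)" by (rule test_function_deriv_continuous[OF phi b])
  show i1: "integrable lborel (\<lambda>x. sqrt (1 + (\<phi> x)\<^sup>2) - 1)"
    by (rule integrable_continuous_bounded_support[where R = R]) (auto intro!: continuous_intros phc simp: out)
  show i2: "integrable lborel (\<lambda>x. \<bar>?d x b\<bar>)"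
    by (rule integrable_continuous_bounded_support[where R = R]) (auto intro!: continuous_intros dc simp: out)
  let ?e = "\<lambda>x. (x \<bullet> b) * (\<phi> x / sqrt (1 + (\<phi> x)\<^sup>2) * ?d x b)"
  have i3: "integrable lborel ?e"
    by (rule integrable_continuous_bounded_support[where R = R])
      (auto intro!: continuous_intros phc dc simp: out nz')
  let ?f = "\<lambda>x. (x \<bullet> b) * (sqrt (1 + (\<phi> x)\<^sup>2) - 1)"
  let ?f' = "\<lambda>x h. (x \<bullet> b) * (\<phi> x / sqrt (1 + (\<phi> x)\<^sup>2) * ?d x h) + (h \<bullet> b) * (sqrt (1 + (\<phi> x)\<^sup>2) - 1)"
  have der: "(?f has_derivative ?f' x) (at x)" for x
  proof -
    have "((\<lambda>t. sqrt (1 + t\<^sup>2) - 1) has_real_derivative (\<phi> x / sqrt (1 + (\<phi> x)\<^sup>2))) (at (\<phi> x))"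
      using pos[of "\<phi> x"] by (auto intro!: derivative_eq_intros simp: field_simps)
    from DERIV_compose_FDERIV[OF this test_function_has_derivative[OF phi]]
    have "((\<lambda>x. sqrt (1 + (\<phi> x)\<^sup>2) - 1) has_derivative (\<lambda>h. ?d x h * (\<phi> x / sqrt (1 + (\<phi> x)\<^sup>2)))) (at x)" .
    moreover have "((\<lambda>x. x \<bullet> b) has_derivative (\<lambda>h. h \<bullet> b)) (at x)"
      by (auto intro!: derivative_eq_intros)
    ultimately have "(?f has_derivative (\<lambda>h. (x \<bullet> b) * (?d x h * (\<phi> x / sqrt (1 + (\<phi> x)\<^sup>2)))
        + (h \<bullet> b) * (sqrt (1 + (\<phi> x)\<^sup>2) - 1))) (at x)"
      by (rule has_derivative_mult[rotated])
    thus ?thesis by (simp only: mult.commute[of "?d x _"])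
  qed
  \<comment> \<open>In direction \<open>b\<close> the last term of \<open>?f'\<close> is the
    integrand to be estimated, because \<open>b \<bullet> b = 1\<close>; the rest is
    \<open>?e\<close>, where \<open>\<bar>x \<bullet> b\<bar>\<close> is at most \<open>R\<close> on
    the support and the factor in \<phi> is at most 1.\<close>
  have "(\<integral>x. ?f' x b \<partial>lborel) = 0"
    by (rule integral_derivative_compact_support[OF der, where R = R])
      (auto intro!: continuous_intros phc dc simp: out nz')
  hence eq: "(\<integral>x. sqrt (1 + (\<phi> x)\<^sup>2) - 1 \<partial>lborel) = - (\<integral>x. ?e x \<partial>lborel)"
    using i1 i3 b by (simp add: inner_Basis)
  have "- (\<integral>x. ?e x \<partial>lborel) = (\<integral>x. - ?e x \<partial>lborel)" by simp
  also have "\<dots> \<le> (\<integral>x. R * \<bar>?d x b\<bar> \<partial>lborel)"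
  proof (rule integral_mono)
    show "integrable lborel (\<lambda>x. - ?e x)" using i3 by (rule integrable_minus)
    show "integrable lborel (\<lambda>x. R * \<bar>?d x b\<bar>)" using i2 by (rule integrable_mult_right)
    fix x
    show "- ?e x \<le> R * \<bar>?d x b\<bar>"
    proof (cases "norm x > R")
      case False
      have "\<bar>\<phi> x\<bar> \<le> sqrt (1 + (\<phi> x)\<^sup>2)" by (rule real_le_rsqrt) simp
      hence q: "\<bar>\<phi> x / sqrt (1 + (\<phi> x)\<^sup>2)\<bar> \<le> 1" 
        unfolding abs_divide using pos[of "\<phi> x"] by (subst divide_le_eq_1_pos) auto
      have "- ?e x \<le> \<bar>x \<bullet> b\<bar> * (\<bar>\<phi> x / sqrt (1 + (\<phi> x)\<^sup>2)\<bar> * \<bar>?d x b\<bar>)"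
        using abs_ge_minus_self[of "?e x"] unfolding abs_mult .
      also have "\<dots> \<le> R * (1 * \<bar>?d x b\<bar>)"
      proof (intro mult_mono mult_right_mono q)
        show "\<bar>x \<bullet> b\<bar> \<le> R" using Basis_le_norm[OF b, of x] False by simp
        thus "0 \<le> R" using abs_ge_zero order_trans by blast
      qed auto
      finally show ?thesis by simp
    qed (simp add: out)
  qed
  finally show "(\<integral>x. sqrt (1 + (\<phi> x)\<^sup>2) - 1 \<partial>lborel) \<le> R * (\<integral>x. \<bar>?d x b\<bar> \<partial>lborel)"
    using eq by simp
qed

text \<open>The square root is the Euclidean norm of the pair \<open>(1, a)\<close>, so this is the
  triangle inequality in the plane.\<close>

lemma sqrt_one_plus_square_lipschitz:
  "sqrt (1 + a\<^sup>2) - 1 \<le> (sqrt (1 + b\<^sup>2) - 1) + \<bar>a - b\<bar>" for a b :: real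
proof -
  have "norm (1::real, a) \<le> norm (1::real, b) + norm (0::real, a - b)"
    using norm_triangle_ineq[of "(1::real, b)" "(0::real, a - b)"] by simp
  thus ?thesis by (simp add: norm_prod_def)
qed

context orlicz
begin

text \<open>Integrate \<open>t_le_G\<close> at \<open>norm (F x) / \<epsilon>\<close>, where the
  modular is at most 1. On a bounded domain smallness in the Luxemburg norm thus becomes smallness
  in L^1, the setting of the Poincare estimate.\<close>

lemma L1_le_lux:
  assumes F: "F \<in> borel_measurable M" and e: "\<epsilon> > 0" "lux M F < ennreal \<epsilon>"
  shows "(\<integral>\<^sup>+x. ennreal (norm (F x)) \<partial>M) \<le> ennreal \<epsilon> * (emeasure M (space M) + ennreal (1 / g 1))"
proof -
  have g1: "g 1 > 0" by (simp add: g_pos)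
  have m [measurable]: "(\<lambda>x. G (norm (F x) / \<epsilon>)) \<in> borel_measurable M"
    using F e by (intro measurable_G_nonneg) auto
  have "(\<integral>\<^sup>+x. ennreal (norm (F x)) \<partial>M) \<le> (\<integral>\<^sup>+x. ennreal \<epsilon> * (1 + ennreal (1 / g 1) * ennreal (G (norm (F x) / \<epsilon>))) \<partial>M)"
  proof (intro nn_integral_mono)
    fix x
    have "norm (F x) \<le> \<epsilon> * (1 + 1 / g 1 * G (norm (F x) / \<epsilon>))"
      using t_le_G[of "norm (F x) / \<epsilon>"] e by (simp add: field_simps)
    hence "ennreal (norm (F x)) \<le> ennreal (\<epsilon> * (1 + 1 / g 1 * G (norm (F x) / \<epsilon>)))" by (rule ennreal_leI)
    also have "\<dots> = ennreal \<epsilon> * (1 + ennreal (1 / g 1) * ennreal (G (norm (F x) / \<epsilon>)))"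
    proof -
      have nn: "0 \<le> 1 / g 1" "0 \<le> G (norm (F x) / \<epsilon>)" using e g1 by (auto simp: G_nonneg)
      have "ennreal (\<epsilon> * (1 + 1 / g 1 * G (norm (F x) / \<epsilon>)))
        = ennreal \<epsilon> * (ennreal 1 + ennreal (1 / g 1 * G (norm (F x) / \<epsilon>)))"
        using e nn by (subst ennreal_mult) (auto simp del: ennreal_1)
      thus ?thesis by (simp only: ennreal_mult[OF nn] ennreal_1)
    qed
    finally show "ennreal (norm (F x)) \<le> ennreal \<epsilon> * (1 + ennreal (1 / g 1) * ennreal (G (norm (F x) / \<epsilon>)))" .
  qed
  also have "\<dots> = ennreal \<epsilon> * (emeasure M (space M) + ennreal (1 / g 1) * modular M F \<epsilon>)"
    unfolding modular_def by (subst nn_integral_cmult, measurable, subst nn_integral_add, simp, measurable)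
      (simp add: nn_integral_cmult)
  also have "\<dots> \<le> ennreal \<epsilon> * (emeasure M (space M) + ennreal (1 / g 1) * 1)"
    using modular_le_1[OF e(2)] by (intro mult_left_mono add_left_mono) auto
  finally show ?thesis by simp
qed

lemma nn_integral_domain_measure:
  assumes "open \<Omega>" "f \<in> borel_measurable borel"
  shows "(\<integral>\<^sup>+x. f x \<partial>domain_measure \<Omega>) = (\<integral>\<^sup>+x. indicator \<Omega> x * f x \<partial>lborel)"
  unfolding domain_measure_def
  using assms by (subst nn_integral_density[OF measurable_ennreal_indicator[OF assms(1)]]) (auto simp: ennreal_indicator)

text \<open>Test functions close to \<open>u\<close> have small gradient because \<open>u\<close>
  has none; \<open>poincare_sqrt\<close> makes the integral of \<open>?p\<close> along them small,
  and the Lipschitz bound on \<open>?p\<close> hands this on to \<open>u\<close>.\<close>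

lemma zero_gradient_imp_zero:
  fixes \<Omega> :: "'a::euclidean_space set"
  assumes "open \<Omega>" "bounded \<Omega>" and u: "u \<in> W0_sG G 1 \<Omega>"
    and z: "AE x in domain_measure \<Omega>. grad \<Omega> u x = 0"
  shows "AE x in lborel. u x = 0"
proof -
  let ?M = "domain_measure \<Omega>"
  let ?p = "\<lambda>t::real. sqrt (1 + t\<^sup>2) - 1"
  obtain b :: 'a where b: "b \<in> Basis" using SOME_Basis by blast
  obtain R where R: "\<Omega> \<subseteq> cball 0 R" "R > 0"
    using bounded_subset_ballD[OF assms(2), of 0] ball_subset_cball by blast
  obtain U where U: "weak_gradient \<Omega> u U" using u by (auto simp: W0_sG_def W_sG_def)
  note Ug = weak_gradient_grad[OF U]
  have um [measurable]: "u \<in> borel_measurable borel" using u by (auto simp: W0_sG_def W_sG_def)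
  define A where "A = emeasure ?M (space ?M) + ennreal (1 / g 1)"
  have "emeasure ?M (space ?M) = (\<integral>\<^sup>+x. 1 \<partial>?M)" by simp
  also have "\<dots> = emeasure lborel \<Omega>"
    using assms(1) by (subst nn_integral_domain_measure) auto
  also have "\<dots> < \<infinity>" using assms(2) by (rule emeasure_bounded_finite)
  finally have A: "A < \<infinity>" by (simp add: A_def)
  have main: "(\<integral>\<^sup>+x. ennreal (?p (u x)) \<partial>?M) \<le> ennreal (R + 1) * (ennreal \<epsilon> * A)" if e: "\<epsilon> > 0" for \<epsilon>
  proof -
    obtain \<phi> where phi: "\<phi> \<in> test_functions \<Omega>" "W_norm G 1 \<Omega> (\<lambda>x. u x - \<phi> x) < ennreal \<epsilon>"
      by (rule W0_approx[OF u e])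
    let ?V = "\<lambda>x. \<Sum>b\<in>Basis. frechet_derivative \<phi> (at x) b *\<^sub>R b"
    let ?d = "\<lambda>x. frechet_derivative \<phi> (at x) b"
    have Vg: "weak_gradient \<Omega> \<phi> ?V" by (rule test_function_weak_gradient[OF phi(1)])
    have [measurable]: "\<phi> \<in> borel_measurable borel"
      by (rule borel_measurable_continuous_onI[OF test_function_continuous[OF phi(1)]])
    have [measurable]: "?d \<in> borel_measurable borel"
      by (rule borel_measurable_continuous_onI[OF test_function_deriv_continuous[OF phi(1) b]])
    have Vm [measurable]: "?V \<in> borel_measurable borel" using Vg by (simp add: weak_gradient_def)
    have wg: "weak_gradient \<Omega> (\<lambda>x. u x - \<phi> x) (\<lambda>x. grad \<Omega> u x - ?V x)"
      using weak_gradient_lincomb[OF Ug Vg, of 1 "-1"] by simp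
    have n1: "norm_G G \<Omega> (\<lambda>x. u x - \<phi> x) < ennreal \<epsilon>" and n2: "norm_grad_G G \<Omega> (\<lambda>x. u x - \<phi> x) < ennreal \<epsilon>"
      using phi(2) by (auto simp: W_norm_def energy_norm_def intro: order_le_less_trans[rotated])
    have "lux ?M (\<lambda>x. u x - \<phi> x) < ennreal \<epsilon>"
      using n1 assms(1) by (simp add: norm_G_eq_lux)
    hence b1: "(\<integral>\<^sup>+x. ennreal (norm (u x - \<phi> x)) \<partial>?M) \<le> ennreal \<epsilon> * A"
      unfolding A_def by (intro L1_le_lux e) auto
    \<comment> \<open>As \<open>grad \<Omega> u\<close> vanishes, the gradient of the approximation
      error is minus the gradient of \<phi>, so closeness in norm bounds the gradient of \<phi>
      itself.\<close>
    have "AE x in ?M. grad \<Omega> (\<lambda>x. u x - \<phi> x) x = grad \<Omega> u x - ?V x"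
      unfolding AE_domain_measure[OF assms(1)]
      by (rule weak_gradient_unique[OF assms(1) weak_gradient_grad[OF wg] wg])
    hence "AE x in ?M. grad \<Omega> (\<lambda>x. u x - \<phi> x) x = (-1) *\<^sub>R ?V x"
      using z by eventually_elim simp
    hence "lux ?M (grad \<Omega> (\<lambda>x. u x - \<phi> x)) = lux ?M (\<lambda>x. (-1) *\<^sub>R ?V x)" by (rule lux_cong_AE)
    also have "\<dots> = lux ?M ?V" using lux_scaleR[of ?M "-1" ?V] by simp
    finally have "lux ?M ?V < ennreal \<epsilon>"
      using n2 norm_grad_G_eq_lux[OF assms(1) wg] by simp
    hence b2: "(\<integral>\<^sup>+x. ennreal (norm (?V x)) \<partial>?M) \<le> ennreal \<epsilon> * A"
      unfolding A_def using Vm by (intro L1_le_lux e) simp_all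
    note po = poincare_sqrt[OF phi(1) b R(1)]
    have p0: "?p t \<ge> 0" for t by simp
    have "(\<integral>\<^sup>+x. ennreal (?p (\<phi> x)) \<partial>?M) \<le> (\<integral>\<^sup>+x. ennreal (?p (\<phi> x)) \<partial>lborel)"
      using assms(1) by (subst nn_integral_domain_measure) (auto intro!: nn_integral_mono split: split_indicator)
    also have "\<dots> = ennreal (\<integral>x. ?p (\<phi> x) \<partial>lborel)"
      by (rule nn_integral_eq_integral[OF po(1)]) simp
    also have "\<dots> \<le> ennreal (R * (\<integral>x. \<bar>?d x\<bar> \<partial>lborel))" by (rule ennreal_leI[OF po(3)])
    also have "\<dots> = ennreal R * ennreal (\<integral>x. \<bar>?d x\<bar> \<partial>lborel)" using R by (simp add: ennreal_mult)
    also have "ennreal (\<integral>x. \<bar>?d x\<bar> \<partial>lborel) = (\<integral>\<^sup>+x. ennreal \<bar>?d x\<bar> \<partial>lborel)"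
      by (rule nn_integral_eq_integral[OF po(2), symmetric]) simp
    also have "(\<integral>\<^sup>+x. ennreal \<bar>?d x\<bar> \<partial>lborel) = (\<integral>\<^sup>+x. indicator \<Omega> x * ennreal \<bar>?d x\<bar> \<partial>lborel)"
    proof (intro nn_integral_cong)
      fix x show "ennreal \<bar>?d x\<bar> = indicator \<Omega> x * ennreal \<bar>?d x\<bar>"
      proof (cases "x \<in> \<Omega>")
        case False
        hence "?d x = 0" using test_function_support[OF phi(1)] by blast
        thus ?thesis by simp
      qed simp
    qed
    also have "\<dots> = (\<integral>\<^sup>+x. ennreal \<bar>?d x\<bar> \<partial>?M)"
      using assms(1) by (subst nn_integral_domain_measure) auto
    also have "\<dots> \<le> (\<integral>\<^sup>+x. ennreal (norm (?V x)) \<partial>?M)"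
    proof (intro nn_integral_mono ennreal_leI)
      fix x
      have "?V x \<bullet> b = ?d x" using b by (simp add: inner_sum_left inner_Basis if_distrib cong: if_cong)
      thus "\<bar>?d x\<bar> \<le> norm (?V x)" using Basis_le_norm[OF b, of "?V x"] by simp
    qed
    also note b2
    finally have b3: "(\<integral>\<^sup>+x. ennreal (?p (\<phi> x)) \<partial>?M) \<le> ennreal R * (ennreal \<epsilon> * A)"
      using R by (simp add: mult_left_mono)
    have "(\<integral>\<^sup>+x. ennreal (?p (u x)) \<partial>?M) \<le> (\<integral>\<^sup>+x. ennreal (?p (\<phi> x)) + ennreal (norm (u x - \<phi> x)) \<partial>?M)"
    proof (intro nn_integral_mono)
      fix x
      have "ennreal (?p (u x)) \<le> ennreal (?p (\<phi> x) + norm (u x - \<phi> x))"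
        using sqrt_one_plus_square_lipschitz[of "u x" "\<phi> x"] by (intro ennreal_leI) simp
      thus "ennreal (?p (u x)) \<le> ennreal (?p (\<phi> x)) + ennreal (norm (u x - \<phi> x))"
        using p0 by (simp add: ennreal_plus[symmetric] del: ennreal_plus)
    qed
    also have "\<dots> = (\<integral>\<^sup>+x. ennreal (?p (\<phi> x)) \<partial>?M) + (\<integral>\<^sup>+x. ennreal (norm (u x - \<phi> x)) \<partial>?M)"
      by (rule nn_integral_add) auto
    also have "\<dots> \<le> ennreal R * (ennreal \<epsilon> * A) + 1 * (ennreal \<epsilon> * A)"
      using b1 b3 by (intro add_mono) auto
    also have "\<dots> = ennreal (R + 1) * (ennreal \<epsilon> * A)"
      using R by (simp add: distrib_right)
    finally show ?thesis .
  qed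
  obtain a where a: "A = ennreal a" "a \<ge> 0" using A by (cases A) auto
  have "(\<integral>\<^sup>+x. ennreal (?p (u x)) \<partial>?M) \<le> 0 + ennreal e" if e: "e > 0" for e
  proof -
    \<comment> \<open>Solves \<open>(R + 1) * (\<epsilon> * a) \<le> e\<close>; \<open>a + 1\<close>
      stands in for \<open>a\<close>, which may be 0.\<close>
    define \<epsilon> where "\<epsilon> = e / ((R + 1) * (a + 1))"
    have "\<epsilon> > 0" using e R a by (simp add: \<epsilon>_def)
    hence "(\<integral>\<^sup>+x. ennreal (?p (u x)) \<partial>?M) \<le> ennreal ((R + 1) * (\<epsilon> * a))"
      using main[of \<epsilon>] a R by (simp add: ennreal_mult)
    also have "\<dots> \<le> ennreal e"
    proof (rule ennreal_leI)
      have "(R + 1) * (\<epsilon> * a) = e * (a / (a + 1))" using R a by (simp add: \<epsilon>_def)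
      also have "\<dots> \<le> e * 1" using a e by (intro mult_left_mono) auto
      finally show "(R + 1) * (\<epsilon> * a) \<le> e" by simp
    qed
    finally show ?thesis by simp
  qed
  hence "(\<integral>\<^sup>+x. ennreal (?p (u x)) \<partial>?M) \<le> 0" by (rule ennreal_le_epsilon)
  hence "(\<integral>\<^sup>+x. ennreal (?p (u x)) \<partial>?M) = 0" by simp
  moreover have "(\<lambda>x. ennreal (?p (u x))) \<in> borel_measurable ?M" by simp
  ultimately have "AE x in ?M. ennreal (?p (u x)) = 0"
    by (simp only: nn_integral_0_iff_AE)
  hence "AE x in lborel. x \<in> \<Omega> \<longrightarrow> ennreal (?p (u x)) = 0" using assms(1) by (simp only: AE_domain_measure)
  moreover have "AE x in lborel. x \<notin> \<Omega> \<longrightarrow> u x = 0" using u by (auto simp: W0_sG_def W_sG_def)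
  ultimately show ?thesis
  proof eventually_elim
    case (elim x)
    have "u x = 0" if "ennreal (?p (u x)) = 0"
    proof -
      have "sqrt (1 + (u x)\<^sup>2) \<le> 1" using that by (simp add: ennreal_eq_0_iff)
      hence "1 + (u x)\<^sup>2 \<le> 1" by simp
      thus ?thesis by simp
    qed
    thus ?case using elim by blast
  qed
qed

text \<open>A vanishing quotient off the diagonal gives \<open>u x = u y\<close> for almost all
  pairs, so \<open>u\<close> is constant almost everywhere; the constant is read off at a point
  outside \<Omega>.\<close>

lemma zero_D_s_imp_zero:
  fixes \<Omega> :: "'a::euclidean_space set"
  assumes "open \<Omega>" "bounded \<Omega>" "s < 1" and u: "AE x in lborel. x \<notin> \<Omega> \<longrightarrow> u x = 0"
    and z: "AE z in pair_measure_s s. D_s s u z = 0"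
  shows "AE x in lborel. u x = 0"
proof -
  have "AE z in lborel \<Otimes>\<^sub>M (lborel :: 'a measure). u (fst z) = u (snd z)"
    using z unfolding AE_pair_measure_s[OF assms(3)]
  proof eventually_elim
    case (elim z)
    thus ?case by (cases "fst z = snd z") (auto simp: D_s_def case_prod_beta)
  qed
  from lborel_pair.AE_pair[OF this] have "AE x in lborel. AE y in (lborel :: 'a measure). u x = u y" by simp
  hence ae: "AE x in lborel. (AE y in lborel. u x = u y) \<and> (x \<notin> \<Omega> \<longrightarrow> u x = 0)"
    using u by eventually_elim blast
  \<comment> \<open>Otherwise \<Omega> would have full, hence infinite, measure although it is
    bounded.\<close>
  have "\<exists>x. x \<notin> \<Omega> \<and> (AE y in lborel. u x = u y) \<and> (x \<notin> \<Omega> \<longrightarrow> u x = 0)"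
  proof (rule ccontr)
    assume n: "\<not> ?thesis"
    from ae have "AE x in lborel. x \<in> \<Omega>" by eventually_elim (use n in blast)
    hence "emeasure lborel \<Omega> = emeasure lborel (UNIV :: 'a set)"
      using assms(1) by (intro emeasure_eq_AE) auto
    thus False using emeasure_bounded_finite[OF assms(2)] by simp
  qed
  thus ?thesis by auto
qed

end

section \<open>Critical points of the quotient\<close>

text \<open>\<open>dH\<close> and \<open>dI\<close> are the derivatives of \<open>H\<close> and
  \<open>I\<close> only up to the constants \<open>H u / dH u\<close> and \<open>I u / dI u\<close>,
  as delivered by \<open>nrm_frechet\<close>. The argument works with the cross difference H(u+v)
  I(u) - H(u) I(u+v); its linear part \<open>D\<close> is the derivative of H/I multiplied by the
  square of \<open>I u\<close>.\<close>

lemma quotient_critical_iff: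
  fixes H I dH dI N :: "('a \<Rightarrow> real) \<Rightarrow> real" and u :: "'a \<Rightarrow> real"
  assumes scale: "\<And>c v. v \<in> W \<Longrightarrow> (\<lambda>x. c * v x) \<in> W"
    and N_nonneg: "\<And>v. v \<in> W \<Longrightarrow> 0 \<le> N v" and N_scale: "\<And>c v. v \<in> W \<Longrightarrow> N (\<lambda>x. c * v x) = \<bar>c\<bar> * N v"
    and u: "u \<in> W"
    and U: "\<And>v. v \<in> W \<Longrightarrow> I (\<lambda>x. u x + v x) > 0 \<Longrightarrow> (\<lambda>x. u x + v x) \<in> U"
    and pos: "H u > 0" "I u > 0" "dH u > 0" "dI u > 0"
    and I_lip: "\<And>v. v \<in> W \<Longrightarrow> \<bar>I (\<lambda>x. u x + v x) - I u\<bar> \<le> N v"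
    and dH_scale: "\<And>c v. v \<in> W \<Longrightarrow> dH (\<lambda>x. c * v x) = c * dH v"
    and dI_scale: "\<And>c v. v \<in> W \<Longrightarrow> dI (\<lambda>x. c * v x) = c * dI v"
    and H_diff: "\<And>\<epsilon>. \<epsilon> > 0 \<Longrightarrow> \<exists>\<delta>>0. \<forall>v\<in>W. N v < \<delta> \<longrightarrow>
        \<bar>H (\<lambda>x. u x + v x) - H u - H u * dH v / dH u\<bar> \<le> \<epsilon> * N v"
    and I_diff: "\<And>\<epsilon>. \<epsilon> > 0 \<Longrightarrow> \<exists>\<delta>>0. \<forall>v\<in>W. N v < \<delta> \<longrightarrow>
        \<bar>I (\<lambda>x. u x + v x) - I u - I u * dI v / dI u\<bar> \<le> \<epsilon> * N v"
  shows "has_frechet_derivative_in W N U (\<lambda>v. H v / I v) (\<lambda>_. 0) u \<longleftrightarrow> (\<exists>lam. \<forall>v\<in>W. dH v = lam * dI v)"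
proof -
  define D where "D v = I u * (H u * dH v / dH u) - H u * (I u * dI v / dI u)" for v
  have cross: "\<exists>\<delta>>0. \<forall>v\<in>W. N v < \<delta> \<longrightarrow>
      \<bar>H (\<lambda>x. u x + v x) * I u - H u * I (\<lambda>x. u x + v x) - D v\<bar> \<le> \<epsilon> * N v" if e: "\<epsilon> > 0" for \<epsilon>
  proof -
    \<comment> \<open>The errors of \<open>H\<close> and \<open>I\<close> enter the cross difference
      with the weights \<open>I u\<close> and \<open>H u\<close>.\<close>
    define \<eta> where "\<eta> = \<epsilon> / (I u + H u)"
    have eta: "\<eta> > 0" using e pos by (simp add: \<eta>_def)
    obtain d1 where d1: "d1 > 0" "\<And>v. v \<in> W \<Longrightarrow> N v < d1 \<Longrightarrow>
        \<bar>H (\<lambda>x. u x + v x) - H u - H u * dH v / dH u\<bar> \<le> \<eta> * N v"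
      using H_diff[OF eta] by blast
    obtain d2 where d2: "d2 > 0" "\<And>v. v \<in> W \<Longrightarrow> N v < d2 \<Longrightarrow>
        \<bar>I (\<lambda>x. u x + v x) - I u - I u * dI v / dI u\<bar> \<le> \<eta> * N v"
      using I_diff[OF eta] by blast
    have "\<bar>H (\<lambda>x. u x + v x) * I u - H u * I (\<lambda>x. u x + v x) - D v\<bar> \<le> \<epsilon> * N v"
      if v: "v \<in> W" "N v < min d1 d2" for v
    proof -
      define A where "A = H (\<lambda>x. u x + v x) - H u - H u * dH v / dH u"
      define B where "B = I (\<lambda>x. u x + v x) - I u - I u * dI v / dI u"
      have AB: "\<bar>A\<bar> \<le> \<eta> * N v" "\<bar>B\<bar> \<le> \<eta> * N v"
        using d1(2)[OF v(1)] d2(2)[OF v(1)] v(2) by (auto simp: A_def B_def)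
      have "H (\<lambda>x. u x + v x) * I u - H u * I (\<lambda>x. u x + v x) - D v = I u * A - H u * B"
        by (simp add: A_def B_def D_def algebra_simps)
      also have "\<bar>\<dots>\<bar> \<le> \<bar>I u * A\<bar> + \<bar>H u * B\<bar>" by (rule abs_triangle_ineq4)
      also have "\<dots> = I u * \<bar>A\<bar> + H u * \<bar>B\<bar>" using pos by (simp add: abs_mult)
      also have "\<dots> \<le> I u * (\<eta> * N v) + H u * (\<eta> * N v)"
        using AB pos by (intro add_mono mult_left_mono) auto
      also have "\<dots> = (I u + H u) * \<eta> * N v" by (simp add: algebra_simps)
      also have "(I u + H u) * \<eta> = \<epsilon>" using pos by (simp add: \<eta>_def)
      finally show ?thesis .
    qed
    thus ?thesis using d1(1) d2(1) by (intro exI[of _ "min d1 d2"]) auto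
  qed
  have I_near: "I (\<lambda>x. u x + v x) > I u / 2" "I (\<lambda>x. u x + v x) < 2 * I u"
    if "v \<in> W" "N v < I u / 2" for v
    using I_lip[OF that(1)] that(2) by (auto simp: abs_le_iff)
  have J_diff: "H (\<lambda>x. u x + v x) / I (\<lambda>x. u x + v x) - H u / I u
      = (H (\<lambda>x. u x + v x) * I u - H u * I (\<lambda>x. u x + v x)) / (I u * I (\<lambda>x. u x + v x))"
    if "v \<in> W" "N v < I u / 2" for v
    using I_near[OF that] pos by (simp add: field_simps)
  have D0: "(\<forall>v\<in>W. D v = 0) \<longleftrightarrow> (\<exists>lam. \<forall>v\<in>W. dH v = lam * dI v)"
  proof
    assume "\<forall>v\<in>W. D v = 0"
    \<comment> \<open>The multiplier is the one that testing with \<open>v = u\<close>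
      forces.\<close>
    hence "dH v = dH u / dI u * dI v" if "v \<in> W" for v
      using that pos by (fastforce simp: D_def field_simps)
    thus "\<exists>lam. \<forall>v\<in>W. dH v = lam * dI v" by blast
  next
    assume "\<exists>lam. \<forall>v\<in>W. dH v = lam * dI v"
    then obtain lam where lam: "\<And>v. v \<in> W \<Longrightarrow> dH v = lam * dI v" by blast
    \<comment> \<open>Testing with \<open>u\<close> gives \<open>dH u = lam * dI u\<close>, and
      \<open>dH u\<close> is positive.\<close>
    have l0: "lam \<noteq> 0" using lam[OF u] pos by auto
    show "\<forall>v\<in>W. D v = 0"
      using lam l0 lam[OF u] by (auto simp: D_def)
  qed
  have "has_frechet_derivative_in W N U (\<lambda>v. H v / I v) (\<lambda>_. 0) u \<longleftrightarrow> (\<forall>v\<in>W. D v = 0)"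
  proof
    assume crit: "has_frechet_derivative_in W N U (\<lambda>v. H v / I v) (\<lambda>_. 0) u"
    show "\<forall>v\<in>W. D v = 0"
    proof
      fix v assume v: "v \<in> W"
      \<comment> \<open>The 1 is the error of the cross difference; \<open>2 * I u * I u\<close>
        bounds the denominator by which the quotient estimate is multiplied.\<close>
      define C where "C = (1 + 2 * I u * I u) * N v"
      have C: "C \<ge> 0" using N_nonneg[OF v] pos by (simp add: C_def)
      have le: "\<bar>D v\<bar> \<le> \<epsilon> * C" if e: "\<epsilon> > 0" for \<epsilon>
      proof -
        obtain d1 where d1: "d1 > 0" "\<And>v. v \<in> W \<Longrightarrow> (\<lambda>x. u x + v x) \<in> U \<Longrightarrow> N v < d1 \<Longrightarrow>
            \<bar>H (\<lambda>x. u x + v x) / I (\<lambda>x. u x + v x) - H u / I u\<bar> \<le> \<epsilon> * N v"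
          using crit e unfolding has_frechet_derivative_in_def by (auto; blast)
        obtain d2 where d2: "d2 > 0" "\<And>v. v \<in> W \<Longrightarrow> N v < d2 \<Longrightarrow>
            \<bar>H (\<lambda>x. u x + v x) * I u - H u * I (\<lambda>x. u x + v x) - D v\<bar> \<le> \<epsilon> * N v"
          using cross[OF e] by blast
        define d where "d = min (min d1 d2) (I u / 2)"
        have d: "d > 0" using d1 d2 pos by (simp add: d_def)
        \<comment> \<open>Shrinks \<open>v\<close> into the region where all estimates hold;
          \<open>N v + 1\<close> allows for \<open>N v = 0\<close>. Since \<open>D\<close> is
          homogeneous, \<open>t\<close> cancels in the end.\<close>
        define t where "t = d / (2 * (N v + 1))"
        have t: "t > 0" using d N_nonneg[OF v] by (simp add: t_def)
        have "t * N v = d * (N v / (2 * (N v + 1)))" by (simp add: t_def)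
        also have "\<dots> < d * 1" using d N_nonneg[OF v] by (intro mult_strict_left_mono) auto
        finally have tN: "t * N v < d" by simp
        let ?w = "\<lambda>x. t * v x"
        have w: "?w \<in> W" "N ?w = t * N v" using scale[OF v] N_scale[OF v] t by auto
        have small: "N ?w < d1" "N ?w < d2" "N ?w < I u / 2"
          using tN by (auto simp: w(2) d_def)
        note near = I_near[OF w(1) small(3)]
        define P where "P = H (\<lambda>x. u x + ?w x) * I u - H u * I (\<lambda>x. u x + ?w x)"
        define Q where "Q = I (\<lambda>x. u x + ?w x)"
        have Q: "Q > 0" "Q < 2 * I u" using near pos by (auto simp: Q_def)
        have inU: "(\<lambda>x. u x + ?w x) \<in> U" using near pos by (intro U w(1)) auto
        have "\<bar>P / (I u * Q)\<bar> \<le> \<epsilon> * (t * N v)"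
          using d1(2)[OF w(1) inU small(1)] unfolding J_diff[OF w(1) small(3)] w(2) P_def Q_def .
        hence "\<bar>P\<bar> \<le> \<epsilon> * (t * N v) * (I u * Q)"
          using Q pos by (simp add: abs_divide abs_mult pos_divide_le_eq)
        also have "\<dots> \<le> \<epsilon> * (t * N v) * (I u * (2 * I u))"
          using Q pos e t N_nonneg[OF v] by (intro mult_left_mono) auto
        finally have P: "\<bar>P\<bar> \<le> \<epsilon> * (t * N v) * (I u * (2 * I u))" .
        have "\<bar>P - D ?w\<bar> \<le> \<epsilon> * (t * N v)"
          using d2(2)[OF w(1) small(2)] by (simp add: P_def w(2))
        hence "\<bar>D ?w\<bar> \<le> \<epsilon> * (t * N v) + \<epsilon> * (t * N v) * (I u * (2 * I u))" using P by linarith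
        also have "\<dots> = t * (\<epsilon> * C)" by (simp add: C_def algebra_simps)
        also have "D ?w = t * D v" by (simp add: D_def dH_scale[OF v] dI_scale[OF v] algebra_simps)
        finally have "t * \<bar>D v\<bar> \<le> t * (\<epsilon> * C)" using t by (simp add: abs_mult)
        thus ?thesis using t by simp
      qed
      have "\<bar>D v\<bar> \<le> 0 + e" if "e > 0" for e
      proof -
        have "\<bar>D v\<bar> \<le> e / (C + 1) * C" using le[of "e / (C + 1)"] that C by simp
        also have "\<dots> = e * (C / (C + 1))" by simp
        also have "\<dots> \<le> e * 1" using that C by (intro mult_left_mono) auto
        finally show ?thesis by simp
      qed
      hence "\<bar>D v\<bar> \<le> 0" by (rule field_le_epsilon)
      thus "D v = 0" by simp
    qed
  next
    assume D: "\<forall>v\<in>W. D v = 0"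
    have "\<exists>\<delta>>0. \<forall>v\<in>W. (\<lambda>x. u x + v x) \<in> U \<and> N v < \<delta> \<longrightarrow>
        \<bar>H (\<lambda>x. u x + v x) / I (\<lambda>x. u x + v x) - H u / I u - 0\<bar> \<le> \<epsilon> * N v" if e: "\<epsilon> > 0" for \<epsilon>
    proof -
      \<comment> \<open>\<open>I u * (I u / 2)\<close> is a lower bound for the denominator of the
        difference of quotients near \<open>u\<close>.\<close>
      define \<eta> where "\<eta> = \<epsilon> * (I u * (I u / 2))"
      have eta: "\<eta> > 0" using e pos by (simp add: \<eta>_def)
      obtain d where d: "d > 0" "\<And>v. v \<in> W \<Longrightarrow> N v < d \<Longrightarrow>
            \<bar>H (\<lambda>x. u x + v x) * I u - H u * I (\<lambda>x. u x + v x) - D v\<bar> \<le> \<eta> * N v"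
        using cross[OF eta] by blast
      have "\<bar>H (\<lambda>x. u x + v x) / I (\<lambda>x. u x + v x) - H u / I u\<bar> \<le> \<epsilon> * N v"
        if v: "v \<in> W" "N v < min d (I u / 2)" for v
      proof -
        define P where "P = H (\<lambda>x. u x + v x) * I u - H u * I (\<lambda>x. u x + v x)"
        define Q where "Q = I (\<lambda>x. u x + v x)"
        have small: "N v < I u / 2" "N v < d" using v by auto
        have Q: "Q > I u / 2" using I_near[OF v(1) small(1)] by (simp add: Q_def)
        hence Q0: "Q > 0" using pos by linarith
        have "\<bar>P\<bar> \<le> \<eta> * N v" using d(2)[OF v(1) small(2)] D v(1) by (simp add: P_def)
        also have "\<dots> = \<epsilon> * N v * (I u * (I u / 2))" by (simp add: \<eta>_def)
        also have "\<dots> \<le> \<epsilon> * N v * (I u * Q)"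
          using Q pos e N_nonneg[OF v(1)] by (intro mult_left_mono) auto
        finally have "\<bar>P / (I u * Q)\<bar> \<le> \<epsilon> * N v"
          using Q0 pos by (simp add: abs_divide abs_mult pos_divide_le_eq)
        thus ?thesis unfolding J_diff[OF v(1) small(1)] P_def Q_def .
      qed
      thus ?thesis using d(1) pos by (intro exI[of _ "min d (I u / 2)"]) auto
    qed
    moreover have "\<exists>C. \<forall>v\<in>W. \<bar>0::real\<bar> \<le> C * N v" by (rule exI[of _ 0]) simp
    ultimately show "has_frechet_derivative_in W N U (\<lambda>v. H v / I v) (\<lambda>_. 0) u"
      unfolding has_frechet_derivative_in_def by simp
  qed
  thus ?thesis using D0 by simp
qed

section \<open>From the abstract quotient to the norm and the energy\<close>

context orlicz
begin

lemma flux_normalized_inner: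
  fixes a b :: "'e::euclidean_space"
  assumes "N > 0"
  shows "flux ((1 / N) *\<^sub>R a) \<bullet> b = g (norm a / N) * ((a \<bullet> b) / norm a)"
  using assms by (cases "a = 0") (auto simp: flux_def)

lemma dual_form_domain_measure:
  fixes F V :: "'a::euclidean_space \<Rightarrow> 'e::euclidean_space"
  assumes "open \<Omega>" and [measurable]: "F \<in> borel_measurable borel" "V \<in> borel_measurable borel"
    and N: "nrm (domain_measure \<Omega>) F > 0"
  shows "dual_form (domain_measure \<Omega>) F V =
    (LINT x:\<Omega>|lborel. g (norm (F x) / nrm (domain_measure \<Omega>) F) * ((F x \<bullet> V x) / norm (F x)))"
proof -
  define n where "n = nrm (domain_measure \<Omega>) F"
  have [measurable]: "\<Omega> \<in> sets borel" using assms(1) by (rule borel_open)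
  have "dual_form (domain_measure \<Omega>) F V
      = (\<integral>x. flux ((1 / n) *\<^sub>R F x) \<bullet> V x \<partial>density lborel (\<lambda>x. ennreal (indicator \<Omega> x)))"
    by (simp only: dual_form_def n_def domain_measure_def)
  also have "\<dots> = (\<integral>x. indicator \<Omega> x *\<^sub>R (flux ((1 / n) *\<^sub>R F x) \<bullet> V x) \<partial>lborel)"
    by (rule integral_density) auto
  finally show ?thesis
    using N unfolding set_lebesgue_integral_def n_def by (simp only: flux_normalized_inner)
qed

lemma dual_form_pair_measure_s:
  fixes F V :: "'a::euclidean_space \<times> 'a \<Rightarrow> real"
  assumes "s < 1" and [measurable]: "F \<in> borel_measurable (lborel \<Otimes>\<^sub>M lborel)" "V \<in> borel_measurable (lborel \<Otimes>\<^sub>M lborel)"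
    and N: "nrm (pair_measure_s s) F > 0"
  shows "dual_form (pair_measure_s s) F V =
    (1 - s) * (LINT z|mu. g (\<bar>F z\<bar> / nrm (pair_measure_s s) F) * (F z / \<bar>F z\<bar>) * V z)"
proof -
  define n where "n = nrm (pair_measure_s s) F"
  have hm: "(\<lambda>z. flux ((1 / n) *\<^sub>R F z) \<bullet> V z) \<in> borel_measurable mu"
    by (simp add: mu_def) measurable
  have "dual_form (pair_measure_s s) F V
      = (\<integral>z. flux ((1 / n) *\<^sub>R F z) \<bullet> V z \<partial>density mu (\<lambda>_. ennreal (1 - s)))"
    by (simp only: dual_form_def n_def pair_measure_s_def)
  also have "\<dots> = (\<integral>z. (1 - s) *\<^sub>R (flux ((1 / n) *\<^sub>R F z) \<bullet> V z) \<partial>mu)"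
    using assms(1) by (intro integral_density hm) auto
  also have "\<dots> = (1 - s) * (\<integral>z. flux ((1 / n) *\<^sub>R F z) \<bullet> V z \<partial>mu)"
    by simp
  also have "(\<integral>z. flux ((1 / n) *\<^sub>R F z) \<bullet> V z \<partial>mu)
      = (LINT z|mu. g (\<bar>F z\<bar> / n) * (F z / \<bar>F z\<bar>) * V z)"
    unfolding n_def flux_normalized_inner[OF N] by (rule Bochner_Integration.integral_cong) simp_all
  finally show ?thesis by (simp only: n_def)
qed

text \<open>Pulls \<open>nrm_frechet\<close> back along a map \<open>T\<close> that is additive only
  up to null sets, measuring the error in a larger norm \<open>N\<close>. For the energy
  \<open>T\<close> is the gradient or the difference quotient, for the norm it is the
  identity.\<close>

lemma nrm_frechet_along:
  fixes T :: "('a \<Rightarrow> real) \<Rightarrow> 'm \<Rightarrow> 'e::euclidean_space"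
  assumes space: "\<And>v. v \<in> W \<Longrightarrow> T v \<in> orlicz_space M"
    and add: "\<And>v. v \<in> W \<Longrightarrow> AE x in M. T (\<lambda>x. u x + v x) x = T u x + T v x"
    and N: "\<And>v. v \<in> W \<Longrightarrow> nrm M (T v) \<le> N v"
    and u: "u \<in> W" "nrm M (T u) > 0" and e: "\<epsilon> > 0"
  shows "\<exists>\<delta>>0. \<forall>v\<in>W. N v < \<delta> \<longrightarrow> \<bar>nrm M (T (\<lambda>x. u x + v x)) - nrm M (T u)
    - nrm M (T u) * dual_form M (T u) (T v) / dual_form M (T u) (T u)\<bar> \<le> \<epsilon> * N v"
proof -
  obtain \<delta> where d: "\<delta> > 0" "\<And>V. V \<in> orlicz_space M \<Longrightarrow> nrm M V < \<delta> \<Longrightarrow>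
    \<bar>nrm M (\<lambda>x. T u x + V x) - nrm M (T u)
      - nrm M (T u) * dual_form M (T u) V / dual_form M (T u) (T u)\<bar> \<le> \<epsilon> * nrm M V"
    using nrm_frechet[OF space[OF u(1)] u(2) e] by blast
  have "\<bar>nrm M (T (\<lambda>x. u x + v x)) - nrm M (T u)
    - nrm M (T u) * dual_form M (T u) (T v) / dual_form M (T u) (T u)\<bar> \<le> \<epsilon> * N v"
    if v: "v \<in> W" "N v < \<delta>" for v
  proof -
    have "\<epsilon> * nrm M (T v) \<le> \<epsilon> * N v" using N[OF v(1)] e by simp
    thus ?thesis
      using d(2)[OF space[OF v(1)]] N[OF v(1)] v(2) nrm_cong_AE[OF add[OF v(1)]] by simp
  qed
  thus ?thesis using d(1) by blast
qed

lemma W0_sG_measurable: "v \<in> W0_sG G s \<Omega> \<Longrightarrow> v \<in> borel_measurable borel"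
  by (auto simp: W0_sG_def W_sG_def)

lemma W0_norm_G_finite: "v \<in> W0_sG G s \<Omega> \<Longrightarrow> norm_G G \<Omega> v < \<infinity>"
  and W0_energy_norm_finite: "v \<in> W0_sG G s \<Omega> \<Longrightarrow> energy_norm G s \<Omega> v < \<infinity>"
  by (auto simp: W_norm_def dest!: W0_norm_finite)

lemma W0_orlicz_space: "open \<Omega> \<Longrightarrow> v \<in> W0_sG G s \<Omega> \<Longrightarrow> v \<in> orlicz_space (domain_measure \<Omega>)"
  using W0_norm_G_finite[of v s \<Omega>] W0_sG_measurable[of v s \<Omega>]
  by (simp add: orlicz_space_def norm_G_eq_lux)

lemma I_fun_eq_nrm: "open \<Omega> \<Longrightarrow> v \<in> W0_sG G s \<Omega> \<Longrightarrow> I_fun G \<Omega> v = nrm (domain_measure \<Omega>) v"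
  using W0_sG_measurable[of v s \<Omega>] by (simp add: I_fun_def nrm_def norm_G_eq_lux)

lemma W_norm_eq_sum:
  "v \<in> W0_sG G s \<Omega> \<Longrightarrow> enn2real (W_norm G s \<Omega> v) = I_fun G \<Omega> v + H_fun G s \<Omega> v"
  using W0_norm_G_finite[of v s \<Omega>] W0_energy_norm_finite[of v s \<Omega>]
  by (simp add: W_norm_def I_fun_def H_fun_def enn2real_plus)

text \<open>Treats s = 1 and s < 1 at once: \<open>T\<close> stands for \<open>grad \<Omega>\<close>
  or \<open>D_s s\<close>, and \<open>M\<close> for the measure that turns the energy into a
  Luxemburg norm.\<close>

lemma critical_point_iff_weak_eigen_solution:
  fixes T :: "('a::euclidean_space \<Rightarrow> real) \<Rightarrow> 'm \<Rightarrow> 'e::euclidean_space"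
  assumes op: "open \<Omega>" and u: "u \<in> W0_sG_nonzero G s \<Omega>"
    and space: "\<And>v. v \<in> W0_sG G s \<Omega> \<Longrightarrow> T v \<in> orlicz_space M"
    and energy: "\<And>v. v \<in> W0_sG G s \<Omega> \<Longrightarrow> H_fun G s \<Omega> v = nrm M (T v)"
    and lincomb: "\<And>a b v w. v \<in> W0_sG G s \<Omega> \<Longrightarrow> w \<in> W0_sG G s \<Omega> \<Longrightarrow>
        AE x in M. T (\<lambda>x. a * v x + b * w x) x = a *\<^sub>R T v x + b *\<^sub>R T w x"
    and zero: "(AE x in M. T u x = 0) \<Longrightarrow> AE x in lborel. u x = 0"
    and dual: "\<And>v. v \<in> W0_sG G s \<Omega> \<Longrightarrow> nrm M (T u) > 0 \<Longrightarrow>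
        L_op G g s \<Omega> u v = dual_form M (T u) (T v)"
  shows "critical_point (W0_sG G s \<Omega>) (\<lambda>v. enn2real (W_norm G s \<Omega> v))
           (W0_sG_nonzero G s \<Omega>) (J_fun G s \<Omega>) u
         \<longleftrightarrow> (\<exists>lam. weak_eigen_solution G g s \<Omega> lam u)"
proof -
  let ?W = "W0_sG G s \<Omega>" and ?N = "\<lambda>v. enn2real (W_norm G s \<Omega> v)" and ?D = "domain_measure \<Omega>"
  have uW: "u \<in> ?W" and u0: "\<not> (AE x in lborel. u x = 0)" using u by (auto simp: W0_sG_nonzero_def)
  have lin: "(\<lambda>x. a * v x + b * w x) \<in> ?W" if "v \<in> ?W" "w \<in> ?W" for a b v w
    by (rule W0_lincomb[OF op that])
  have scale: "(\<lambda>x. c * v x) \<in> ?W" if "v \<in> ?W" for c v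
    using lin[OF that that, of c 0] by simp
  have add: "(\<lambda>x. v x + w x) \<in> ?W" if "v \<in> ?W" "w \<in> ?W" for v w
    using lin[OF that, of 1 1] by simp
  have T_scale: "AE x in M. T (\<lambda>x. c * v x) x = c *\<^sub>R T v x" if "v \<in> ?W" for c v
    using lincomb[OF that that, of c 0] by simp
  have N_eq: "?N v = nrm ?D v + nrm M (T v)" if "v \<in> ?W" for v
    using W_norm_eq_sum[OF that] I_fun_eq_nrm[OF op that] energy[OF that] by simp
  have IN: "nrm ?D v \<le> ?N v" and HN: "nrm M (T v) \<le> ?N v" if "v \<in> ?W" for v
    using N_eq[OF that] nrm_nonneg[of ?D v] nrm_nonneg[of M "T v"] by linarith+
  \<comment> \<open>Used in both directions: positivity of the norm at \<open>u\<close>, and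
    membership of \<open>u + v\<close> in the punctured space once its norm is positive.\<close>
  have I_pos_imp: "nrm ?D v > 0 \<longleftrightarrow> \<not> (AE x in lborel. v x = 0)" if v: "v \<in> ?W" for v
  proof
    assume p: "nrm ?D v > 0"
    show "\<not> (AE x in lborel. v x = 0)"
    proof
      assume "AE x in lborel. v x = 0"
      hence "AE x in ?D. v x = 0" unfolding AE_domain_measure[OF op] by eventually_elim simp
      hence "lux ?D v = 0" by (rule lux_AE_zero)
      thus False using p by (simp add: nrm_def)
    qed
  next
    assume n: "\<not> (AE x in lborel. v x = 0)"
    have "nrm ?D v \<noteq> 0"
    proof
      assume "nrm ?D v = 0"
      hence "AE x in lborel. x \<in> \<Omega> \<longrightarrow> v x = 0"
        using nrm_0_imp_AE[OF W0_orlicz_space[OF op v]] by (simp add: AE_domain_measure[OF op])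
      moreover have "AE x in lborel. x \<notin> \<Omega> \<longrightarrow> v x = 0" using v by (auto simp: W0_sG_def W_sG_def)
      ultimately have "AE x in lborel. v x = 0" by eventually_elim blast
      thus False using n by blast
    qed
    thus "nrm ?D v > 0" using nrm_nonneg[of ?D v] by linarith
  qed
  have Iu: "nrm ?D u > 0" using I_pos_imp[OF uW] u0 by blast
  have "nrm M (T u) \<noteq> 0" using nrm_0_imp_AE[OF space[OF uW]] zero u0 by blast
  hence Hu: "nrm M (T u) > 0" using nrm_nonneg[of M "T u"] by linarith
  have dI_eq: "dual_form ?D u v = (LINT x:\<Omega>|lborel. g (\<bar>u x\<bar> / I_fun G \<Omega> u) * (u x * v x / \<bar>u x\<bar>))"
    if "v \<in> ?W" for v
    using dual_form_domain_measure[OF op W0_sG_measurable[OF uW] W0_sG_measurable[OF that] Iu]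
    by (simp add: I_fun_eq_nrm[OF op uW])
  have quot: "has_frechet_derivative_in ?W ?N (W0_sG_nonzero G s \<Omega>) (\<lambda>v. H_fun G s \<Omega> v / I_fun G \<Omega> v) (\<lambda>_. 0) u
    \<longleftrightarrow> (\<exists>lam. \<forall>v\<in>?W. dual_form M (T u) (T v) = lam * dual_form ?D u v)"
  proof (rule quotient_critical_iff)
    show "\<And>c v. v \<in> ?W \<Longrightarrow> (\<lambda>x. c * v x) \<in> ?W" by (rule scale)
    show "\<And>v. v \<in> ?W \<Longrightarrow> 0 \<le> ?N v" by simp
    show "?N (\<lambda>x. c * v x) = \<bar>c\<bar> * ?N v" if v: "v \<in> ?W" for c v
    proof -
      have "nrm M (T (\<lambda>x. c * v x)) = \<bar>c\<bar> * nrm M (T v)"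
        unfolding nrm_cong_AE[OF T_scale[OF v]] by (rule nrm_scaleR)
      moreover have "nrm ?D (\<lambda>x. c * v x) = \<bar>c\<bar> * nrm ?D v"
        using nrm_scaleR[of ?D c v] by simp
      ultimately show ?thesis unfolding N_eq[OF v] N_eq[OF scale[OF v]] by (simp add: distrib_left)
    qed
    show "u \<in> ?W" by (rule uW)
    show "(\<lambda>x. u x + v x) \<in> W0_sG_nonzero G s \<Omega>" if "v \<in> ?W" "I_fun G \<Omega> (\<lambda>x. u x + v x) > 0" for v
      using add[OF uW that(1)] that(2) I_pos_imp[OF add[OF uW that(1)]] I_fun_eq_nrm[OF op add[OF uW that(1)]]
      by (auto simp: W0_sG_nonzero_def)
    show "H_fun G s \<Omega> u > 0" using Hu by (simp add: energy[OF uW])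
    show "I_fun G \<Omega> u > 0" using Iu by (simp add: I_fun_eq_nrm[OF op uW])
    show "dual_form M (T u) (T u) > 0" using dual_form_self_ge[OF space[OF uW] Hu] Hu by linarith
    show "dual_form ?D u u > 0" using dual_form_self_ge[OF W0_orlicz_space[OF op uW] Iu] Iu by linarith
    show "\<bar>I_fun G \<Omega> (\<lambda>x. u x + v x) - I_fun G \<Omega> u\<bar> \<le> ?N v" if v: "v \<in> ?W" for v
    proof -
      have sp: "u \<in> orlicz_space ?D" "v \<in> orlicz_space ?D"
        using W0_orlicz_space[OF op] uW v by auto
      have "nrm ?D (\<lambda>x. u x + v x) \<le> nrm ?D u + nrm ?D v" by (rule nrm_triangle[OF sp])
      moreover have "nrm ?D u \<le> nrm ?D (\<lambda>x. u x + v x) + nrm ?D v"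
        using nrm_triangle[OF orlicz_space_add[OF sp] orlicz_space_scaleR[OF sp(2), of "-1"]]
          nrm_scaleR[of ?D "-1" v] by simp
      ultimately show ?thesis
        using IN[OF v] unfolding I_fun_eq_nrm[OF op uW] I_fun_eq_nrm[OF op add[OF uW v]] by linarith
    qed
    show "dual_form M (T u) (T (\<lambda>x. c * v x)) = c * dual_form M (T u) (T v)" if v: "v \<in> ?W" for c v
    proof -
      have "dual_form M (T u) (T (\<lambda>x. c * v x)) = dual_form M (T u) (\<lambda>x. c *\<^sub>R T v x)"
        using T_scale[OF v] space[OF uW] orlicz_space_measurable[OF space[OF scale[OF v]]]
          orlicz_space_measurable[OF orlicz_space_scaleR[OF space[OF v]]]
        by (rule dual_form_cong_AE)
      thus ?thesis by (simp add: dual_form_def)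
    qed
    show "dual_form ?D u (\<lambda>x. c * v x) = c * dual_form ?D u v" for c v
      by (simp add: dual_form_def mult.left_commute[of _ c])
    show "\<exists>\<delta>>0. \<forall>v\<in>?W. ?N v < \<delta> \<longrightarrow> \<bar>H_fun G s \<Omega> (\<lambda>x. u x + v x) - H_fun G s \<Omega> u
        - H_fun G s \<Omega> u * dual_form M (T u) (T v) / dual_form M (T u) (T u)\<bar> \<le> \<epsilon> * ?N v"
      if e: "\<epsilon> > 0" for \<epsilon>
    proof -
      have T_add: "AE x in M. T (\<lambda>x. u x + v x) x = T u x + T v x" if "v \<in> ?W" for v
        using lincomb[OF uW that, of 1 1] by simp
      show ?thesis
        using nrm_frechet_along[where T = T and M = M and W = ?W and N = ?N, OF space T_add HN uW Hu e]
          energy uW add[OF uW] by auto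
    qed
    show "\<exists>\<delta>>0. \<forall>v\<in>?W. ?N v < \<delta> \<longrightarrow> \<bar>I_fun G \<Omega> (\<lambda>x. u x + v x) - I_fun G \<Omega> u
        - I_fun G \<Omega> u * dual_form ?D u v / dual_form ?D u u\<bar> \<le> \<epsilon> * ?N v"
      if e: "\<epsilon> > 0" for \<epsilon>
    proof -
      have sp: "v \<in> orlicz_space ?D" and I_eq: "I_fun G \<Omega> v = nrm ?D v" if "v \<in> ?W" for v
        using W0_orlicz_space[OF op that] I_fun_eq_nrm[OF op that] by auto
      show ?thesis
        using nrm_frechet_along[where T = "\<lambda>v. v" and M = ?D and W = ?W and N = ?N, OF sp _ IN uW Iu e]
          I_eq uW add[OF uW] by auto
    qed
  qed
  have "critical_point ?W ?N (W0_sG_nonzero G s \<Omega>) (J_fun G s \<Omega>) u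
    \<longleftrightarrow> has_frechet_derivative_in ?W ?N (W0_sG_nonzero G s \<Omega>) (\<lambda>v. H_fun G s \<Omega> v / I_fun G \<Omega> v) (\<lambda>_. 0) u"
    using u by (simp add: critical_point_def J_fun_def[abs_def])
  also note quot
  also have "(\<exists>lam. \<forall>v\<in>?W. dual_form M (T u) (T v) = lam * dual_form ?D u v)
    \<longleftrightarrow> (\<exists>lam. weak_eigen_solution G g s \<Omega> lam u)"
    using uW by (simp add: weak_eigen_solution_def dual Hu dI_eq)
  finally show ?thesis .
qed

end

theorem theorem3p1:
  fixes \<Omega> :: "'a::euclidean_space set"
    and G g :: "real \<Rightarrow> real"
    and pm pp s :: real
    and u :: "'a \<Rightarrow> real"
  assumes "bounded_lipschitz_domain \<Omega>"
    and "young_function G g"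
    and "1 < pm" and "pm < pp"
    and "\<And>t. t > 0 \<Longrightarrow> pm - 1 \<le> t * deriv g t / g t \<and> t * deriv g t / g t \<le> pp - 1"
    and "0 < s" and "s \<le> 1"
    and "u \<in> W0_sG_nonzero G s \<Omega>"
  shows "critical_point (W0_sG G s \<Omega>) (\<lambda>v. enn2real (W_norm G s \<Omega> v))
           (W0_sG_nonzero G s \<Omega>) (J_fun G s \<Omega>) u
         \<longleftrightarrow> (\<exists>lam. weak_eigen_solution G g s \<Omega> lam u)"
proof -
  interpret orlicz G g pm pp
    using assms(2-5) by unfold_locales
  have op: "open \<Omega>" and bd: "bounded \<Omega>" using assms(1) by (auto simp: bounded_lipschitz_domain_def)
  have uW: "u \<in> W0_sG G s \<Omega>" using assms(8) by (simp add: W0_sG_nonzero_def)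
  show ?thesis
  proof (cases "s = 1")
    case True
    have wg: "\<exists>V. weak_gradient \<Omega> v V" if "v \<in> W0_sG G s \<Omega>" for v
      using that True by (auto simp: W0_sG_def W_sG_def)
    have gm: "grad \<Omega> v \<in> borel_measurable borel" if "v \<in> W0_sG G s \<Omega>" for v
      using wg[OF that] weak_gradient_grad by (auto simp: weak_gradient_def)
    have en: "energy_norm G s \<Omega> v = lux (domain_measure \<Omega>) (grad \<Omega> v)" if "v \<in> W0_sG G s \<Omega>" for v
      using wg[OF that] norm_grad_G_eq_lux[OF op] True by (auto simp: energy_norm_def)
    have H: "H_fun G s \<Omega> v = nrm (domain_measure \<Omega>) (grad \<Omega> v)" if "v \<in> W0_sG G s \<Omega>" for v
      by (simp add: H_fun_def nrm_def en[OF that])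
    show ?thesis
    proof (rule critical_point_iff_weak_eigen_solution[where T = "grad \<Omega>" and M = "domain_measure \<Omega>", OF op assms(8)])
      show "grad \<Omega> v \<in> orlicz_space (domain_measure \<Omega>)" if "v \<in> W0_sG G s \<Omega>" for v
        using gm[OF that] en[OF that] W0_energy_norm_finite[OF that] by (simp add: orlicz_space_def)
      show "AE x in domain_measure \<Omega>. grad \<Omega> (\<lambda>x. a * v x + b * w x) x = a *\<^sub>R grad \<Omega> v x + b *\<^sub>R grad \<Omega> w x"
        if "v \<in> W0_sG G s \<Omega>" "w \<in> W0_sG G s \<Omega>" for a b v w
        using wg[OF that(1)] wg[OF that(2)] grad_lincomb_AE[OF op] by (auto simp: AE_domain_measure[OF op])
      show "AE x in lborel. u x = 0" if "AE x in domain_measure \<Omega>. grad \<Omega> u x = 0"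
        using zero_gradient_imp_zero[OF op bd _ that] uW True by simp
      show "L_op G g s \<Omega> u v = dual_form (domain_measure \<Omega>) (grad \<Omega> u) (grad \<Omega> v)"
        if "v \<in> W0_sG G s \<Omega>" "nrm (domain_measure \<Omega>) (grad \<Omega> u) > 0" for v
        using dual_form_domain_measure[OF op gm[OF uW] gm[OF that(1)] that(2)] True H[OF uW]
        by (simp add: L_op_def)
    qed (rule H)
  next
    case False
    hence s1: "s < 1" using assms by simp
    have m: "D_s s v \<in> borel_measurable (lborel \<Otimes>\<^sub>M lborel)" if "v \<in> W0_sG G s \<Omega>" for v
      using W0_sG_measurable[OF that] by (rule measurable_D_s)
    have en: "energy_norm G s \<Omega> v = lux (pair_measure_s s) (D_s s v)" if "v \<in> W0_sG G s \<Omega>" for v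
      using seminorm_sG_eq_lux[OF W0_sG_measurable[OF that]] False by (simp add: energy_norm_def)
    have H: "H_fun G s \<Omega> v = nrm (pair_measure_s s) (D_s s v)" if "v \<in> W0_sG G s \<Omega>" for v
      by (simp add: H_fun_def nrm_def en[OF that])
    show ?thesis
    proof (rule critical_point_iff_weak_eigen_solution[where T = "D_s s" and M = "pair_measure_s s", OF op assms(8)])
      show "D_s s v \<in> orlicz_space (pair_measure_s s)" if "v \<in> W0_sG G s \<Omega>" for v
        using m[OF that] en[OF that] W0_energy_norm_finite[OF that] by (simp add: orlicz_space_def)
      show "AE x in pair_measure_s s. D_s s (\<lambda>x. a * v x + b * w x) x = a *\<^sub>R D_s s v x + b *\<^sub>R D_s s w x"
        for a b and v w :: "'a \<Rightarrow> real"
        by (intro AE_I2 D_s_lincomb)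
      show "AE x in lborel. u x = 0" if "AE z in pair_measure_s s. D_s s u z = 0"
        using zero_D_s_imp_zero[OF op bd s1 _ that] uW by (auto simp: W0_sG_def W_sG_def)
      show "L_op G g s \<Omega> u v = dual_form (pair_measure_s s) (D_s s u) (D_s s v)"
        if "v \<in> W0_sG G s \<Omega>" "nrm (pair_measure_s s) (D_s s u) > 0" for v
        using dual_form_pair_measure_s[OF s1 m[OF uW] m[OF that(1)] that(2)] False H[OF uW]
        by (simp add: L_op_def)
    qed (rule H)
  qed
qed

end
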